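(* Let $\Gamma$ be an embedded network, let $\widetilde{\mathcal H}=\{\widetilde H_\gamma\}_{\gamma\in\mathcal E}$ be a Hamiltonian on $\Gamma$ with each $\widetilde H_\gamma$ continuous in both arguments, convex in $\mu$, and coercive in $\mu$ uniformly in $s$. Let $(c_x)_{x\in\mathbf V}$ be a flux limiter and let $u_0\in C(\Gamma)$. Then a locally bounded function $u:\Gamma\times\mathbb R^+\to\mathbb R$ is a viscosity solution to $$\partial_t u(x,t)+\widetilde{\mathcal H}(x,D_xu)=0\quad\text{on }\Gamma\times(0,\infty)$$ with flux limiter $c_x$ and initial datum $u_0$ if and only if it is a flux limited solution to the same equation with flux limiter $c_x$ and initial datum $u_0$. (The notions "viscosity solution" and "flux limited solution" are those defined in the context.)
   Context: **Network.** Fix $N\ge1$. An embedded network is a set $\Gamma=\bigcup_{\gamma\in\mathcal E}\gamma([0,|\gamma|])\subset\mathbb R^N$, where $\mathcal E$ is a finite collection of regular ($C^1$ with non-vanishing derivative, with one-sided derivatives at the endpoints) simple oriented curves $\gamma:[0,|\gamma|]\to\mathbb R^N$, called arcs, of Euclidean length $|\gamma|$ and parametrized by arc length. For every arc $\gamma$ the inverse arc $\widetilde\gamma(s):=\gamma(|\gamma|-s)$ also belongs to $\mathcal E$, and $\gamma((0,|\gamma|))\cap\gamma'((0,|\gamma'|))=\emptyset$ whenever $\gamma'\ne\gamma,\widetilde\gamma$. Vertices are the initial and terminal points of the arcs; $\mathbf V$ is the set of vertices, and $\gamma((0,|\gamma|))\cap\mathbf V=\emptyset$ for all $\gamma$.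 The network is connected (any two vertices are linked by a finite concatenation of arcs) and $\mathcal E$ contains no loops (arcs with coinciding initial and final point). An orientation $\mathcal E^+\subset\mathcal E$ containing exactly one arc of each pair $\{\gamma,\widetilde\gamma\}$ is fixed, and $\mathcal E_x^+:=\{\gamma\in\mathcal E^+:\gamma(s)=x\text{ for some }s\in[0,|\gamma|]\}$. Here $\mathbb R^+=[0,\infty)$. $C^1(\Gamma\times\mathbb R^+)$ is the set of continuous functions $\Phi:\Gamma\times\mathbb R^+\to\mathbb R$ such that $(s,t)\mapsto\Phi(\gamma(s),t)$ is $C^1$ on $[0,|\gamma|]\times\mathbb R^+$ for every $\gamma\in\mathcal E$. For $x\in\mathbf V$, $\partial_x\Phi(x,t)$ denotes the family $\{\partial_s[\Phi(\gamma(s),t)]_{s=0}\}_{\{\gamma\in\mathcal E:\gamma(0)=x\}}$. **Hamiltonian.** A Hamiltonian on $\Gamma$ is a collection $\widetilde{\mathcal H}=\{\widetilde H_\gamma\}_{\gamma\in\mathcal E}$ of functions $\widetilde H_\gamma:[0,|\gamma|]\times\mathbb R\to\mathbb R$, $(s,\mu)\mapsto\widetilde H_\gamma(s,\mu)$, with $\widetilde H_{\widetilde\gamma}(s,\mu)=\widetilde H_\gamma(|\gamma|-s,-\mu)$; otherwise they are unrelated. The equation $\partial_tu+\widetilde{\mathcal H}(x,D_xu)=0$ on $\Gamma\times(0,\infty)$ stands for the family of local equations $$(\mathrm{HJ}_\gamma)\qquad\partial_tU(s,t)+\widetilde H_\gamma(s,\partial_sU(s,t))=0\quad\text{on }(0,|\gamma|)\times(0,\infty),\qquad\gamma\in\mathcal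 E,$$ whose sub/supersolutions are understood in the usual viscosity sense. A flux limiter is a function $x\mapsto c_x$ from $\mathbf V$ to $\mathbb R$ with $c_x\le-\max_{\gamma\in\mathcal E_x^+,\,s\in[0,|\gamma|]}\min_{\mu\in\mathbb R}\widetilde H_\gamma(s,\mu)$ for all $x\in\mathbf V$. **Test functions.** A supertangent (resp. subtangent) to $u$ at a point is a function $\varphi$ such that $u-\varphi$ has a local maximum (resp. local minimum) at that point. For an open set $\mathcal O$ and a function $u$ on $\overline{\mathcal O}$, a subtangent $\varphi$ at $z\in\partial\mathcal O$ is constrained to $\overline{\mathcal O}$ if $z$ minimizes $u-\varphi$ on the intersection of a neighborhood of $z$ with $\overline{\mathcal O}$. Below, "constrained subtangent at $(0,t_0)$" refers to $\mathcal O=(0,|\gamma|)\times(0,\infty)$. **Viscosity solution (with flux limiter $c_x$).** A continuous $w:\Gamma\times\mathbb R^+\to\mathbb R$ is a viscosity subsolution if (i) $(s,t)\mapsto w(\gamma(s),t)$ is a viscosity subsolution of $(\mathrm{HJ}_\gamma)$ for every $\gamma\in\mathcal E^+$; (ii) for every $t_0>0$ and vertex $x$, if $\psi$ is a $C^1$ supertangent to $w(x,\cdot)$ at $t_0$, then $\partial_t\psi(t_0)\le c_x$. A continuous $v:\Gamma\times\mathbb R^+\to\mathbb R$ is a viscosity supersolution if (iii) $(s,t)\mapsto v(\gamma(s),t)$ is a viscosity supersolution of $(\mathrm{HJ}_\gamma)$ for every $\gamma\in\mathcal E^+$; (iv) for every vertex $x$ and $t_0>0$, if $\psi$ is a $C^1$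 subtangent to $v(x,\cdot)$ at $t_0$ with $\partial_t\psi(t_0)<c_x$, then there is $\gamma\in\mathcal E$ with $\gamma(0)=x$ such that $\partial_t\varphi(0,t_0)+\widetilde H_\gamma(0,\partial_s\varphi(0,t_0))\ge0$ for every constrained $C^1$ subtangent $\varphi$ to $(s,t)\mapsto v(\gamma(s),t)$ at $(0,t_0)$ (existence of such $\varphi$ is not required). A viscosity solution is a function that is both (in particular it is continuous). It has initial datum $u_0$ if $u(\cdot,0)=u_0$. **Flux limited solution (with flux limiter $c_x$).** For each $\gamma\in\mathcal E$ let $\widehat\mu_\gamma$ be a minimizer of $\mu\mapsto\widetilde H_\gamma(0,\mu)$ and set $\widetilde H_\gamma^-(s,\mu):=\widetilde H_\gamma(s,\mu)$ for $\mu\le\widehat\mu_\gamma$, $\widetilde H_\gamma^-(s,\mu):=\widetilde H_\gamma(s,\widehat\mu_\gamma)$ for $\mu>\widehat\mu_\gamma$. For $x\in\mathbf V$ and a family of real numbers $p=\{p_\gamma\}_{\{\gamma:\gamma(0)=x\}}$ (the arc-derivatives at $x$) set $$\widetilde F(x,p):=\max\Big\{-c_x,\max_{\{\gamma\in\mathcal E:\gamma(0)=x\}}\widetilde H^-_\gamma(0,p_\gamma)\Big\}.$$ For a locally bounded $u:\Gamma\times\mathbb R^+\to\mathbb R$ let $u^*(x,t):=\limsup_{(y,r)\to(x,t)}u(y,r)$ and $u_*(x,t):=\liminf_{(y,r)\to(x,t)}u(y,r)$ be its upper and lower semicontinuous envelopes on $\Gamma\times\mathbb R^+$. A locally bounded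 $w$ is a flux limited subsolution if (i) $(s,t)\mapsto w^*(\gamma(s),t)$ is a viscosity subsolution of $(\mathrm{HJ}_\gamma)$ for all $\gamma\in\mathcal E$; (ii) for all $(x,t_0)\in\mathbf V\times(0,\infty)$ and every $C^1(\Gamma\times\mathbb R^+)$ supertangent $\Psi$ to $w^*$ at $(x,t_0)$, $\partial_t\Psi(x,t_0)+\widetilde F(x,\partial_x\Psi(x,t_0))\le0$. A locally bounded $v$ is a flux limited supersolution if (iii) $(s,t)\mapsto v_*(\gamma(s),t)$ is a viscosity supersolution of $(\mathrm{HJ}_\gamma)$ for all $\gamma\in\mathcal E$; (iv) for all $(x,t_0)\in\mathbf V\times(0,\infty)$ and every $C^1(\Gamma\times\mathbb R^+)$ subtangent $\Phi$ to $v_*$ at $(x,t_0)$, $\partial_t\Phi(x,t_0)+\widetilde F(x,\partial_x\Phi(x,t_0))\ge0$. A flux limited solution is a function that is both. It has initial datum $u_0$ if $u^*(\cdot,0)\le u_0\le u_*(\cdot,0)$ on $\Gamma$. *)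

theory Defs
  imports "HOL-Analysis.Analysis"
begin

section \<open>Embedded networks\<close>

text \<open>
  An arc is a length together with a curve on \<open>[0, length]\<close>.  Curves of a network are required to
  be \<open>extensional\<close> on that interval, so that equality of arcs is equality of the curves as maps
  on \<open>[0, length]\<close>.
\<close>

datatype 'a net_arc = Net_Arc (len: real) (crv: "real \<Rightarrow> 'a")

definition regular_arc :: "'a::euclidean_space net_arc \<Rightarrow> bool" where
  "regular_arc \<gamma> \<longleftrightarrow>
     0 < len \<gamma> \<and>
     crv \<gamma> \<in> extensional {0..len \<gamma>} \<and>
     (\<exists>D. continuous_on {0..len \<gamma>} D \<and>
          (\<forall>s\<in>{0..len \<gamma>}. (crv \<gamma> has_vector_derivative D s) (at s within {0..len \<gamma>}) \<and>
                          norm (D s) = 1))"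

text \<open>
  Unit speed is parametrization by arc length; it makes \<open>len \<gamma>\<close> the Euclidean length and the
  derivative non-vanishing.  As usual, a simple curve may close up at its end points.
\<close>

definition simple_arc :: "'a net_arc \<Rightarrow> bool" where
  "simple_arc \<gamma> \<longleftrightarrow>
     (\<forall>s\<in>{0..len \<gamma>}. \<forall>r\<in>{0..len \<gamma>}. s < r \<and> crv \<gamma> s = crv \<gamma> r \<longrightarrow> s = 0 \<and> r = len \<gamma>)"

definition inv_arc :: "'a net_arc \<Rightarrow> 'a net_arc" where
  "inv_arc \<gamma> = Net_Arc (len \<gamma>) (restrict (\<lambda>s. crv \<gamma> (len \<gamma> - s)) {0..len \<gamma>})"

definition arc_interior :: "'a net_arc \<Rightarrow> 'a set" where
  "arc_interior \<gamma> = crv \<gamma> ` {0<..<len \<gamma>}"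

definition network :: "'a net_arc set \<Rightarrow> 'a set" where
  "network E = (\<Union>\<gamma>\<in>E. crv \<gamma> ` {0..len \<gamma>})"

definition vertices :: "'a net_arc set \<Rightarrow> 'a set" where
  "vertices E = (\<Union>\<gamma>\<in>E. {crv \<gamma> 0, crv \<gamma> (len \<gamma>)})"

definition embedded_network :: "'a::euclidean_space net_arc set \<Rightarrow> bool" where
  "embedded_network E \<longleftrightarrow>
     finite E \<and>
     (\<forall>\<gamma>\<in>E. regular_arc \<gamma> \<and> simple_arc \<gamma> \<and> crv \<gamma> 0 \<noteq> crv \<gamma> (len \<gamma>)) \<and>
     (\<forall>\<gamma>\<in>E. inv_arc \<gamma> \<in> E) \<and>
     (\<forall>\<gamma>\<in>E. \<forall>\<gamma>'\<in>E. \<gamma>' \<noteq> \<gamma> \<and> \<gamma>' \<noteq> inv_arc \<gamma> \<longrightarrow> arc_interior \<gamma> \<inter> arc_interior \<gamma>' = {}) \<and>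
     (\<forall>\<gamma>\<in>E. arc_interior \<gamma> \<inter> vertices E = {}) \<and>
     (\<forall>x\<in>vertices E. \<forall>y\<in>vertices E. (x, y) \<in> {(crv \<gamma> 0, crv \<gamma> (len \<gamma>)) |\<gamma>. \<gamma> \<in> E}\<^sup>*)"

definition orientation_of :: "'a net_arc set \<Rightarrow> 'a net_arc set \<Rightarrow> bool" where
  "orientation_of E Ep \<longleftrightarrow> Ep \<subseteq> E \<and> (\<forall>\<gamma>\<in>E. (\<gamma> \<in> Ep) \<noteq> (inv_arc \<gamma> \<in> Ep))"

definition arcs_through :: "'a net_arc set \<Rightarrow> 'a \<Rightarrow> 'a net_arc set" where
  "arcs_through Ep x = {\<gamma> \<in> Ep. \<exists>s\<in>{0..len \<gamma>}. crv \<gamma> s = x}"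

definition arcs_from :: "'a net_arc set \<Rightarrow> 'a \<Rightarrow> 'a net_arc set" where
  "arcs_from E x = {\<gamma> \<in> E. crv \<gamma> 0 = x}"


section \<open>Hamiltonians and flux limiters\<close>

type_synonym 'a hamilt = "'a net_arc \<Rightarrow> real \<Rightarrow> real \<Rightarrow> real"

definition hamiltonian :: "'a net_arc set \<Rightarrow> 'a hamilt \<Rightarrow> bool" where
  "hamiltonian E H \<longleftrightarrow>
     (\<forall>\<gamma>\<in>E. \<forall>s\<in>{0..len \<gamma>}. \<forall>\<mu>. H (inv_arc \<gamma>) s \<mu> = H \<gamma> (len \<gamma> - s) (- \<mu>))"

definition coercive_uniformly :: "real set \<Rightarrow> (real \<Rightarrow> real \<Rightarrow> real) \<Rightarrow> bool" where
  "coercive_uniformly S h \<longleftrightarrow> (\<forall>M. \<forall>\<^sub>F \<mu> in at_infinity. \<forall>s\<in>S. M \<le> h s \<mu>)"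

text \<open>
  For continuous, uniformly coercive Hamiltonians and a vertex \<open>x\<close>, the infimum and the supremum
  below are attained.
\<close>

definition flux_limiter ::
    "'a net_arc set \<Rightarrow> 'a net_arc set \<Rightarrow> 'a hamilt \<Rightarrow> ('a \<Rightarrow> real) \<Rightarrow> bool" where
  "flux_limiter E Ep H c \<longleftrightarrow>
     (\<forall>x\<in>vertices E.
        c x \<le> - (SUP (\<gamma>, s)\<in>(SIGMA \<gamma>:arcs_through Ep x. {0..len \<gamma>}). INF \<mu>. H \<gamma> s \<mu>))"


section \<open>Test functions\<close>

definition supertangent ::
    "'b::topological_space set \<Rightarrow> ('b \<Rightarrow> real) \<Rightarrow> ('b \<Rightarrow> real) \<Rightarrow> 'b \<Rightarrow> bool" where
  "supertangent S u \<phi> z \<longleftrightarrow> (\<forall>\<^sub>F y in at z within S. u y - \<phi> y \<le> u z - \<phi> z)"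

definition subtangent ::
    "'b::topological_space set \<Rightarrow> ('b \<Rightarrow> real) \<Rightarrow> ('b \<Rightarrow> real) \<Rightarrow> 'b \<Rightarrow> bool" where
  "subtangent S u \<phi> z \<longleftrightarrow> (\<forall>\<^sub>F y in at z within S. u z - \<phi> z \<le> u y - \<phi> y)"

text \<open>
  Continuous differentiability relative to \<open>S\<close>, i.e. with one-sided derivatives at points of \<open>S\<close>
  on its boundary.
\<close>

definition C1_on :: "(real \<times> real) set \<Rightarrow> (real \<times> real \<Rightarrow> real) \<Rightarrow> bool" where
  "C1_on S \<phi> \<longleftrightarrow>
     (\<exists>p q. continuous_on S p \<and> continuous_on S q \<and>
        (\<forall>z\<in>S. (\<phi> has_derivative (\<lambda>(h, k). p z * h + q z * k)) (at z within S)))"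

definition partial_s :: "real set \<Rightarrow> (real \<times> real \<Rightarrow> real) \<Rightarrow> real \<Rightarrow> real \<Rightarrow> real" where
  "partial_s I \<phi> s t = vector_derivative (\<lambda>r. \<phi> (r, t)) (at s within I)"

text \<open>Only used at positive times, so that no one-sided time derivative is needed.\<close>

definition partial_t :: "('b \<times> real \<Rightarrow> real) \<Rightarrow> 'b \<Rightarrow> real \<Rightarrow> real" where
  "partial_t \<phi> x t = vector_derivative (\<lambda>r. \<phi> (x, r)) (at t)"

definition along :: "'a net_arc \<Rightarrow> ('a \<times> real \<Rightarrow> real) \<Rightarrow> real \<times> real \<Rightarrow> real" where
  "along \<gamma> u = (\<lambda>(s, t). u (crv \<gamma> s, t))"

definition C1_network :: "'a::euclidean_space net_arc set \<Rightarrow> ('a \<times> real \<Rightarrow> real) \<Rightarrow> bool" where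
  "C1_network E \<Phi> \<longleftrightarrow>
     continuous_on (network E \<times> {0..}) \<Phi> \<and>
     (\<forall>\<gamma>\<in>E. C1_on ({0..len \<gamma>} \<times> {0..}) (along \<gamma> \<Phi>))"

definition arc_derivs :: "('a \<times> real \<Rightarrow> real) \<Rightarrow> real \<Rightarrow> 'a net_arc \<Rightarrow> real" where
  "arc_derivs \<Phi> t = (\<lambda>\<gamma>. partial_s {0..len \<gamma>} (along \<gamma> \<Phi>) 0 t)"

text \<open>
  The family \<open>\<partial>\<^sub>x \<Phi>(x, t)\<close> consists of the values of \<open>arc_derivs \<Phi> t\<close> at the arcs in
  \<open>arcs_from E x\<close>.
\<close>


section \<open>Viscosity solutions\<close>

text \<open>
  Sub- and supersolutions of \<open>\<partial>\<^sub>t U + h(s, \<partial>\<^sub>s U) = 0\<close> on \<open>(0, L) \<times> (0, \<infinity>)\<close>.  Semicontinuity of \<open>U\<close>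
  is not part of the definition; it holds automatically wherever these notions are used below.
\<close>

definition HJ_subsolution ::
    "real \<Rightarrow> (real \<Rightarrow> real \<Rightarrow> real) \<Rightarrow> (real \<times> real \<Rightarrow> real) \<Rightarrow> bool" where
  "HJ_subsolution L h U \<longleftrightarrow>
     (\<forall>s0\<in>{0<..<L}. \<forall>t0>0. \<forall>\<phi>.
        C1_on ({0<..<L} \<times> {0<..}) \<phi> \<and> supertangent ({0<..<L} \<times> {0<..}) U \<phi> (s0, t0) \<longrightarrow>
        partial_t \<phi> s0 t0 + h s0 (partial_s {0<..<L} \<phi> s0 t0) \<le> 0)"

definition HJ_supersolution ::
    "real \<Rightarrow> (real \<Rightarrow> real \<Rightarrow> real) \<Rightarrow> (real \<times> real \<Rightarrow> real) \<Rightarrow> bool" where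
  "HJ_supersolution L h U \<longleftrightarrow>
     (\<forall>s0\<in>{0<..<L}. \<forall>t0>0. \<forall>\<phi>.
        C1_on ({0<..<L} \<times> {0<..}) \<phi> \<and> subtangent ({0<..<L} \<times> {0<..}) U \<phi> (s0, t0) \<longrightarrow>
        partial_t \<phi> s0 t0 + h s0 (partial_s {0<..<L} \<phi> s0 t0) \<ge> 0)"

definition viscosity_subsolution ::
    "'a::euclidean_space net_arc set \<Rightarrow> 'a net_arc set \<Rightarrow> 'a hamilt \<Rightarrow> ('a \<Rightarrow> real) \<Rightarrow>
     ('a \<times> real \<Rightarrow> real) \<Rightarrow> bool" where
  "viscosity_subsolution E Ep H c w \<longleftrightarrow>
     continuous_on (network E \<times> {0..}) w \<and>
     (\<forall>\<gamma>\<in>Ep. HJ_subsolution (len \<gamma>) (H \<gamma>) (along \<gamma> w)) \<and>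
     (\<forall>x\<in>vertices E. \<forall>t0>0. \<forall>\<psi>.
        \<psi> C1_differentiable_on {0<..} \<and> supertangent {0<..} (\<lambda>t. w (x, t)) \<psi> t0 \<longrightarrow>
        deriv \<psi> t0 \<le> c x)"

definition viscosity_supersolution ::
    "'a::euclidean_space net_arc set \<Rightarrow> 'a net_arc set \<Rightarrow> 'a hamilt \<Rightarrow> ('a \<Rightarrow> real) \<Rightarrow>
     ('a \<times> real \<Rightarrow> real) \<Rightarrow> bool" where
  "viscosity_supersolution E Ep H c v \<longleftrightarrow>
     continuous_on (network E \<times> {0..}) v \<and>
     (\<forall>\<gamma>\<in>Ep. HJ_supersolution (len \<gamma>) (H \<gamma>) (along \<gamma> v)) \<and>
     (\<forall>x\<in>vertices E. \<forall>t0>0. \<forall>\<psi>.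
        \<psi> C1_differentiable_on {0<..} \<and> subtangent {0<..} (\<lambda>t. v (x, t)) \<psi> t0 \<and>
        deriv \<psi> t0 < c x \<longrightarrow>
        (\<exists>\<gamma>\<in>arcs_from E x. \<forall>\<phi>.
           C1_on ({0..len \<gamma>} \<times> {0..}) \<phi> \<and>
           subtangent ({0..len \<gamma>} \<times> {0..}) (along \<gamma> v) \<phi> (0, t0) \<longrightarrow>
           partial_t \<phi> 0 t0 + H \<gamma> 0 (partial_s {0..len \<gamma>} \<phi> 0 t0) \<ge> 0))"

definition viscosity_solution ::
    "'a::euclidean_space net_arc set \<Rightarrow> 'a net_arc set \<Rightarrow> 'a hamilt \<Rightarrow> ('a \<Rightarrow> real) \<Rightarrow>
     ('a \<Rightarrow> real) \<Rightarrow> ('a \<times> real \<Rightarrow> real) \<Rightarrow> bool" where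
  "viscosity_solution E Ep H c u0 u \<longleftrightarrow>
     viscosity_subsolution E Ep H c u \<and> viscosity_supersolution E Ep H c u \<and>
     (\<forall>x\<in>network E. u (x, 0) = u0 x)"


section \<open>Flux limited solutions\<close>

definition locally_bounded :: "'b::metric_space set \<Rightarrow> ('b \<Rightarrow> real) \<Rightarrow> bool" where
  "locally_bounded S u \<longleftrightarrow> (\<forall>z\<in>S. \<exists>e>0. bounded (u ` (S \<inter> ball z e)))"

text \<open>
  Semicontinuous envelopes relative to \<open>S\<close>.  The point \<open>z\<close> itself is allowed in the limsup and
  liminf, hence the unpunctured neighbourhood filter instead of \<open>at z within S\<close>.  For locally
  bounded \<open>u\<close> and \<open>z \<in> S\<close> the extended real limits are finite.
\<close>

definition usc_envelope :: "'b::topological_space set \<Rightarrow> ('b \<Rightarrow> real) \<Rightarrow> 'b \<Rightarrow> real" where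
  "usc_envelope S u z = real_of_ereal (Limsup (inf (nhds z) (principal S)) (\<lambda>y. ereal (u y)))"

definition lsc_envelope :: "'b::topological_space set \<Rightarrow> ('b \<Rightarrow> real) \<Rightarrow> 'b \<Rightarrow> real" where
  "lsc_envelope S u z = real_of_ereal (Liminf (inf (nhds z) (principal S)) (\<lambda>y. ereal (u y)))"

text \<open>The argument \<open>m\<close> assigns to each arc \<open>\<gamma>\<close> the chosen minimizer of \<open>H \<gamma> 0\<close>.\<close>

definition H_minus :: "'a hamilt \<Rightarrow> ('a net_arc \<Rightarrow> real) \<Rightarrow> 'a hamilt" where
  "H_minus H m \<gamma> s \<mu> = (if \<mu> \<le> m \<gamma> then H \<gamma> s \<mu> else H \<gamma> s (m \<gamma>))"

definition flux_F ::
    "'a net_arc set \<Rightarrow> 'a hamilt \<Rightarrow> ('a net_arc \<Rightarrow> real) \<Rightarrow> ('a \<Rightarrow> real) \<Rightarrow>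
     'a \<Rightarrow> ('a net_arc \<Rightarrow> real) \<Rightarrow> real" where
  "flux_F E H m c x p = max (- c x) (MAX \<gamma>\<in>arcs_from E x. H_minus H m \<gamma> 0 (p \<gamma>))"

definition flux_limited_subsolution ::
    "'a::euclidean_space net_arc set \<Rightarrow> 'a hamilt \<Rightarrow> ('a net_arc \<Rightarrow> real) \<Rightarrow> ('a \<Rightarrow> real) \<Rightarrow>
     ('a \<times> real \<Rightarrow> real) \<Rightarrow> bool" where
  "flux_limited_subsolution E H m c w \<longleftrightarrow>
     (let Q = network E \<times> {0..}; w' = usc_envelope Q w in
       locally_bounded Q w \<and>
       (\<forall>\<gamma>\<in>E. HJ_subsolution (len \<gamma>) (H \<gamma>) (along \<gamma> w')) \<and>
       (\<forall>x\<in>vertices E. \<forall>t0>0. \<forall>\<Psi>. C1_network E \<Psi> \<and> supertangent Q w' \<Psi> (x, t0) \<longrightarrow>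
          partial_t \<Psi> x t0 + flux_F E H m c x (arc_derivs \<Psi> t0) \<le> 0))"

definition flux_limited_supersolution ::
    "'a::euclidean_space net_arc set \<Rightarrow> 'a hamilt \<Rightarrow> ('a net_arc \<Rightarrow> real) \<Rightarrow> ('a \<Rightarrow> real) \<Rightarrow>
     ('a \<times> real \<Rightarrow> real) \<Rightarrow> bool" where
  "flux_limited_supersolution E H m c v \<longleftrightarrow>
     (let Q = network E \<times> {0..}; v' = lsc_envelope Q v in
       locally_bounded Q v \<and>
       (\<forall>\<gamma>\<in>E. HJ_supersolution (len \<gamma>) (H \<gamma>) (along \<gamma> v')) \<and>
       (\<forall>x\<in>vertices E. \<forall>t0>0. \<forall>\<Phi>. C1_network E \<Phi> \<and> subtangent Q v' \<Phi> (x, t0) \<longrightarrow>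
          partial_t \<Phi> x t0 + flux_F E H m c x (arc_derivs \<Phi> t0) \<ge> 0))"

definition flux_limited_solution ::
    "'a::euclidean_space net_arc set \<Rightarrow> 'a hamilt \<Rightarrow> ('a net_arc \<Rightarrow> real) \<Rightarrow> ('a \<Rightarrow> real) \<Rightarrow>
     ('a \<Rightarrow> real) \<Rightarrow> ('a \<times> real \<Rightarrow> real) \<Rightarrow> bool" where
  "flux_limited_solution E H m c u0 u \<longleftrightarrow>
     flux_limited_subsolution E H m c u \<and> flux_limited_supersolution E H m c u \<and>
     (\<forall>x\<in>network E. usc_envelope (network E \<times> {0..}) u (x, 0) \<le> u0 x \<and>
                    u0 x \<le> lsc_envelope (network E \<times> {0..}) u (x, 0))"

end

theory Submission
  imports Defs
begin

text \<open>
  All notions are translated into first-order jets along the arcs: a jet is realised by a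
  \<open>C1\<close> test function, along an arc or on the whole network, by adding a smooth modulus of its
  remainder.  Subsolutions are handled by transport: since \<open>h s p \<ge> - \<nu> p - \<kappa>\<close>, they grow at
  rate at most \<open>\<kappa>\<close> along lines of speed \<open>\<nu>\<close>.  For supersolutions, a jet \<open>(p, a)\<close> at a vertex
  with \<open>a + h 0 p < 0\<close> can always be replaced by one with larger slope (critical slopes).

  A flux limited solution is continuous by comparison of its envelopes \<open>w\<close> and \<open>v\<close>.  Doubling only
  the time variable, at a maximum point of \<open>w - v\<close> the transport inequalities for \<open>w\<close> bound the
  slopes of the lower jets of \<open>v\<close> on each branch from below, and the critical slope property then
  yields lower jets whose slopes are the minimizers of the Hamiltonians, which contradicts the
  junction condition for \<open>v\<close>.  Interior points of arcs are junctions with two branches.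

  For the supersolution condition at a vertex, suppose that every arc has a jet \<open>(p', a')\<close> with
  \<open>a' + h 0 p' < 0\<close>.  The jets form a closed convex set, so moving along the segment to \<open>(m, a)\<close> with
  the critical slope property shows that \<open>(m, a)\<close> is a jet on every arc, and the junction
  condition fails.
\<close>

section \<open>Jets\<close>

text \<open>Doubling only the time variable compares both functions at the same point of the
  network, so Hamiltonians of different arcs, which are unrelated, never meet in one inequality. The
  price is that the maximum point supplies a time slope for each function but no space derivative.
  Transport replaces the latter: an affine minorant of h turns the equation for w into a bound on
  its growth along a line ending at the point, and the maximum property hands this bound to v. At a
  vertex such a line must run against increasing s, and exactly there the decreasing part
  \<open>H_minus\<close> is strong enough: it controls b - \<nu> p for every \<nu> > 0. The
  minimizers m are the slopes to aim for, since at p = m the function F equals -c_x by the bound on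
  the flux limiter; the condition for v then reads a \<ge> c_x, while w gives b \<le> c_x. The time
  penalty contributes a strictly increasing term, which makes a < b and closes the argument. At an
  interior point the minimum of the Hamiltonian there plays the role of -c_x.\<close>

definition lower_jet ::
    "(real \<times> real) set \<Rightarrow> (real \<times> real \<Rightarrow> real) \<Rightarrow> real \<Rightarrow> real \<Rightarrow> real \<Rightarrow> real \<Rightarrow> bool" where
  "lower_jet S f s t p a \<longleftrightarrow>
     (\<forall>\<epsilon>>0. \<exists>d>0. \<forall>h k. \<bar>h\<bar> < d \<longrightarrow> \<bar>k\<bar> < d \<longrightarrow> (s + h, t + k) \<in> S \<longrightarrow>
        f (s, t) + p * h + a * k - \<epsilon> * (\<bar>h\<bar> + \<bar>k\<bar>) \<le> f (s + h, t + k))"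

text \<open>Superdifferentials are subdifferentials of the negative function with negated slopes.
  Being an abbreviation, it lets every lemma on lower jets apply to upper ones directly.\<close>

abbreviation upper_jet ::
    "(real \<times> real) set \<Rightarrow> (real \<times> real \<Rightarrow> real) \<Rightarrow> real \<Rightarrow> real \<Rightarrow> real \<Rightarrow> real \<Rightarrow> bool" where
  "upper_jet S f s t p a \<equiv> lower_jet S (\<lambda>z. - f z) s t (- p) (- a)"

lemma lower_jetI:
  assumes "\<And>\<epsilon>. \<epsilon> > 0 \<Longrightarrow> \<exists>d>0. \<forall>h k. \<bar>h\<bar> < d \<longrightarrow> \<bar>k\<bar> < d \<longrightarrow> (s + h, t + k) \<in> S \<longrightarrow>
        f (s, t) + p * h + a * k - \<epsilon> * (\<bar>h\<bar> + \<bar>k\<bar>) \<le> f (s + h, t + k)"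
  shows "lower_jet S f s t p a"
  using assms unfolding lower_jet_def by blast

lemma lower_jetD:
  assumes "lower_jet S f s t p a" "\<epsilon> > 0"
  obtains d where "d > 0" "\<And>h k. \<bar>h\<bar> < d \<Longrightarrow> \<bar>k\<bar> < d \<Longrightarrow> (s + h, t + k) \<in> S \<Longrightarrow>
        f (s, t) + p * h + a * k - \<epsilon> * (\<bar>h\<bar> + \<bar>k\<bar>) \<le> f (s + h, t + k)"
  using assms unfolding lower_jet_def by blast

lemma upper_jetD:
  assumes "upper_jet S f s t p a" "\<epsilon> > 0"
  obtains d where "d > 0" "\<And>h k. \<bar>h\<bar> < d \<Longrightarrow> \<bar>k\<bar> < d \<Longrightarrow> (s + h, t + k) \<in> S \<Longrightarrow>
        f (s + h, t + k) \<le> f (s, t) + p * h + a * k + \<epsilon> * (\<bar>h\<bar> + \<bar>k\<bar>)"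
proof -
  from lower_jetD[OF assms] obtain d where "d > 0" "\<And>h k. \<bar>h\<bar> < d \<Longrightarrow> \<bar>k\<bar> < d \<Longrightarrow> (s + h, t + k) \<in> S \<Longrightarrow>
        - f (s, t) + (-p) * h + (-a) * k - \<epsilon> * (\<bar>h\<bar> + \<bar>k\<bar>) \<le> - f (s + h, t + k)"
    by blast
  then show ?thesis by (intro that[of d]) (force simp: algebra_simps)+
qed

lemma upper_jetI:
  assumes "\<And>\<epsilon>. \<epsilon> > 0 \<Longrightarrow> \<exists>d>0. \<forall>h k. \<bar>h\<bar> < d \<longrightarrow> \<bar>k\<bar> < d \<longrightarrow> (s + h, t + k) \<in> S \<longrightarrow>
        f (s + h, t + k) \<le> f (s, t) + p * h + a * k + \<epsilon> * (\<bar>h\<bar> + \<bar>k\<bar>)"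
  shows "upper_jet S f s t p a"
proof (rule lower_jetI)
  fix \<epsilon> :: real assume "\<epsilon> > 0"
  from assms[OF this] obtain d where d: "d > 0" "\<And>h k. \<bar>h\<bar> < d \<Longrightarrow> \<bar>k\<bar> < d \<Longrightarrow> (s + h, t + k) \<in> S \<Longrightarrow>
        f (s + h, t + k) \<le> f (s, t) + p * h + a * k + \<epsilon> * (\<bar>h\<bar> + \<bar>k\<bar>)" by blast
  then show "\<exists>d>0. \<forall>h k. \<bar>h\<bar> < d \<longrightarrow> \<bar>k\<bar> < d \<longrightarrow> (s + h, t + k) \<in> S \<longrightarrow>
        - f (s, t) + - p * h + - a * k - \<epsilon> * (\<bar>h\<bar> + \<bar>k\<bar>) \<le> - f (s + h, t + k)"
    by (intro exI[of _ d]) (force simp: algebra_simps)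
qed

lemma lower_jet_local:
  assumes "lower_jet S f s t p a"
    and "d > 0" "\<And>h k. \<bar>h\<bar> < d \<Longrightarrow> \<bar>k\<bar> < d \<Longrightarrow> (s + h, t + k) \<in> S' \<Longrightarrow> (s + h, t + k) \<in> S"
  shows "lower_jet S' f s t p a"
proof (rule lower_jetI)
  fix \<epsilon> :: real assume "\<epsilon> > 0"
  from lower_jetD[OF assms(1) this] obtain e where "e > 0" "\<And>h k. \<bar>h\<bar> < e \<Longrightarrow> \<bar>k\<bar> < e \<Longrightarrow> (s + h, t + k) \<in> S \<Longrightarrow>
        f (s, t) + p * h + a * k - \<epsilon> * (\<bar>h\<bar> + \<bar>k\<bar>) \<le> f (s + h, t + k)" by blast
  then show "\<exists>d>0. \<forall>h k. \<bar>h\<bar> < d \<longrightarrow> \<bar>k\<bar> < d \<longrightarrow> (s + h, t + k) \<in> S' \<longrightarrow>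
        f (s, t) + p * h + a * k - \<epsilon> * (\<bar>h\<bar> + \<bar>k\<bar>) \<le> f (s + h, t + k)"
    using assms(2,3) by (intro exI[of _ "min d e"]) auto
qed

lemma lower_jet_le:
  assumes "lower_jet S f s t p a" "d > 0"
    and "\<And>h k. \<bar>h\<bar> < d \<Longrightarrow> \<bar>k\<bar> < d \<Longrightarrow> (s + h, t + k) \<in> S \<Longrightarrow>
      g (s, t) + (f (s + h, t + k) - f (s, t)) \<le> g (s + h, t + k)"
  shows "lower_jet S g s t p a"
proof (rule lower_jetI)
  fix \<epsilon> :: real assume "\<epsilon> > 0"
  from lower_jetD[OF assms(1) this] obtain e where e: "e > 0" "\<And>h k. \<bar>h\<bar> < e \<Longrightarrow> \<bar>k\<bar> < e \<Longrightarrow> (s + h, t + k) \<in> S \<Longrightarrow>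
        f (s, t) + p * h + a * k - \<epsilon> * (\<bar>h\<bar> + \<bar>k\<bar>) \<le> f (s + h, t + k)" by blast
  show "\<exists>d>0. \<forall>h k. \<bar>h\<bar> < d \<longrightarrow> \<bar>k\<bar> < d \<longrightarrow> (s + h, t + k) \<in> S \<longrightarrow>
        g (s, t) + p * h + a * k - \<epsilon> * (\<bar>h\<bar> + \<bar>k\<bar>) \<le> g (s + h, t + k)"
  proof (intro exI[of _ "min d e"] conjI allI impI)
    show "min d e > 0" using assms(2) e by auto
    fix h k assume "\<bar>h\<bar> < min d e" "\<bar>k\<bar> < min d e" "(s + h, t + k) \<in> S"
    then show "g (s, t) + p * h + a * k - \<epsilon> * (\<bar>h\<bar> + \<bar>k\<bar>) \<le> g (s + h, t + k)"
      using e(2)[of h k] assms(3)[of h k] by auto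
  qed
qed

text \<open>When only increments h \<ge> 0 occur, as at the base of a strip, lowering the slope
  lowers the affine minorant. So the set of slopes at a base is downward closed.\<close>

lemma lower_jet_mono:
  assumes "lower_jet S f s t p a" "p' \<le> p" and "\<And>h k. (s + h, t + k) \<in> S \<Longrightarrow> 0 \<le> h"
  shows "lower_jet S f s t p' a"
proof (rule lower_jetI)
  fix \<epsilon> :: real assume "\<epsilon> > 0"
  from lower_jetD[OF assms(1) this] obtain e where e: "e > 0" "\<And>h k. \<bar>h\<bar> < e \<Longrightarrow> \<bar>k\<bar> < e \<Longrightarrow> (s + h, t + k) \<in> S \<Longrightarrow>
        f (s, t) + p * h + a * k - \<epsilon> * (\<bar>h\<bar> + \<bar>k\<bar>) \<le> f (s + h, t + k)" by blast
  show "\<exists>d>0. \<forall>h k. \<bar>h\<bar> < d \<longrightarrow> \<bar>k\<bar> < d \<longrightarrow> (s + h, t + k) \<in> S \<longrightarrow>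
        f (s, t) + p' * h + a * k - \<epsilon> * (\<bar>h\<bar> + \<bar>k\<bar>) \<le> f (s + h, t + k)"
  proof (intro exI[of _ e] conjI allI impI)
    fix h k assume *: "\<bar>h\<bar> < e" "\<bar>k\<bar> < e" "(s + h, t + k) \<in> S"
    have "p' * h \<le> p * h" using assms(2) assms(3)[OF *(3)] by (rule mult_right_mono)
    then show "f (s, t) + p' * h + a * k - \<epsilon> * (\<bar>h\<bar> + \<bar>k\<bar>) \<le> f (s + h, t + k)"
      using e(2)[OF *] by linarith
  qed (use e in auto)
qed

lemma lower_jet_convex:
  assumes "lower_jet S f s t p a" "lower_jet S f s t p' a'" "0 \<le> l" "l \<le> 1"
  shows "lower_jet S f s t ((1 - l) * p + l * p') ((1 - l) * a + l * a')"
proof (rule lower_jetI)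
  fix \<epsilon> :: real assume "\<epsilon> > 0"
  from lower_jetD[OF assms(1) this] obtain e where e: "e > 0" "\<And>h k. \<bar>h\<bar> < e \<Longrightarrow> \<bar>k\<bar> < e \<Longrightarrow> (s + h, t + k) \<in> S \<Longrightarrow>
        f (s, t) + p * h + a * k - \<epsilon> * (\<bar>h\<bar> + \<bar>k\<bar>) \<le> f (s + h, t + k)" by blast
  from lower_jetD[OF assms(2) \<open>\<epsilon> > 0\<close>] obtain e' where e': "e' > 0" "\<And>h k. \<bar>h\<bar> < e' \<Longrightarrow> \<bar>k\<bar> < e' \<Longrightarrow> (s + h, t + k) \<in> S \<Longrightarrow>
        f (s, t) + p' * h + a' * k - \<epsilon> * (\<bar>h\<bar> + \<bar>k\<bar>) \<le> f (s + h, t + k)" by blast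
  show "\<exists>d>0. \<forall>h k. \<bar>h\<bar> < d \<longrightarrow> \<bar>k\<bar> < d \<longrightarrow> (s + h, t + k) \<in> S \<longrightarrow>
        f (s, t) + ((1 - l) * p + l * p') * h + ((1 - l) * a + l * a') * k - \<epsilon> * (\<bar>h\<bar> + \<bar>k\<bar>) \<le> f (s + h, t + k)"
  proof (intro exI[of _ "min e e'"] conjI allI impI)
    fix h k assume *: "\<bar>h\<bar> < min e e'" "\<bar>k\<bar> < min e e'" "(s + h, t + k) \<in> S"
    let ?X = "f (s, t) + p * h + a * k - \<epsilon> * (\<bar>h\<bar> + \<bar>k\<bar>)"
    let ?Y = "f (s, t) + p' * h + a' * k - \<epsilon> * (\<bar>h\<bar> + \<bar>k\<bar>)"
    have "(1 - l) * ?X + l * ?Y \<le> (1 - l) * f (s + h, t + k) + l * f (s + h, t + k)"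
      using * assms(3,4) e(2)[of h k] e'(2)[of h k] by (intro add_mono mult_left_mono) auto
    then show "f (s, t) + ((1 - l) * p + l * p') * h + ((1 - l) * a + l * a') * k - \<epsilon> * (\<bar>h\<bar> + \<bar>k\<bar>) \<le> f (s + h, t + k)"
      by (simp add: algebra_simps)
  qed (use e e' in auto)
qed

lemma lower_jet_closed:
  assumes "\<And>\<epsilon>. \<epsilon> > 0 \<Longrightarrow> \<exists>p' a'. \<bar>p' - p\<bar> \<le> \<epsilon> \<and> \<bar>a' - a\<bar> \<le> \<epsilon> \<and> lower_jet S f s t p' a'"
  shows "lower_jet S f s t p a"
proof (rule lower_jetI)
  fix \<epsilon> :: real assume "\<epsilon> > 0"
  then have "\<epsilon>/2 > 0" by simp
  from assms[OF this] obtain p' a' where pa: "\<bar>p' - p\<bar> \<le> \<epsilon>/2" "\<bar>a' - a\<bar> \<le> \<epsilon>/2" "lower_jet S f s t p' a'" by blast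
  from lower_jetD[OF pa(3) \<open>\<epsilon>/2 > 0\<close>] obtain e where e: "e > 0" "\<And>h k. \<bar>h\<bar> < e \<Longrightarrow> \<bar>k\<bar> < e \<Longrightarrow> (s + h, t + k) \<in> S \<Longrightarrow>
        f (s, t) + p' * h + a' * k - \<epsilon>/2 * (\<bar>h\<bar> + \<bar>k\<bar>) \<le> f (s + h, t + k)" by blast
  show "\<exists>d>0. \<forall>h k. \<bar>h\<bar> < d \<longrightarrow> \<bar>k\<bar> < d \<longrightarrow> (s + h, t + k) \<in> S \<longrightarrow>
        f (s, t) + p * h + a * k - \<epsilon> * (\<bar>h\<bar> + \<bar>k\<bar>) \<le> f (s + h, t + k)"
  proof (intro exI[of _ e] conjI allI impI)
    fix h k assume *: "\<bar>h\<bar> < e" "\<bar>k\<bar> < e" "(s + h, t + k) \<in> S"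
    have "(p - p') * h \<le> \<epsilon>/2 * \<bar>h\<bar>" "(a - a') * k \<le> \<epsilon>/2 * \<bar>k\<bar>"
      using mult_right_mono[OF pa(1), of "\<bar>h\<bar>"] mult_right_mono[OF pa(2), of "\<bar>k\<bar>"]
        abs_ge_self[of "(p - p') * h"] abs_ge_self[of "(a - a') * k"]
      by (simp_all add: abs_mult abs_minus_commute)
    then show "f (s, t) + p * h + a * k - \<epsilon> * (\<bar>h\<bar> + \<bar>k\<bar>) \<le> f (s + h, t + k)"
      using e(2)[OF *] by (simp add: algebra_simps) argo
  qed (use e in auto)
qed

lemma lower_jet_has_derivative:
  assumes "(\<phi> has_derivative (\<lambda>(h, k). p * h + a * k)) (at (s, t) within S)"
  shows "lower_jet S \<phi> s t p a"
proof (rule lower_jetI)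
  fix \<epsilon> :: real assume \<epsilon>: "\<epsilon> > 0"
  obtain d where d: "d > 0" "\<And>y. y \<in> S \<Longrightarrow> norm (y - (s, t)) < d \<Longrightarrow>
      norm (\<phi> y - \<phi> (s, t) - (\<lambda>(h, k). p * h + a * k) (y - (s, t))) \<le> \<epsilon> * norm (y - (s, t))"
    using assms \<epsilon> unfolding has_derivative_within_alt by blast
  show "\<exists>d>0. \<forall>h k. \<bar>h\<bar> < d \<longrightarrow> \<bar>k\<bar> < d \<longrightarrow> (s + h, t + k) \<in> S \<longrightarrow>
        \<phi> (s, t) + p * h + a * k - \<epsilon> * (\<bar>h\<bar> + \<bar>k\<bar>) \<le> \<phi> (s + h, t + k)"
  proof (intro exI[of _ "d/2"] conjI allI impI)
    fix h k assume *: "\<bar>h\<bar> < d/2" "\<bar>k\<bar> < d/2" "(s + h, t + k) \<in> S"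
    have n: "norm (h, k) \<le> \<bar>h\<bar> + \<bar>k\<bar>" using norm_Pair_le[of h k] by simp
    have "norm (\<phi> (s + h, t + k) - \<phi> (s, t) - (p * h + a * k)) \<le> \<epsilon> * norm (h, k)"
      using d(2)[OF *(3)] n * by simp
    also have "\<dots> \<le> \<epsilon> * (\<bar>h\<bar> + \<bar>k\<bar>)" using n \<epsilon> by simp
    finally show "\<phi> (s, t) + p * h + a * k - \<epsilon> * (\<bar>h\<bar> + \<bar>k\<bar>) \<le> \<phi> (s + h, t + k)"
      by (simp add: abs_le_iff)
  qed (use d in auto)
qed

lemma local_min_lower_jet:
  assumes "(\<phi> has_derivative (\<lambda>(h, k). p * h + a * k)) (at (s, t) within S)"
    and "d > 0" "\<And>h k. \<bar>h\<bar> < d \<Longrightarrow> \<bar>k\<bar> < d \<Longrightarrow> (s + h, t + k) \<in> S \<Longrightarrow>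
      f (s, t) - \<phi> (s, t) \<le> f (s + h, t + k) - \<phi> (s + h, t + k)"
  shows "lower_jet S f s t p a"
  by (rule lower_jet_le[OF lower_jet_has_derivative[OF assms(1)] assms(2)])
    (use assms(3) in \<open>fastforce simp: algebra_simps\<close>)

lemma local_max_upper_jet:
  assumes "(\<phi> has_derivative (\<lambda>(h, k). p * h + a * k)) (at (s, t) within S)"
    and "d > 0" "\<And>h k. \<bar>h\<bar> < d \<Longrightarrow> \<bar>k\<bar> < d \<Longrightarrow> (s + h, t + k) \<in> S \<Longrightarrow>
      f (s + h, t + k) - \<phi> (s + h, t + k) \<le> f (s, t) - \<phi> (s, t)"
  shows "upper_jet S f s t p a"
proof (rule local_min_lower_jet[of "\<lambda>z. - \<phi> z"])
  show "((\<lambda>z. - \<phi> z) has_derivative (\<lambda>(h, k). - p * h + - a * k)) (at (s, t) within S)"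
    using has_derivative_minus[OF assms(1)] by (simp add: case_prod_unfold)
qed (use assms(2,3) in \<open>fastforce simp: algebra_simps\<close>)+

section \<open>Touching test functions and jets\<close>

lemma subtangent_box:
  fixes f \<phi> :: "real \<times> real \<Rightarrow> real"
  assumes "subtangent S f \<phi> (s, t)"
  obtains d where "d > 0" "\<And>h k. \<bar>h\<bar> < d \<Longrightarrow> \<bar>k\<bar> < d \<Longrightarrow> (s + h, t + k) \<in> S \<Longrightarrow>
      f (s, t) - \<phi> (s, t) \<le> f (s + h, t + k) - \<phi> (s + h, t + k)"
proof -
  from assms obtain d where d: "d > 0" "\<And>y. y \<in> S \<Longrightarrow> y \<noteq> (s, t) \<Longrightarrow> dist y (s, t) < d \<Longrightarrow>
      f (s, t) - \<phi> (s, t) \<le> f y - \<phi> y"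
    unfolding subtangent_def eventually_at by blast
  show ?thesis
  proof (rule that[of "d/2"])
    fix h k assume *: "\<bar>h\<bar> < d/2" "\<bar>k\<bar> < d/2" "(s + h, t + k) \<in> S"
    have "dist (s + h, t + k) (s, t) < d"
      using norm_Pair_le[of h k] * by (simp add: dist_norm)
    then show "f (s, t) - \<phi> (s, t) \<le> f (s + h, t + k) - \<phi> (s + h, t + k)"
      using d(2)[OF *(3)] by (cases "(s + h, t + k) = (s, t)") (auto simp: prod_eq_iff)
  qed (use d in auto)
qed

lemma subtangent_boxI:
  fixes f \<phi> :: "real \<times> real \<Rightarrow> real"
  assumes "d > 0" "\<And>h k. \<bar>h\<bar> < d \<Longrightarrow> \<bar>k\<bar> < d \<Longrightarrow> (s + h, t + k) \<in> S \<Longrightarrow>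
      f (s, t) - \<phi> (s, t) \<le> f (s + h, t + k) - \<phi> (s + h, t + k)"
  shows "subtangent S f \<phi> (s, t)"
  unfolding subtangent_def eventually_at
proof (intro exI[of _ d] conjI ballI impI)
  fix y assume y: "y \<in> S" "y \<noteq> (s, t) \<and> dist y (s, t) < d"
  obtain s' t' where st: "y = (s', t')" by (cases y)
  have "\<bar>s' - s\<bar> < d" "\<bar>t' - t\<bar> < d"
    using y dist_fst_le[of y "(s, t)"] dist_snd_le[of y "(s, t)"] by (auto simp: st dist_real_def)
  then show "f (s, t) - \<phi> (s, t) \<le> f y - \<phi> y"
    using assms(2)[of "s' - s" "t' - t"] y st by auto
qed (use assms in auto)

lemma supertangent_uminus: "supertangent S f \<phi> z \<longleftrightarrow> subtangent S (\<lambda>z. - f z) (\<lambda>z. - \<phi> z) z"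
  unfolding supertangent_def subtangent_def by (simp add: algebra_simps)

lemma lower_jet_of_subtangent:
  assumes "(\<phi> has_derivative (\<lambda>(h, k). p * h + a * k)) (at (s, t) within S)" "subtangent S f \<phi> (s, t)"
  shows "lower_jet S f s t p a"
proof -
  obtain d where "d > 0" "\<And>h k. \<bar>h\<bar> < d \<Longrightarrow> \<bar>k\<bar> < d \<Longrightarrow> (s + h, t + k) \<in> S \<Longrightarrow>
      f (s, t) - \<phi> (s, t) \<le> f (s + h, t + k) - \<phi> (s + h, t + k)"
    using subtangent_box[OF assms(2)] by blast
  from local_min_lower_jet[OF assms(1) this] show ?thesis by blast
qed

section \<open>C1 functions of two variables and their partial derivatives\<close>

lemma C1_on_uminus: assumes "C1_on S \<phi>" shows "C1_on S (\<lambda>z. - \<phi> z)"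
proof -
  obtain p q where "continuous_on S p" "continuous_on S q"
    "\<And>z. z \<in> S \<Longrightarrow> (\<phi> has_derivative (\<lambda>(h, k). p z * h + q z * k)) (at z within S)"
    using assms unfolding C1_on_def by blast
  then show ?thesis unfolding C1_on_def
    by (intro exI[of _ "\<lambda>z. - p z"] exI[of _ "\<lambda>z. - q z"])
      (auto intro!: continuous_intros derivative_eq_intros simp: case_prod_unfold)
qed

text \<open>The last assumption is uniqueness of derivatives within I. It is kept abstract because
  it is discharged in one way on open intervals and in another at the end point of a closed one.
  Time has to be interior to J since \<open>partial_t\<close> is a two-sided derivative.\<close>

lemma C1_on_partials:
  assumes "C1_on (I \<times> J) \<phi>" "s \<in> I" "t \<in> interior J"
    and "\<And>(g :: real \<Rightarrow> real) D. (g has_vector_derivative D) (at s within I) \<Longrightarrow> vector_derivative g (at s within I) = D"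
  shows "(\<phi> has_derivative (\<lambda>(h, k). partial_s I \<phi> s t * h + partial_t \<phi> s t * k)) (at (s, t) within I \<times> J)"
proof -
  have tJ: "t \<in> J" using assms(3) interior_subset by blast
  obtain p q where pq: "\<And>z. z \<in> I \<times> J \<Longrightarrow> (\<phi> has_derivative (\<lambda>(h, k). p z * h + q z * k)) (at z within I \<times> J)"
    using assms(1) unfolding C1_on_def by blast
  then have D: "(\<phi> has_derivative (\<lambda>(h, k). p (s, t) * h + q (s, t) * k)) (at (s, t) within I \<times> J)"
    using assms(2) tJ by blast
  have "((\<lambda>r. \<phi> (r, t)) has_derivative (\<lambda>h. (\<lambda>(h, k). p (s, t) * h + q (s, t) * k) (h, 0))) (at s within I)"
    by (rule has_derivative_in_compose2[where t = "I \<times> J" and f = "\<lambda>r. (r, t)" and g = \<phi>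
          and g' = "\<lambda>z (h, k). p z * h + q z * k", THEN has_derivative_eq_rhs])
      (use pq assms(2) tJ in \<open>auto intro!: derivative_eq_intros\<close>)
  then have "((\<lambda>r. \<phi> (r, t)) has_vector_derivative p (s, t)) (at s within I)"
    by (simp add: has_vector_derivative_def mult.commute)
  then have 1: "partial_s I \<phi> s t = p (s, t)" unfolding partial_s_def by (rule assms(4))
  have "((\<lambda>r. \<phi> (s, r)) has_derivative (\<lambda>k. (\<lambda>(h, k). p (s, t) * h + q (s, t) * k) (0, k))) (at t within J)"
    by (rule has_derivative_in_compose2[where t = "I \<times> J" and f = "\<lambda>r. (s, r)" and g = \<phi>
          and g' = "\<lambda>z (h, k). p z * h + q z * k", THEN has_derivative_eq_rhs])
      (use pq assms(2) tJ in \<open>auto intro!: derivative_eq_intros\<close>)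
  then have "((\<lambda>r. \<phi> (s, r)) has_vector_derivative q (s, t)) (at t)"
    by (simp add: has_vector_derivative_def mult.commute at_within_interior[OF assms(3)])
  then have 2: "partial_t \<phi> s t = q (s, t)" unfolding partial_t_def by (rule vector_derivative_at)
  show ?thesis using D unfolding 1 2 .
qed

text \<open>The test functions that realise a jet are sums of a function of s and a function of t
  along each arc, which reduces joint differentiability to one variable.\<close>

lemma C1_on_separated:
  assumes "continuous_on UNIV g'" "continuous_on UNIV A'"
    and "\<And>s. (g has_real_derivative g' s) (at s)" "\<And>t. (A has_real_derivative A' t) (at t)"
    and "\<And>s t. (s, t) \<in> S \<Longrightarrow> \<phi> (s, t) = g s + A t"
  shows "C1_on S \<phi>"
  unfolding C1_on_def
proof (rule exI[of _ "\<lambda>z. g' (fst z)"], rule exI[of _ "\<lambda>z. A' (snd z)"], intro conjI ballI)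
  show "continuous_on S (\<lambda>z. g' (fst z))" "continuous_on S (\<lambda>z. A' (snd z))"
    by (auto intro!: continuous_on_compose2[OF assms(1)] continuous_on_compose2[OF assms(2)] continuous_intros)
  fix z assume z: "z \<in> S"
  have "((\<lambda>z. g (fst z) + A (snd z)) has_derivative (\<lambda>h. fst h * g' (fst z) + snd h * A' (snd z))) (at z within S)"
    by (auto intro!: derivative_eq_intros DERIV_compose_FDERIV assms)
  then have "(\<phi> has_derivative (\<lambda>h. fst h * g' (fst z) + snd h * A' (snd z))) (at z within S)"
    by (rule has_derivative_transform[OF z, rotated]) (metis assms(5) prod.collapse)
  then show "(\<phi> has_derivative (\<lambda>(h, k). g' (fst z) * h + A' (snd z) * k)) (at z within S)"
    by (simp add: case_prod_unfold mult.commute)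
qed

subsection \<open>A continuously differentiable modulus\<close>

lemma sqrt_diff_le_abs: "d > 0 \<Longrightarrow> sqrt (d\<^sup>2 + r\<^sup>2) - d \<le> \<bar>r\<bar>"
  using sqrt_add_le_add_sqrt[of "d\<^sup>2" "r\<^sup>2"] by simp

text \<open>\<sigma> is the sum of the functions T n, each a rounded copy of 6 * (1/2)^n |r| that
  vanishes at 0 together with its derivative. Their derivatives are at most 6 * (1/2)^n, so the
  series may be differentiated termwise. Once |r| reaches d (n + 1), the rounding has cost at most
  two thirds, which leaves 2 * (1/2)^n |r| in the single term n.\<close>

lemma C1_modulus_sequence:
  fixes d :: "nat \<Rightarrow> real"
  assumes "\<And>n. d n > 0"
  obtains \<sigma> \<sigma>' where "continuous_on UNIV \<sigma>'" "\<And>r. (\<sigma> has_real_derivative \<sigma>' r) (at r)"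
    "\<sigma> 0 = 0" "\<sigma>' 0 = 0" "\<And>r. 0 \<le> \<sigma> r" "\<And>r. \<sigma> \<bar>r\<bar> = \<sigma> r"
    "\<And>n r. d (Suc n) \<le> \<bar>r\<bar> \<Longrightarrow> 2 * (1/2)^n * \<bar>r\<bar> \<le> \<sigma> r"
proof -
  define T where "T n r = 6 * ((1/2)^n * (sqrt ((d (Suc n))\<^sup>2 + r\<^sup>2) - d (Suc n)))" for n r
  define T' where "T' n r = 6 * ((1/2)^n * (r / sqrt ((d (Suc n))\<^sup>2 + r\<^sup>2)))" for n r
  have pos: "(d n)\<^sup>2 + r\<^sup>2 > 0" for n r
    using assms[of n] by (simp add: add_pos_nonneg)
  have DT: "(T n has_real_derivative T' n r) (at r)" for n r
    unfolding T_def[abs_def] T'_def using pos[of "Suc n" r]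
    by (auto intro!: derivative_eq_intros simp: field_simps)
  have T'_bound: "norm (T' n r) \<le> 6 * (1/2)^n" for n r
  proof -
    have "\<bar>r\<bar> \<le> sqrt ((d (Suc n))\<^sup>2 + r\<^sup>2)" by (rule real_le_rsqrt) simp
    then have "\<bar>r / sqrt ((d (Suc n))\<^sup>2 + r\<^sup>2)\<bar> \<le> 1"
      using pos[of "Suc n" r] by (simp add: abs_mult)
    then have "6 * (1/2)^n * \<bar>r / sqrt ((d (Suc n))\<^sup>2 + r\<^sup>2)\<bar> \<le> 6 * (1/2)^n * 1"
      by (intro mult_left_mono) auto
    then show ?thesis by (simp add: T'_def abs_mult mult.assoc)
  qed
  have sumb: "summable (\<lambda>n. 6 * (1/2::real)^n)" by (intro summable_mult summable_geometric) simp
  have unif: "uniform_limit UNIV (\<lambda>n r. \<Sum>i<n. T' i r) (\<lambda>r. \<Sum>i. T' i r) sequentially"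
    by (rule Weierstrass_m_test[OF T'_bound sumb])
  have T0: "T n 0 = 0" for n using assms[of "Suc n"] by (simp add: T_def real_sqrt_abs)
  have T_nn: "0 \<le> T n r" for n r
  proof -
    have "d (Suc n) \<le> sqrt ((d (Suc n))\<^sup>2 + r\<^sup>2)" by (rule real_le_rsqrt) simp
    then show ?thesis by (simp add: T_def)
  qed
  have summT: "summable (\<lambda>n. T n r)" for r
  proof (rule summable_comparison_test'[of "\<lambda>n. \<bar>r\<bar> * (6 * (1/2)^n)" 0])
    show "summable (\<lambda>n. \<bar>r\<bar> * (6 * (1/2)^n))" by (rule summable_mult[OF sumb])
    show "norm (T n r) \<le> \<bar>r\<bar> * (6 * (1/2)^n)" for n
    proof -
      have "(1/2)^n * (sqrt ((d (Suc n))\<^sup>2 + r\<^sup>2) - d (Suc n)) \<le> (1/2)^n * \<bar>r\<bar>"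
        by (intro mult_left_mono sqrt_diff_le_abs assms) auto
      moreover have "\<bar>r\<bar> * (6 * (1/2)^n) = 6 * ((1/2)^n * \<bar>r\<bar>)" by (simp only: mult_ac)
      ultimately have "T n r \<le> \<bar>r\<bar> * (6 * (1/2)^n)" unfolding T_def by linarith
      moreover have "norm (T n r) = T n r" using T_nn[of n r] by simp
      ultimately show ?thesis by simp
    qed
  qed
  define \<sigma> where "\<sigma> r = (\<Sum>n. T n r)" for r
  define \<sigma>' where "\<sigma>' r = (\<Sum>n. T' n r)" for r
  show ?thesis
  proof (rule that[of \<sigma>' \<sigma>])
    show "continuous_on UNIV \<sigma>'"
      unfolding \<sigma>'_def
    proof (rule uniform_limit_theorem[OF _ unif])
      have "continuous_on UNIV (T' i)" for i
      proof -
        have "sqrt ((d (Suc i))\<^sup>2 + r\<^sup>2) \<noteq> 0" for r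
          using real_sqrt_gt_zero[OF pos[of "Suc i" r]] by (metis less_irrefl)
        then show ?thesis unfolding T'_def[abs_def]
          by (intro continuous_on_mult continuous_on_divide continuous_on_const continuous_on_id
              continuous_on_real_sqrt continuous_on_add continuous_on_power ballI)
      qed
      then show "\<forall>\<^sub>F n in sequentially. continuous_on UNIV (\<lambda>r. \<Sum>i<n. T' i r)"
        by (intro always_eventually allI continuous_on_sum) auto
    qed simp
    show "(\<sigma> has_real_derivative \<sigma>' r) (at r)" for r
    proof -
      have "uniformly_convergent_on UNIV (\<lambda>n r. \<Sum>i<n. T' i r)"
        using unif unfolding uniformly_convergent_on_def by blast
      from has_field_derivative_series'(2)[OF convex_UNIV DT this UNIV_I summT, of r]
      have "((\<lambda>x. \<Sum>n. T n x) has_field_derivative (\<Sum>n. T' n r)) (at r)"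
        by simp
      then show ?thesis by (simp add: \<sigma>_def[abs_def] \<sigma>'_def)
    qed
    show "\<sigma> 0 = 0" unfolding \<sigma>_def T0 by (rule suminf_zero)
    have "T' n 0 = 0" for n by (simp add: T'_def)
    then show "\<sigma>' 0 = 0" unfolding \<sigma>'_def by (simp only: suminf_zero)
    show "0 \<le> \<sigma> r" for r unfolding \<sigma>_def by (rule suminf_nonneg[OF summT T_nn])
    show "\<sigma> \<bar>r\<bar> = \<sigma> r" for r unfolding \<sigma>_def T_def power2_abs ..
    fix n r assume r: "d (Suc n) \<le> \<bar>r\<bar>"
    have "d (Suc n) + \<bar>r\<bar> / 3 \<le> sqrt ((d (Suc n))\<^sup>2 + r\<^sup>2)"
    proof (rule real_le_rsqrt)
      have "d (Suc n) * \<bar>r\<bar> \<le> \<bar>r\<bar> * \<bar>r\<bar>" using r by (intro mult_right_mono) auto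
      moreover have "(d (Suc n) + \<bar>r\<bar> / 3)\<^sup>2 =
          (d (Suc n))\<^sup>2 + (2/3) * (d (Suc n) * \<bar>r\<bar>) + (1/9) * (\<bar>r\<bar> * \<bar>r\<bar>)"
        by (simp add: power2_eq_square algebra_simps)
      moreover have "r\<^sup>2 = \<bar>r\<bar> * \<bar>r\<bar>" "0 \<le> \<bar>r\<bar> * \<bar>r\<bar>" by (simp_all add: power2_eq_square)
      ultimately show "(d (Suc n) + \<bar>r\<bar> / 3)\<^sup>2 \<le> (d (Suc n))\<^sup>2 + r\<^sup>2" by linarith
    qed
    then have "(1/2)^n * (\<bar>r\<bar> / 3) \<le> (1/2)^n * (sqrt ((d (Suc n))\<^sup>2 + r\<^sup>2) - d (Suc n))"
      by (intro mult_left_mono) auto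
    then have "2 * (1/2)^n * \<bar>r\<bar> \<le> T n r" by (simp add: T_def)
    also have "\<dots> \<le> \<sigma> r" unfolding \<sigma>_def
      using sum_le_suminf[OF summT, of "{n}" r] T_nn by simp
    finally show "2 * (1/2)^n * \<bar>r\<bar> \<le> \<sigma> r" .
  qed
qed

text \<open>Take radii d n on which the error is below (1/2)^n (|h| + |k|). A pair whose size \<rho>
  lies between consecutive radii has an error controlled by the coarser scale, and the modulus is
  already that large from the finer radius on. The index i allows one modulus for all arcs issuing
  from a vertex.\<close>

lemma C1_modulus:
  fixes e :: "'i \<Rightarrow> real \<Rightarrow> real \<Rightarrow> real"
  assumes "\<And>\<epsilon>. \<epsilon> > 0 \<Longrightarrow> \<exists>d>0. \<forall>i h k. B i h k \<longrightarrow> \<bar>h\<bar> < d \<longrightarrow> \<bar>k\<bar> < d \<longrightarrow> e i h k \<le> \<epsilon> * (\<bar>h\<bar> + \<bar>k\<bar>)"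
  obtains \<sigma> \<sigma>' d where "continuous_on UNIV \<sigma>'" "\<And>r. (\<sigma> has_real_derivative \<sigma>' r) (at r)"
    "\<sigma> 0 = 0" "\<sigma>' 0 = 0" "\<And>r. 0 \<le> \<sigma> r" "d > 0"
    "\<And>i h k. B i h k \<Longrightarrow> \<bar>h\<bar> < d \<Longrightarrow> \<bar>k\<bar> < d \<Longrightarrow> e i h k \<le> \<sigma> h + \<sigma> k"
proof -
  have "\<exists>D. \<forall>n. D n > 0 \<and> (\<forall>i h k. B i h k \<longrightarrow> \<bar>h\<bar> < D n \<longrightarrow> \<bar>k\<bar> < D n \<longrightarrow> e i h k \<le> (1/2)^n * (\<bar>h\<bar> + \<bar>k\<bar>))"
    by (rule choice) (use assms in auto)
  then obtain D where D: "\<And>n. D n > 0" "\<And>n i h k. B i h k \<Longrightarrow> \<bar>h\<bar> < D n \<Longrightarrow> \<bar>k\<bar> < D n \<Longrightarrow> e i h k \<le> (1/2)^n * (\<bar>h\<bar> + \<bar>k\<bar>)"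
    by blast
  \<comment> \<open>The bound (1/2)^n forces the radii to 0, so that every \<rho> > 0 exceeds one of
    them; the minimum over D keeps the error estimate valid.\<close>
  define d where "d n = Min (insert ((1/2)^n) (D ` {..n}))" for n
  have d_pos: "d n > 0" for n unfolding d_def using D(1) by (subst Min_gr_iff) auto
  have d_le: "d n \<le> D n" "d n \<le> (1/2)^n" for n
  proof -
    have "finite (insert ((1/2)^n) (D ` {..n}))" "D n \<in> insert ((1/2)^n) (D ` {..n})" by auto
    then show "d n \<le> D n" unfolding d_def by (rule Min_le)
    show "d n \<le> (1/2)^n" unfolding d_def by (rule Min_le) auto
  qed
  obtain \<sigma> \<sigma>' where s: "continuous_on UNIV \<sigma>'" "\<And>r. (\<sigma> has_real_derivative \<sigma>' r) (at r)"
    "\<sigma> 0 = 0" "\<sigma>' 0 = 0" "\<And>r. 0 \<le> \<sigma> r" "\<And>r. \<sigma> \<bar>r\<bar> = \<sigma> r"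
    and big: "\<And>n r. d (Suc n) \<le> \<bar>r\<bar> \<Longrightarrow> 2 * (1/2)^n * \<bar>r\<bar> \<le> \<sigma> r"
    by (rule C1_modulus_sequence[of d, OF d_pos]) (rule that)
  show ?thesis
  proof (rule that[OF s(1-5) d_pos[of 0]])
    fix i h k assume B: "B i h k" and hk: "\<bar>h\<bar> < d 0" "\<bar>k\<bar> < d 0"
    define \<rho> where "\<rho> = max \<bar>h\<bar> \<bar>k\<bar>"
    show "e i h k \<le> \<sigma> h + \<sigma> k"
    proof (cases "\<rho> = 0")
      case True
      then have "h = 0" "k = 0" by (auto simp: \<rho>_def max_def split: if_splits)
      then show ?thesis using D(2)[OF B, of 0] D(1)[of 0] s(3) by simp
    next
      case False
      then have \<rho>: "\<rho> > 0" by (auto simp: \<rho>_def)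
      obtain N where N: "(1/2::real)^N < \<rho>" using real_arch_pow_inv[OF \<rho>, of "1/2"] by auto
      have "d N \<le> \<rho>" using d_le(2)[of N] N by simp
      \<comment> \<open>The scale j just before the first radius below \<rho> still satisfies \<rho>
        < d j, while d (j + 1) \<le> \<rho> activates the lower bound on \<sigma>. The factor 2 in
        that bound pays for |h| + |k| \<le> 2 \<rho>.\<close>
      define n where "n = (LEAST n. d n \<le> \<rho>)"
      have n: "d n \<le> \<rho>" unfolding n_def by (rule LeastI[of "\<lambda>n. d n \<le> \<rho>", OF \<open>d N \<le> \<rho>\<close>])
      have "n \<noteq> 0"
      proof
        assume "n = 0"
        with n have "d 0 \<le> \<rho>" by simp
        then show False using hk by (simp add: \<rho>_def)
      qed
      then obtain j where j: "n = Suc j" by (cases n) auto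
      have "\<not> d j \<le> \<rho>" using not_less_Least[of j "\<lambda>n. d n \<le> \<rho>"] j unfolding n_def by simp
      then have "\<bar>h\<bar> < D j" "\<bar>k\<bar> < D j" using d_le(1)[of j] by (auto simp: \<rho>_def)
      then have "e i h k \<le> (1/2)^j * (\<bar>h\<bar> + \<bar>k\<bar>)" by (rule D(2)[OF B])
      also have "\<dots> \<le> (1/2)^j * (2 * \<rho>)" by (intro mult_left_mono) (auto simp: \<rho>_def)
      also have "\<dots> \<le> \<sigma> \<rho>" using big[of j \<rho>] n \<rho> unfolding j by simp
      also have "\<dots> \<le> \<sigma> h + \<sigma> k" using s(5)[of h] s(5)[of k] s(6)[of h] s(6)[of k]
        by (cases "\<bar>h\<bar> \<le> \<bar>k\<bar>") (simp_all add: \<rho>_def max_def)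
      finally show ?thesis .
    qed
  qed
qed

section \<open>Semicontinuity\<close>

text \<open>Lower semicontinuity is always expressed as \<open>usc_on\<close> of the negative
  function, so that attainment of maxima is the only compactness statement.\<close>

definition usc_on :: "'b::metric_space set \<Rightarrow> ('b \<Rightarrow> real) \<Rightarrow> bool" where
  "usc_on S f \<longleftrightarrow> (\<forall>z\<in>S. \<forall>y>f z. \<exists>d>0. \<forall>x\<in>S. dist x z < d \<longrightarrow> f x < y)"

lemma usc_onD:
  assumes "usc_on S f" "z \<in> S" "f z < y"
  obtains d where "d > 0" "\<And>x. x \<in> S \<Longrightarrow> dist x z < d \<Longrightarrow> f x < y"
  using assms unfolding usc_on_def by blast

lemma usc_on_subset: "usc_on S f \<Longrightarrow> T \<subseteq> S \<Longrightarrow> usc_on T f"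
  unfolding usc_on_def by blast

lemma usc_on_continuous: "continuous_on S f \<Longrightarrow> usc_on S f"
  unfolding usc_on_def continuous_on_iff
proof (intro ballI allI impI)
  fix z y assume *: "\<forall>x\<in>S. \<forall>e>0. \<exists>d>0. \<forall>x'\<in>S. dist x' x < d \<longrightarrow> dist (f x') (f x) < e"
    "z \<in> S" "f z < y"
  then obtain d where "d > 0" "\<forall>x'\<in>S. dist x' z < d \<longrightarrow> dist (f x') (f z) < y - f z"
    by (meson diff_gt_0_iff_gt)
  then show "\<exists>d>0. \<forall>x\<in>S. dist x z < d \<longrightarrow> f x < y"
    by (intro exI[of _ d]) (auto simp: dist_real_def abs_less_iff)
qed

lemma usc_on_add:
  assumes "usc_on S f" "usc_on S g"
  shows "usc_on S (\<lambda>x. f x + g x)"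
  unfolding usc_on_def
proof (intro ballI allI impI)
  fix z y assume z: "z \<in> S" and "f z + g z < y"
  define e where "e = (y - (f z + g z)) / 2"
  have e: "f z < f z + e" "g z < g z + e" "y = f z + e + (g z + e)"
    using \<open>f z + g z < y\<close> by (auto simp: e_def)
  obtain d1 where d1: "d1 > 0" "\<And>x. x \<in> S \<Longrightarrow> dist x z < d1 \<Longrightarrow> f x < f z + e"
    using usc_onD[OF assms(1) z e(1)] by blast
  obtain d2 where d2: "d2 > 0" "\<And>x. x \<in> S \<Longrightarrow> dist x z < d2 \<Longrightarrow> g x < g z + e"
    using usc_onD[OF assms(2) z e(2)] by blast
  show "\<exists>d>0. \<forall>x\<in>S. dist x z < d \<longrightarrow> f x + g x < y"
  proof (intro exI[of _ "min d1 d2"] conjI ballI impI)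
    fix x assume "x \<in> S" "dist x z < min d1 d2"
    then have "f x < f z + e" "g x < g z + e" using d1(2) d2(2) by auto
    then show "f x + g x < y" unfolding e(3) by (rule add_strict_mono)
  qed (use d1 d2 in auto)
qed

lemma usc_on_compose:
  assumes "usc_on S f" "continuous_on T g" "g ` T \<subseteq> S"
  shows "usc_on T (\<lambda>x. f (g x))"
  unfolding usc_on_def
proof (intro ballI allI impI)
  fix z y assume z: "z \<in> T" and y: "f (g z) < y"
  obtain d where d: "d > 0" "\<And>x. x \<in> S \<Longrightarrow> dist x (g z) < d \<Longrightarrow> f x < y"
    using usc_onD[OF assms(1) _ y] z assms(3) by blast
  obtain e where "e > 0" "\<And>x. x \<in> T \<Longrightarrow> dist x z < e \<Longrightarrow> dist (g x) (g z) < d"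
    using assms(2) z d(1) unfolding continuous_on_iff by meson
  then show "\<exists>d>0. \<forall>x\<in>T. dist x z < d \<longrightarrow> f (g x) < y"
    using d(2) assms(3) by (intro exI[of _ e]) blast
qed

text \<open>If there were no maximum, each z would have a point Y z of larger value and a
  neighbourhood on which f stays below f (Y z). Finitely many of these neighbourhoods cover K, but
  the point Y z with the largest of the finitely many values lies in one of them, where f is below
  another such value.\<close>

lemma usc_on_attains_max:
  assumes "compact K" "K \<noteq> {}" "usc_on K f"
  obtains z where "z \<in> K" "\<And>x. x \<in> K \<Longrightarrow> f x \<le> f z"
proof -
  have "\<exists>z\<in>K. \<forall>x\<in>K. f x \<le> f z"
  proof (rule ccontr)
    assume "\<not> ?thesis"
    then have "\<forall>z\<in>K. \<exists>y\<in>K. f z < f y" by (meson not_le)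
    then obtain Y where Y: "\<And>z. z \<in> K \<Longrightarrow> Y z \<in> K \<and> f z < f (Y z)" by metis
    then have "\<forall>z\<in>K. \<exists>d>0. \<forall>x\<in>K. dist x z < d \<longrightarrow> f x < f (Y z)"
      using assms(3) unfolding usc_on_def by blast
    then obtain d where d: "\<And>z. z \<in> K \<Longrightarrow> d z > 0 \<and> (\<forall>x\<in>K. dist x z < d z \<longrightarrow> f x < f (Y z))" by metis
    have "K \<subseteq> (\<Union>z\<in>K. ball z (d z))" using d by fastforce
    then obtain C where C: "C \<subseteq> K" "finite C" "K \<subseteq> (\<Union>z\<in>C. ball z (d z))"
      using compactE_image[OF assms(1), of K "\<lambda>z. ball z (d z)"] by blast
    have "C \<noteq> {}" using C(3) assms(2) by auto
    define M where "M = Max ((\<lambda>z. f (Y z)) ` C)"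
    have "M \<in> (\<lambda>z. f (Y z)) ` C" unfolding M_def using C(2) \<open>C \<noteq> {}\<close> by (intro Max_in) auto
    then obtain z where z: "z \<in> C" "M = f (Y z)" by auto
    then have "Y z \<in> K" using Y C(1) by blast
    then obtain z' where z': "z' \<in> C" "Y z \<in> ball z' (d z')" using C(3) by blast
    then have "f (Y z) < f (Y z')" using d[of z'] C(1) \<open>Y z \<in> K\<close> by (auto simp: dist_commute)
    also have "\<dots> \<le> M" unfolding M_def using C(2) z'(1) by (intro Max_ge) auto
    finally show False using z by simp
  qed
  then show ?thesis using that by blast
qed

section \<open>Hamiltonians on a strip\<close>

text \<open>The line -\<nu> p - \<kappa> lies strictly below h, with a gap growing at least linearly
  in |p|. For convex Hamiltonians such a gap absorbs small changes of s, see
  \<open>tilt_nearby\<close>; a mere inequality would not.\<close>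

definition tilt :: "(real \<Rightarrow> real) \<Rightarrow> real \<Rightarrow> real \<Rightarrow> bool" where
  "tilt h \<nu> \<kappa> \<longleftrightarrow> (\<exists>\<delta>>0. \<forall>p. \<delta> * (1 + \<bar>p\<bar>) \<le> h p + \<nu> * p + \<kappa>)"

text \<open>For |p| \<le> R the bound \<theta> is enough; beyond R half of the growth \<delta> |p|
  absorbs C, which is how R is chosen.\<close>

lemma linear_growth_pos:
  fixes g :: "real \<Rightarrow> real"
  assumes "\<theta> > 0" "\<delta> > 0" "\<And>p. \<theta> \<le> g p" "\<And>p. \<delta> * \<bar>p\<bar> - C \<le> g p"
  shows "\<exists>\<delta>'>0. \<forall>p. \<delta>' * (1 + \<bar>p\<bar>) \<le> g p"
proof -
  define R where "R = 2 * (\<bar>C\<bar> + \<delta>) / \<delta>"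
  have R: "R > 0" "\<delta> / 2 * R = \<bar>C\<bar> + \<delta>" using assms(2) by (auto simp: R_def add_nonneg_pos)
  define \<delta>' where "\<delta>' = min (\<delta>/2) (\<theta> / (1 + R))"
  have pos: "\<delta>' > 0" using R assms(1,2) by (simp add: \<delta>'_def)
  have "\<delta>' * (1 + \<bar>p\<bar>) \<le> g p" for p
  proof (cases "\<bar>p\<bar> \<le> R")
    case True
    have "\<delta>' * (1 + \<bar>p\<bar>) \<le> \<theta> / (1 + R) * (1 + R)"
      using True pos R(1) by (intro mult_mono) (auto simp: \<delta>'_def)
    also have "\<dots> = \<theta>" using R by simp
    finally show ?thesis using assms(3)[of p] by linarith
  next
    case False
    have "\<delta>' * (1 + \<bar>p\<bar>) \<le> \<delta>/2 * (1 + \<bar>p\<bar>)"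
      unfolding \<delta>'_def by (intro mult_right_mono min.cobounded1) auto
    also have "\<dots> \<le> \<delta> * \<bar>p\<bar> - C"
    proof -
      have "\<delta>/2 * R \<le> \<delta>/2 * \<bar>p\<bar>" using False assms(2) by (intro mult_left_mono) auto
      moreover have "\<delta>/2 * (1 + \<bar>p\<bar>) = \<delta>/2 + \<delta>/2 * \<bar>p\<bar>" "\<delta> * \<bar>p\<bar> = \<delta>/2 * \<bar>p\<bar> + \<delta>/2 * \<bar>p\<bar>"
        by (simp_all add: algebra_simps)
      ultimately show ?thesis using R(2) assms(2) abs_ge_self[of C] by linarith
    qed
    finally show ?thesis using assms(4)[of p] by linarith
  qed
  then show ?thesis using pos by blast
qed

definition strip_hamiltonian :: "real \<Rightarrow> (real \<Rightarrow> real \<Rightarrow> real) \<Rightarrow> bool" where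
  "strip_hamiltonian L h \<longleftrightarrow> 0 < L \<and> continuous_on ({0..L} \<times> UNIV) (\<lambda>(s, p). h s p) \<and>
     (\<forall>s\<in>{0..L}. convex_on UNIV (h s)) \<and> (\<exists>\<delta>>0. \<exists>C. \<forall>s\<in>{0..L}. \<forall>p. \<delta> * \<bar>p\<bar> - C \<le> h s p)"

text \<open>M bounds |h| at p = 0 and R is such that h \<ge> M + 1 for |p| \<ge> R. Convexity along
  the ray from 0 then forces growth at rate 1/R beyond R; inside, compactness bounds h.\<close>

lemma strip_hamiltonianI:
  assumes "0 < L" and cont: "continuous_on ({0..L} \<times> UNIV) (\<lambda>(s, p). h s p)"
    and conv: "\<And>s. s \<in> {0..L} \<Longrightarrow> convex_on UNIV (h s)" and coer: "coercive_uniformly {0..L} h"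
  shows "strip_hamiltonian L h"
proof -
  have cb: "\<exists>M. \<forall>s\<in>{0..L}. \<forall>p. \<bar>p\<bar> \<le> R \<longrightarrow> \<bar>h s p\<bar> \<le> M" for R
  proof -
    have "compact ((\<lambda>(s, p). h s p) ` ({0..L} \<times> {-R..R}))"
      by (intro compact_continuous_image continuous_on_subset[OF cont] compact_Times) auto
    then obtain M where "\<forall>x\<in>(\<lambda>(s, p). h s p) ` ({0..L} \<times> {-R..R}). norm x \<le> M"
      using compact_imp_bounded bounded_iff by metis
    then show ?thesis by (intro exI[of _ M]) force
  qed
  obtain M where M: "\<And>s p. s \<in> {0..L} \<Longrightarrow> \<bar>p\<bar> \<le> 0 \<Longrightarrow> \<bar>h s p\<bar> \<le> M" using cb by meson
  then have M0: "\<And>s. s \<in> {0..L} \<Longrightarrow> \<bar>h s 0\<bar> \<le> M" by simp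
  have "0 \<le> M" using M0[of 0] \<open>0 < L\<close> by auto
  obtain R0 where R0: "\<And>p. R0 \<le> \<bar>p\<bar> \<Longrightarrow> \<forall>s\<in>{0..L}. M + 1 \<le> h s p"
    using coer unfolding coercive_uniformly_def eventually_at_infinity real_norm_def by meson
  define R where "R = \<bar>R0\<bar> + 1"
  have R: "R > 0" "\<And>p s. R \<le> \<bar>p\<bar> \<Longrightarrow> s \<in> {0..L} \<Longrightarrow> M + 1 \<le> h s p"
    using R0 by (auto simp: R_def)
  obtain M2 where M2: "\<And>s p. s \<in> {0..L} \<Longrightarrow> \<bar>p\<bar> \<le> R \<Longrightarrow> \<bar>h s p\<bar> \<le> M2" using cb by meson
  have M20: "0 \<le> M2" using M2[of 0 0] R \<open>0 < L\<close> by auto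
  have "1/R * \<bar>p\<bar> - (M2 + 1) \<le> h s p" if s: "s \<in> {0..L}" for s p
  proof (cases "\<bar>p\<bar> \<le> R")
    case True
    then have "1/R * \<bar>p\<bar> \<le> 1" using R by (simp add: field_simps)
    then show ?thesis using M2[OF s True] by (simp add: abs_le_iff)
  next
    case False
    define \<theta> where "\<theta> = R / \<bar>p\<bar>"
    have \<theta>: "0 < \<theta>" "\<theta> \<le> 1" "\<bar>\<theta> * p\<bar> = R" using False R by (auto simp: \<theta>_def abs_mult)
    have "h s ((1 - \<theta>) *\<^sub>R 0 + \<theta> *\<^sub>R p) \<le> (1 - \<theta>) * h s 0 + \<theta> * h s p"
      using conv[OF s] \<theta> by (intro convex_onD) auto
    moreover have "M + 1 \<le> h s (\<theta> * p)" using R(2)[OF _ s] \<theta> by simp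
    moreover have "(1 - \<theta>) * h s 0 \<le> (1 - \<theta>) * M"
      using M0[OF s] \<theta> by (intro mult_left_mono) (auto simp: abs_le_iff)
    ultimately have "1 \<le> \<theta> * (h s p - M)" by (simp add: algebra_simps)
    then have "1/R * \<bar>p\<bar> \<le> h s p - M" using \<theta> R False by (simp add: \<theta>_def field_simps)
    then show ?thesis using \<open>0 \<le> M\<close> M20 by linarith
  qed
  then have "\<exists>\<delta>>0. \<exists>C. \<forall>s\<in>{0..L}. \<forall>p. \<delta> * \<bar>p\<bar> - C \<le> h s p"
    using R(1) by (intro exI[of _ "1/R"] conjI exI[of _ "M2 + 1"]) auto
  then show ?thesis using assms unfolding strip_hamiltonian_def by blast
qed

text \<open>Half of the linear growth rate serves as \<nu> and the other half is the gap; the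
  constants are common to all s.\<close>

lemma tilt_small_slope:
  assumes "strip_hamiltonian L h"
  obtains \<nu> \<kappa> where "\<nu> > 0" "\<And>s. s \<in> {0..L} \<Longrightarrow> tilt (h s) \<nu> \<kappa>" "\<And>s. s \<in> {0..L} \<Longrightarrow> tilt (h s) (- \<nu>) \<kappa>"
    "\<And>s p. s \<in> {0..L} \<Longrightarrow> 0 \<le> h s p + \<nu> * p + \<kappa>" "\<And>s p. s \<in> {0..L} \<Longrightarrow> 0 \<le> h s p + - \<nu> * p + \<kappa>"
proof -
  obtain \<delta> C where d: "\<delta> > 0" "\<And>s p. s \<in> {0..L} \<Longrightarrow> \<delta> * \<bar>p\<bar> - C \<le> h s p"
    using assms unfolding strip_hamiltonian_def by blast
  have a: "\<delta>/2 * (1 + \<bar>p\<bar>) \<le> h s p + \<nu> * p + (C + \<delta>/2)" if "s \<in> {0..L}" "\<bar>\<nu>\<bar> = \<delta>/2" for s p \<nu>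
  proof -
    have "\<bar>\<nu> * p\<bar> = \<delta>/2 * \<bar>p\<bar>" using that(2) by (simp add: abs_mult)
    then have "- (\<delta>/2 * \<bar>p\<bar>) \<le> \<nu> * p" by linarith
    then show ?thesis using d(2)[OF that(1), of p] by (simp add: algebra_simps)
  qed
  have b: "0 \<le> \<delta>/2 * (1 + \<bar>p\<bar>)" for p using d(1) by simp
  show ?thesis
  proof (rule that[of "\<delta>/2" "C + \<delta>/2"])
    show "tilt (h s) (\<delta>/2) (C + \<delta>/2)" "tilt (h s) (- (\<delta>/2)) (C + \<delta>/2)" if "s \<in> {0..L}" for s
      unfolding tilt_def using a[OF that, of "\<delta>/2"] a[OF that, of "- (\<delta>/2)"] d(1) half_gt_zero[OF d(1)]
      by (metis abs_minus_cancel abs_of_pos)+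
    show "0 \<le> h s p + \<delta>/2 * p + (C + \<delta>/2)" "0 \<le> h s p + - (\<delta>/2) * p + (C + \<delta>/2)"
      if "s \<in> {0..L}" for s p
      by (rule order_trans[OF b a[OF that]]; use d(1) in simp)+
  qed (use d in auto)
qed

text \<open>A horizontal line just below the minimum. It bounds the growth in time at a fixed point
  of the arc.\<close>

lemma tilt_zero:
  assumes "strip_hamiltonian L h" "s \<in> {0..L}" "\<And>p. h s m \<le> h s p" "e > 0"
  shows "tilt (h s) 0 (e - h s m)"
proof -
  obtain \<delta> C where d: "\<delta> > 0" "\<And>s p. s \<in> {0..L} \<Longrightarrow> \<delta> * \<bar>p\<bar> - C \<le> h s p"
    using assms unfolding strip_hamiltonian_def by blast
  have "\<exists>\<delta>'>0. \<forall>p. \<delta>' * (1 + \<bar>p\<bar>) \<le> h s p + 0 * p + (e - h s m)"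
  proof (rule linear_growth_pos[OF assms(4) d(1)])
    show "\<delta> * \<bar>p\<bar> - (C - (e - h s m)) \<le> h s p + 0 * p + (e - h s m)" for p
      using d(2)[OF assms(2), of p] by simp
  qed (use assms(3) in auto)
  then show ?thesis unfolding tilt_def by simp
qed

text \<open>
  Tilting a supporting line of \<open>h\<close> at \<open>q\<close> towards the horizontal makes the gap to \<open>h\<close> grow
  linearly in both directions.
\<close>

lemma tilt_support:
  fixes h :: "real \<Rightarrow> real"
  assumes "convex_on UNIV h" "\<delta> > 0" "\<And>p. \<delta> * \<bar>p\<bar> - C \<le> h p"
    and "q < m" "h m < h q" "- b < h q"
  obtains \<nu> \<kappa> where "\<nu> > 0" "tilt h \<nu> \<kappa>" "\<kappa> + \<nu> * q < b"
proof -
  \<comment> \<open>-v is the right derivative of h at q, an infimum of difference quotients, so the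
    line through (q, h q) with slope -v supports h. It must descend because h m < h q with m >
    q.\<close>
  define v where "v = - (INF t\<in>{q<..} \<inter> UNIV. (h q - h t) / (q - t))"
  have sup: "h q - v * (p - q) \<le> h p" for p
    using convex_le_Inf_differential[OF assms(1), of q p] by (simp add: v_def)
  have "0 < v * (m - q)" using sup[of m] assms(5) by linarith
  then have v: "v > 0" using assms(4) by (simp add: zero_less_mult_iff)
  \<comment> \<open>y is the midpoint of -b and h q. A line through (q, y) has \<kappa> + \<nu> q =
    - y < b, and the gap h q - y = 2 \<theta> is shared: one \<theta> is spent on the tilt, one is
    kept.\<close>
  define y where "y = (h q - b) / 2"
  define \<theta> where "\<theta> = (h q - y) / 2"
  have y: "- b < y" "\<theta> > 0" "h q = y + 2 * \<theta>" using assms(6) by (simp_all add: y_def \<theta>_def field_simps)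
  define R where "R = 2 * (\<bar>C + y\<bar> + \<theta>) / v"
  have "0 < \<bar>C + y\<bar> + \<theta>" using y by linarith
  then have R: "R > 0" "v/2 * R = \<bar>C + y\<bar> + \<theta>" using v by (simp_all add: R_def)
  \<comment> \<open>The tilt \<epsilon> costs at most \<theta> on [q, q + R]. Beyond q + R the slope
    of at least v/2 that remains beats the constant lower bound -C of h.\<close>
  define \<epsilon> where "\<epsilon> = min (v/2) (\<theta> / R)"
  have \<epsilon>: "\<epsilon> > 0" "\<epsilon> \<le> v/2" "\<epsilon> * R \<le> \<theta>"
  proof -
    have "\<epsilon> * R \<le> \<theta> / R * R" using R by (intro mult_right_mono) (auto simp: \<epsilon>_def)
    then show "\<epsilon> * R \<le> \<theta>" using R by simp
    show "\<epsilon> \<le> v/2" unfolding \<epsilon>_def by (rule min.cobounded1)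
  qed (use v y R in \<open>auto simp: \<epsilon>_def\<close>)
  define \<nu> where "\<nu> = v - \<epsilon>"
  define \<kappa> where "\<kappa> = - (y + \<nu> * q)"
  have g: "h p + \<nu> * p + \<kappa> = h p - y + \<nu> * (p - q)" for p by (simp add: \<kappa>_def algebra_simps)
  have lo: "- C \<le> h p" for p
  proof -
    have "0 \<le> \<delta> * \<bar>p\<bar>" using assms(2) by simp
    then show ?thesis using assms(3)[of p] by linarith
  qed
  have g1: "2 * \<theta> + \<epsilon> * (q - p) \<le> h p + \<nu> * p + \<kappa>" for p
    using sup[of p] y(3) unfolding g by (simp add: \<nu>_def algebra_simps)
  have g2: "v/2 * (p - q) - (C + y) \<le> h p + \<nu> * p + \<kappa>" if "q \<le> p" for p
  proof -
    have "v/2 * (p - q) \<le> \<nu> * (p - q)" using that \<epsilon>(2) by (intro mult_right_mono) (auto simp: \<nu>_def)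
    then show ?thesis using lo[of p] unfolding g by linarith
  qed
  have pos: "\<theta> \<le> h p + \<nu> * p + \<kappa>" for p
  proof -
    consider "p \<le> q" | "q \<le> p" "p - q \<le> R" | "q \<le> p" "R \<le> p - q" by linarith
    then show ?thesis
    proof cases
      case 1
      then have "0 \<le> \<epsilon> * (q - p)" using \<epsilon> by simp
      then show ?thesis using g1[of p] y by linarith
    next
      case 2
      have "\<epsilon> * (p - q) \<le> \<epsilon> * R" using 2 \<epsilon> by (intro mult_left_mono) auto
      moreover have "\<epsilon> * (q - p) = - (\<epsilon> * (p - q))" by (simp add: algebra_simps)
      ultimately show ?thesis using g1[of p] \<epsilon>(3) by linarith
    next
      case 3
      have "v/2 * R \<le> v/2 * (p - q)" using 3 v by (intro mult_left_mono) auto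
      then show ?thesis using g2[OF 3(1)] R(2) by linarith
    qed
  qed
  have lin: "\<epsilon> * \<bar>p\<bar> - (\<epsilon> * \<bar>q\<bar> + \<bar>C + y\<bar>) \<le> h p + \<nu> * p + \<kappa>" for p
  proof -
    have "\<epsilon> * \<bar>p\<bar> \<le> \<epsilon> * (\<bar>p - q\<bar> + \<bar>q\<bar>)" using \<epsilon> by (intro mult_left_mono) auto
    moreover have "\<epsilon> * \<bar>p - q\<bar> - \<bar>C + y\<bar> \<le> h p + \<nu> * p + \<kappa>"
    proof (cases "p \<le> q")
      case True
      then show ?thesis using g1[of p] y by simp
    next
      case False
      then have "\<epsilon> * (p - q) \<le> v/2 * (p - q)" using \<epsilon> by (intro mult_right_mono) auto
      moreover have "\<bar>p - q\<bar> = p - q" using False by simp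
      ultimately show ?thesis using g2[of p] False abs_ge_self[of "C + y"] by linarith
    qed
    ultimately show ?thesis by (simp add: algebra_simps)
  qed
  have "tilt h \<nu> \<kappa>" unfolding tilt_def by (rule linear_growth_pos[OF y(2) \<epsilon>(1) pos lin])
  moreover have "\<nu> > 0" using \<epsilon> v by (simp add: \<nu>_def)
  moreover have "\<kappa> + \<nu> * q < b" using y(1) by (simp add: \<kappa>_def)
  ultimately show ?thesis using that by blast
qed

text \<open>For |p| \<le> R uniform continuity changes the gap by less than \<delta>. For larger |p|
  convexity along the ray from 0 applies, because at |p| = R the gap exceeds its value at 0; the 3
  in the choice of R leaves room for the perturbation at both points.\<close>

lemma tilt_nearby:
  assumes "strip_hamiltonian L h" "s0 \<in> {0..L}" "tilt (h s0) \<nu> \<kappa>"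
  obtains d where "d > 0" "\<And>s p. s \<in> {0..L} \<Longrightarrow> \<bar>s - s0\<bar> < d \<Longrightarrow> 0 \<le> h s p + \<nu> * p + \<kappa>"
proof -
  have cont: "continuous_on ({0..L} \<times> UNIV) (\<lambda>(s, p). h s p)"
    and conv: "\<And>s. s \<in> {0..L} \<Longrightarrow> convex_on UNIV (h s)"
    using assms(1) unfolding strip_hamiltonian_def by auto
  obtain \<delta> where \<delta>: "\<delta> > 0" "\<And>p. \<delta> * (1 + \<bar>p\<bar>) \<le> h s0 p + \<nu> * p + \<kappa>"
    using assms(3) unfolding tilt_def by blast
  define g where "g s p = h s p + \<nu> * p + \<kappa>" for s p
  define R where "R = (\<bar>g s0 0\<bar> + 3) / \<delta>"
  have R: "R > 0" "\<delta> * R = \<bar>g s0 0\<bar> + 3" using \<delta> by (auto simp: R_def)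
  have "uniformly_continuous_on ({0..L} \<times> {-R..R}) (\<lambda>(s, p). h s p)"
    by (intro compact_uniformly_continuous continuous_on_subset[OF cont] compact_Times) auto
  then obtain d where d: "d > 0" "\<And>x y. x \<in> {0..L} \<times> {-R..R} \<Longrightarrow> y \<in> {0..L} \<times> {-R..R} \<Longrightarrow> dist x y < d \<Longrightarrow>
      dist ((\<lambda>(s, p). h s p) x) ((\<lambda>(s, p). h s p) y) < min \<delta> 1"
    unfolding uniformly_continuous_on_def using \<delta>(1) by (metis min_less_iff_conj zero_less_one dist_commute)
  have near: "\<bar>g s p - g s0 p\<bar> < min \<delta> 1" if "s \<in> {0..L}" "\<bar>s - s0\<bar> < d" "\<bar>p\<bar> \<le> R" for s p
    using d(2)[of "(s, p)" "(s0, p)"] that assms(2)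
    by (auto simp: g_def dist_Pair_Pair dist_real_def abs_le_iff)
  show ?thesis
  proof (rule that[OF d(1)])
    fix s p assume s: "s \<in> {0..L}" "\<bar>s - s0\<bar> < d"
    have "0 \<le> g s p"
    proof (cases "\<bar>p\<bar> \<le> R")
      case True
      have "\<delta> + \<delta> * \<bar>p\<bar> \<le> g s0 p" using \<delta>(2)[of p] by (simp add: g_def algebra_simps)
      moreover have "0 \<le> \<delta> * \<bar>p\<bar>" using \<delta>(1) by simp
      moreover have "\<bar>g s p - g s0 p\<bar> < \<delta>" using near[OF s True] by simp
      ultimately show ?thesis unfolding abs_less_iff by linarith
    next
      case False
      define \<theta> where "\<theta> = R / \<bar>p\<bar>"
      have \<theta>: "0 < \<theta>" "\<theta> \<le> 1" "\<bar>\<theta> * p\<bar> = R" using False R by (auto simp: \<theta>_def abs_mult)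
      have "h s ((1 - \<theta>) *\<^sub>R 0 + \<theta> *\<^sub>R p) \<le> (1 - \<theta>) * h s 0 + \<theta> * h s p"
        using conv[OF s(1)] \<theta> by (intro convex_onD) auto
      then have 1: "g s (\<theta> * p) \<le> (1 - \<theta>) * g s 0 + \<theta> * g s p"
        by (simp add: g_def algebra_simps)
      have "\<delta> + \<delta> * R \<le> g s0 (\<theta> * p)" using \<delta>(2)[of "\<theta> * p"] \<theta>(3) by (simp add: g_def algebra_simps)
      then have 2: "\<bar>g s0 0\<bar> + 2 \<le> g s (\<theta> * p)"
        using near[OF s, of "\<theta> * p"] \<theta>(3) \<delta>(1) R(2) by (auto simp: abs_less_iff)
      have 3: "g s 0 \<le> \<bar>g s0 0\<bar> + 1" "0 \<le> g s 0"
        using near[OF s, of 0] R(1) \<delta>(2)[of 0] by (auto simp: g_def abs_less_iff)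
      have "(1 - \<theta>) * g s 0 \<le> 1 * g s 0" using 3 \<theta> by (intro mult_right_mono) auto
      then have "0 \<le> \<theta> * g s p" using 1 2 3 by linarith
      then show ?thesis using \<theta> by (simp add: zero_le_mult_iff)
    qed
    then show "0 \<le> h s p + \<nu> * p + \<kappa>" by (simp add: g_def)
  qed
qed

section \<open>Transport along characteristics\<close>

text \<open>
  If every upper jet satisfies \<open>b + \<nu> p \<le> \<kappa>\<close>, then \<open>U\<close> grows at rate at most \<open>\<kappa>\<close> along lines of
  slope \<open>\<nu>\<close>.  The test function is steep in the distance \<open>\<xi>\<close> to the line, which does not
  contribute to \<open>b + \<nu> p\<close>; the high power of time replaces a terminal condition.
\<close>

lemma transport:
  fixes U :: "real \<times> real \<Rightarrow> real"
  assumes usc: "usc_on ({l..r} \<times> {ta..tb}) U"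
    and sa: "sa \<in> {l..r}" and \<sigma>: "0 < \<sigma>" "ta + \<sigma> < tb" and end_in: "sa + \<nu> * \<sigma> \<in> {l..r}"
    and jets: "\<And>s t p b. s \<in> A \<Longrightarrow> s \<in> {l..r} \<Longrightarrow> ta < t \<Longrightarrow> t < tb \<Longrightarrow>
        upper_jet ({l..r} \<times> {ta..tb}) U s t p b \<Longrightarrow> b + \<nu> * p \<le> \<kappa>"
    and cb: "0 < cb" "\<And>s t. s \<in> {l..r} \<Longrightarrow> s \<notin> A \<Longrightarrow> t \<in> {ta..tb} \<Longrightarrow> cb * (t - ta) \<le> \<bar>s - sa - \<nu> * (t - ta)\<bar>"
  shows "U (sa + \<nu> * \<sigma>, ta + \<sigma>) \<le> U (sa, ta) + \<kappa> * \<sigma>"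
proof (rule field_le_epsilon)
  fix e :: real assume "e > 0"
  define D where "D = {l..r} \<times> {ta..tb}"
  \<comment> \<open>The error budget: 2 \<eta> in the bound on the maximum, \<eta> \<sigma> from
    replacing \<kappa> by \<kappa>', and \<eta> for the power term at time ta + \<sigma>, where its
    base equals 1.\<close>
  define \<eta> where "\<eta> = e / (\<sigma> + 3)"
  have \<eta>: "\<eta> > 0" "\<eta> * (\<sigma> + 3) = e" using \<open>e > 0\<close> \<sigma> by (auto simp: \<eta>_def)
  define \<kappa>' where "\<kappa>' = \<kappa> + \<eta>"
  define N where "N = U (sa, ta)"
  have t12: "ta < tb" using \<sigma> by linarith
  have s1D: "(sa, ta) \<in> D" using sa t12 by (auto simp: D_def)
  have cD: "compact D" unfolding D_def by (intro compact_Times) auto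
  obtain zB where zB: "zB \<in> D" "\<And>z. z \<in> D \<Longrightarrow> U z \<le> U zB"
    using usc_on_attains_max[OF cD _ usc[folded D_def]] s1D by blast
  \<comment> \<open>B dominates U - N together with the largest possible effect of the drift
    \<kappa>' (t - ta).\<close>
  define B where "B = \<bar>U zB - N\<bar> + \<bar>\<kappa>'\<bar> * (tb - ta) + 1"
  have B: "U z - N \<le> B - \<bar>\<kappa>'\<bar> * (tb - ta)" if "z \<in> D" for z
    using zB(2)[OF that] by (auto simp: B_def)
  have "U (sa, ta) < N + \<eta>" using \<eta> by (simp add: N_def)
  then obtain d where d: "d > 0" "\<And>z. z \<in> D \<Longrightarrow> dist z (sa, ta) < d \<Longrightarrow> U z < N + \<eta>"
    using usc_onD[OF usc[folded D_def] s1D] by blast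
  define \<rho> where "\<rho> = d / 2"
  define \<rho>' where "\<rho>' = Min {\<rho>, \<rho> / (2 * (\<bar>\<nu>\<bar> + 1)), \<eta> / (\<bar>\<kappa>'\<bar> + 1)}"
  have "\<rho> > 0" using d by (simp add: \<rho>_def)
  then have \<rho>: "\<rho> > 0" "\<rho>' > 0" "\<rho>' \<le> \<rho>" using \<eta> by (simp_all add: \<rho>'_def)
  have \<rho>\<nu>: "\<bar>\<nu>\<bar> * \<rho>' \<le> \<rho> / 2"
  proof -
    have "\<rho>' \<le> \<rho> / (2 * (\<bar>\<nu>\<bar> + 1))" by (simp add: \<rho>'_def)
    then have "(\<bar>\<nu>\<bar> + 1) * \<rho>' \<le> \<rho> / 2" by (simp add: field_simps)
    then show ?thesis using \<rho> by (simp add: algebra_simps)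
  qed
  have \<rho>\<kappa>: "\<bar>\<kappa>'\<bar> * \<rho>' \<le> \<eta>"
  proof -
    have "\<rho>' \<le> \<eta> / (\<bar>\<kappa>'\<bar> + 1)" by (simp add: \<rho>'_def)
    then have "(\<bar>\<kappa>'\<bar> + 1) * \<rho>' \<le> \<eta>" by (simp add: field_simps)
    then show ?thesis using \<rho> by (simp add: algebra_simps)
  qed
  have box: "U (s, t) < N + \<eta>" if "(s, t) \<in> D" "\<bar>s - sa\<bar> < \<rho>" "\<bar>t - ta\<bar> < \<rho>" for s t
  proof (rule d(2)[OF that(1)])
    have "dist (s, t) (sa, ta) \<le> \<bar>s - sa\<bar> + \<bar>t - ta\<bar>"
      using norm_Pair_le[of "s - sa" "t - ta"] by (simp add: dist_norm)
    then show "dist (s, t) (sa, ta) < d" using that by (simp add: \<rho>_def)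
  qed
  \<comment> \<open>A point of the bottom or of a side that is not close to the start satisfies
    |\<xi>| \<ge> c1: \<rho>/2 accounts for a displacement in s at early times, cb * \<rho>' for the
    sides later on. K is then chosen so that the penalty reaches B there.\<close>
  define c1 where "c1 = min (\<rho>/2) (cb * \<rho>')"
  have c1: "c1 > 0" using \<rho> cb by (simp add: c1_def)
  define K where "K = B / c1\<^sup>2"
  have B0: "0 < B" unfolding B_def using t12 by (intro add_nonneg_pos add_nonneg_nonneg) auto
  then have K: "K \<ge> 0" "K * c1\<^sup>2 = B" using c1 by (auto simp: K_def)
  have "1 < (tb - ta) / \<sigma>" using \<sigma> by (simp add: field_simps)
  then obtain n where n: "B / \<eta> < ((tb - ta) / \<sigma>) ^ n" using real_arch_pow by blast
  then have n': "B < \<eta> * ((tb - ta) / \<sigma>) ^ n" using \<eta> by (simp add: field_simps)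
  define \<xi> where "\<xi> s t = s - sa - \<nu> * (t - ta)" for s t
  define \<Phi> where "\<Phi> = (\<lambda>(s, t). \<kappa>' * (t - ta) + K * (\<xi> s t)\<^sup>2 + \<eta> * ((t - ta) / \<sigma>) ^ n)"
  have uscF: "usc_on D (\<lambda>z. U z + - \<Phi> z)"
  proof (rule usc_on_add[OF usc[folded D_def] usc_on_continuous])
    show "continuous_on D (\<lambda>z. - \<Phi> z)"
      unfolding \<Phi>_def \<xi>_def case_prod_unfold using \<sigma> by (auto intro!: continuous_intros)
  qed
  have "D \<noteq> {}" using s1D by blast
  obtain z where "z \<in> D" "\<And>y. y \<in> D \<Longrightarrow> U y + - \<Phi> y \<le> U z + - \<Phi> z"
    by (rule usc_on_attains_max[OF cD \<open>D \<noteq> {}\<close> uscF]) (rule that)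
  then have z: "z \<in> D" "\<And>y. y \<in> D \<Longrightarrow> U y - \<Phi> y \<le> U z - \<Phi> z" by simp_all
  obtain s t where st: "z = (s, t)" by (cases z)
  have stD: "s \<in> {l..r}" "t \<in> {ta..tb}" using z st by (auto simp: D_def)
  have pw: "0 \<le> \<eta> * ((t - ta) / \<sigma>) ^ n" using \<eta> \<sigma> stD by simp
  have ktle: "- (\<bar>\<kappa>'\<bar> * (tb - ta)) \<le> \<kappa>' * (t - ta)"
  proof -
    have "\<bar>\<kappa>'\<bar> * (t - ta) \<le> \<bar>\<kappa>'\<bar> * (tb - ta)" using stD by (intro mult_left_mono) auto
    moreover have "- (\<bar>\<kappa>'\<bar> * (t - ta)) \<le> \<kappa>' * (t - ta)"
      using stD mult_right_mono[of "- \<bar>\<kappa>'\<bar>" \<kappa>' "t - ta"] by simp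
    ultimately show ?thesis by linarith
  qed
  have Kxi: "0 \<le> K * (\<xi> s t)\<^sup>2" using K by simp
  have main: "U z - \<Phi> z \<le> N + 2 * \<eta>"
  proof -
    consider "t = tb" | "t = ta \<or> s \<notin> A" | "ta < t" "t < tb" "s \<in> A" using stD by fastforce
    then show ?thesis
    proof cases
      case 1
      then show ?thesis using B[OF z(1)] n' ktle Kxi \<eta> unfolding st \<Phi>_def by auto
    next
      case 2
      show ?thesis
      proof (cases "\<bar>s - sa\<bar> < \<rho> \<and> t - ta < \<rho>'")
        case True
        then have "U z < N + \<eta>" using box[of s t] z st stD \<rho> by auto
        moreover have "- \<eta> \<le> \<kappa>' * (t - ta)"
        proof -
          have "\<bar>\<kappa>'\<bar> * (t - ta) \<le> \<bar>\<kappa>'\<bar> * \<rho>'" using True by (intro mult_left_mono) auto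
          moreover have "- (\<bar>\<kappa>'\<bar> * (t - ta)) \<le> \<kappa>' * (t - ta)"
            using stD mult_right_mono[of "- \<bar>\<kappa>'\<bar>" \<kappa>' "t - ta"] by simp
          ultimately show ?thesis using \<rho>\<kappa> by linarith
        qed
        ultimately show ?thesis using Kxi pw unfolding st \<Phi>_def by auto
      next
        case False
        have "c1 \<le> \<bar>\<xi> s t\<bar>"
        proof (cases "\<rho>' \<le> t - ta")
          case True
          then have "s \<notin> A" using 2 \<rho> by auto
          have "cb * \<rho>' \<le> cb * (t - ta)" using True cb by simp
          also have "\<dots> \<le> \<bar>\<xi> s t\<bar>" using cb(2)[OF stD(1) \<open>s \<notin> A\<close> stD(2)] by (simp add: \<xi>_def)
          finally show ?thesis by (simp add: c1_def)
        next
          case F2: False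
          then have "\<rho> \<le> \<bar>s - sa\<bar>" using False by auto
          moreover have "\<bar>\<nu> * (t - ta)\<bar> \<le> \<bar>\<nu>\<bar> * \<rho>'"
            using F2 stD by (auto simp: abs_mult intro!: mult_left_mono)
          ultimately have "\<rho>/2 \<le> \<bar>\<xi> s t\<bar>" using \<rho>\<nu> unfolding \<xi>_def by linarith
          then show ?thesis by (simp add: c1_def)
        qed
        then have "c1\<^sup>2 \<le> \<bar>\<xi> s t\<bar>\<^sup>2" using c1 by (intro power_mono) auto
        then have "c1\<^sup>2 \<le> (\<xi> s t)\<^sup>2" by simp
        then have "K * c1\<^sup>2 \<le> K * (\<xi> s t)\<^sup>2" using K(1) by (rule mult_left_mono)
        then show ?thesis using B[OF z(1)] K ktle pw \<eta> unfolding st \<Phi>_def by auto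
      qed
    next
      case 3
      define b where "b = \<kappa>' - 2 * K * \<nu> * \<xi> s t + \<eta> * (real n * ((t - ta) / \<sigma>) ^ (n - 1) / \<sigma>)"
      have "(\<Phi> has_derivative (\<lambda>(h, k). (2 * K * \<xi> s t) * h + b * k)) (at (s, t) within D)"
        unfolding \<Phi>_def \<xi>_def b_def case_prod_unfold using \<sigma>
        by (auto intro!: derivative_eq_intros simp: fun_eq_iff algebra_simps)
      then have "upper_jet D U s t (2 * K * \<xi> s t) b"
        by (rule local_max_upper_jet[where d = 1]) (use z st in auto)
      from jets[OF 3(3) stD(1) 3(1,2) this[unfolded D_def]]
      have "b + \<nu> * (2 * K * \<xi> s t) \<le> \<kappa>" .
      moreover have "0 \<le> \<eta> * (real n * ((t - ta) / \<sigma>) ^ (n - 1) / \<sigma>)" using 3 \<eta> \<sigma> by simp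
      ultimately have False using \<eta> by (simp add: b_def \<kappa>'_def algebra_simps)
      then show ?thesis ..
    qed
  qed
  have "(sa + \<nu> * \<sigma>, ta + \<sigma>) \<in> D" using end_in \<sigma> by (auto simp: D_def)
  from z(2)[OF this] main
  have "U (sa + \<nu> * \<sigma>, ta + \<sigma>) \<le> N + 2 * \<eta> + \<kappa>' * \<sigma> + \<eta>"
    using \<sigma> by (simp add: \<Phi>_def \<xi>_def)
  also have "\<dots> = U (sa, ta) + \<kappa> * \<sigma> + e" using \<eta>(2) by (simp add: N_def \<kappa>'_def algebra_simps)
  finally show "U (sa + \<nu> * \<sigma>, ta + \<sigma>) \<le> U (sa, ta) + \<kappa> * \<sigma> + e" .
qed

section \<open>Sub- and supersolutions on a strip\<close>

abbreviation strip :: "real \<Rightarrow> (real \<times> real) set" where "strip L \<equiv> {0..L} \<times> {0..}"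

definition strip_sub :: "real \<Rightarrow> (real \<Rightarrow> real \<Rightarrow> real) \<Rightarrow> (real \<times> real \<Rightarrow> real) \<Rightarrow> bool" where
  "strip_sub L h U \<longleftrightarrow> (\<forall>s\<in>{0<..<L}. \<forall>t>0. \<forall>p a. upper_jet (strip L) U s t p a \<longrightarrow> a + h s p \<le> 0)"

definition strip_super :: "real \<Rightarrow> (real \<Rightarrow> real \<Rightarrow> real) \<Rightarrow> (real \<times> real \<Rightarrow> real) \<Rightarrow> bool" where
  "strip_super L h V \<longleftrightarrow> (\<forall>s\<in>{0<..<L}. \<forall>t>0. \<forall>p a. lower_jet (strip L) V s t p a \<longrightarrow> 0 \<le> a + h s p)"

lemma strip_subD: "strip_sub L h U \<Longrightarrow> 0 < s \<Longrightarrow> s < L \<Longrightarrow> 0 < t \<Longrightarrow> upper_jet (strip L) U s t p a \<Longrightarrow> a + h s p \<le> 0"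
  unfolding strip_sub_def by auto

lemma strip_superD: "strip_super L h V \<Longrightarrow> 0 < s \<Longrightarrow> s < L \<Longrightarrow> 0 < t \<Longrightarrow> lower_jet (strip L) V s t p a \<Longrightarrow> 0 \<le> a + h s p"
  unfolding strip_super_def by auto

lemma upper_jet_box_strip:
  assumes "upper_jet ({l..r} \<times> {ta..tb}) U s t p b" "ta < t" "t < tb"
    and "d > 0" "\<And>x. x \<in> {0..L} \<Longrightarrow> \<bar>x - s\<bar> < d \<Longrightarrow> x \<in> {l..r}"
  shows "upper_jet (strip L) U s t p b"
proof (rule lower_jet_local[OF assms(1), of "min d (min (t - ta) (tb - t))"])
  fix h k assume "\<bar>h\<bar> < min d (min (t - ta) (tb - t))" "\<bar>k\<bar> < min d (min (t - ta) (tb - t))" "(s + h, t + k) \<in> strip L"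
  then show "(s + h, t + k) \<in> {l..r} \<times> {ta..tb}" using assms(5)[of "s + h"] by auto
qed (use assms in auto)

text \<open>Upper jets satisfy b + h s p \<le> 0, so h s p \<ge> \<nu> p - \<kappa> gives the jet
  condition of \<open>transport\<close>. The line, prolonged by a short time \<tau>, stays at
  distance g/2 from both sides, which yields the separation constant.\<close>

lemma transport_interior:
  assumes U: "usc_on (strip L) U" "strip_sub L h U"
    and lr: "0 < l" "r < L" "\<And>s p. s \<in> {l..r} \<Longrightarrow> 0 \<le> h s p + - \<nu> * p + \<kappa>"
    and s: "s \<in> {l<..<r}" "s + \<nu> * \<sigma> \<in> {l<..<r}" and t: "0 \<le> t" "0 < \<sigma>"
  shows "U (s + \<nu> * \<sigma>, t + \<sigma>) \<le> U (s, t) + \<kappa> * \<sigma>"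
proof -
  define g where "g = Min {s - l, r - s, s + \<nu> * \<sigma> - l, r - (s + \<nu> * \<sigma>)}"
  have g: "g > 0" "l + g \<le> s" "s + g \<le> r" "l + g \<le> s + \<nu> * \<sigma>" "s + \<nu> * \<sigma> + g \<le> r"
    using s by (auto simp: g_def)
  define \<tau> where "\<tau> = g / (2 * (\<bar>\<nu>\<bar> + 1))"
  have \<tau>: "\<tau> > 0" "\<bar>\<nu>\<bar> * \<tau> \<le> g / 2"
    using g(1) by (auto simp: \<tau>_def field_simps)
  have inner: "l + g/2 \<le> s + \<nu> * r'" "s + \<nu> * r' \<le> r - g/2" if "0 \<le> r'" "r' \<le> \<sigma> + \<tau>" for r'
  proof -
    have *: "\<bar>\<nu> * (r' - r'')\<bar> \<le> g / 2" if "\<bar>r' - r''\<bar> \<le> \<tau>" for r''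
      using mult_left_mono[OF that, of "\<bar>\<nu>\<bar>"] \<tau>(2) by (simp add: abs_mult)
    have "l + g/2 \<le> s + \<nu> * r' \<and> s + \<nu> * r' \<le> r - g/2"
    proof (cases "r' \<le> \<sigma>")
      case True
      define w where "w = r' / \<sigma>"
      have w: "0 \<le> w" "w \<le> 1" "\<nu> * r' = w * (\<nu> * \<sigma>)" using that True t by (auto simp: w_def)
      have "s + \<nu> * r' = (1 - w) * s + w * (s + \<nu> * \<sigma>)" by (simp add: w(3) algebra_simps)
      moreover have "(1 - w) * (l + g) \<le> (1 - w) * s" "(1 - w) * s \<le> (1 - w) * (r - g)"
        by (rule mult_left_mono; use w g in linarith)+
      moreover have "w * (l + g) \<le> w * (s + \<nu> * \<sigma>)"
        by (rule mult_left_mono) (use w g in linarith)+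
      moreover have "w * (s + \<nu> * \<sigma>) \<le> w * (r - g)"
        by (rule mult_left_mono) (use w g in linarith)+
      moreover have "(1 - w) * (l + g) + w * (l + g) = l + g" "(1 - w) * (r - g) + w * (r - g) = r - g"
        by (simp_all add: algebra_simps)
      ultimately show ?thesis using g(1) by linarith
    next
      case False
      have "\<nu> * r' = \<nu> * \<sigma> + \<nu> * (r' - \<sigma>)" by (simp add: algebra_simps)
      then show ?thesis using *[of \<sigma>] False that g unfolding abs_le_iff by linarith
    qed
    then show "l + g/2 \<le> s + \<nu> * r'" "s + \<nu> * r' \<le> r - g/2" by auto
  qed
  show ?thesis
  proof (rule transport[where l = l and r = r and A = "{l<..<r}" and tb = "t + \<sigma> + \<tau>" and cb = "g / 2 / (\<sigma> + \<tau>)"])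
    show "usc_on ({l..r} \<times> {t..t + \<sigma> + \<tau>}) U" using U(1) lr t by (auto intro: usc_on_subset)
    show "b + \<nu> * p \<le> \<kappa>" if a: "x \<in> {l<..<r}" "x \<in> {l..r}" "t < y" "y < t + \<sigma> + \<tau>"
      "upper_jet ({l..r} \<times> {t..t + \<sigma> + \<tau>}) U x y p b" for x y p b
    proof -
      have "upper_jet (strip L) U x y p b"
        by (rule upper_jet_box_strip[OF a(5,3,4), of "min (x - l) (r - x)"]) (use a in auto)
      then have "b + h x p \<le> 0" by (rule strip_subD[OF U(2), rotated 3]) (use a lr t in auto)
      then show ?thesis using lr(3)[OF a(2), of p] by linarith
    qed
    show "g / 2 / (\<sigma> + \<tau>) * (y - t) \<le> \<bar>x - s - \<nu> * (y - t)\<bar>"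
      if a: "x \<in> {l..r}" "x \<notin> {l<..<r}" "y \<in> {t..t + \<sigma> + \<tau>}" for x y
    proof -
      have "(y - t) / (\<sigma> + \<tau>) \<le> 1" using a t \<tau> by (simp add: field_simps)
      then have "g / 2 * ((y - t) / (\<sigma> + \<tau>)) \<le> g / 2 * 1" using g by (intro mult_left_mono) auto
      moreover have "g / 2 / (\<sigma> + \<tau>) * (y - t) = g / 2 * ((y - t) / (\<sigma> + \<tau>))" by simp
      moreover have "x = l \<or> x = r" using a by auto
      moreover have "l + g/2 \<le> s + \<nu> * (y - t)" "s + \<nu> * (y - t) \<le> r - g/2" using a by (intro inner; simp)+
      ultimately show ?thesis by linarith
    qed
  qed (use s t \<tau> g in auto)
qed

text \<open>The line starts on the side s = 0 but leaves it at speed \<nu>, so its distance from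
  this side is \<nu> (y - t), as the separation condition of \<open>transport\<close> requires. The
  values on the base thus act as data.\<close>

lemma transport_outward:
  assumes U: "usc_on (strip L) U" "strip_sub L h U"
    and \<nu>: "0 < \<nu>" "\<nu> * \<sigma> < r" "r \<le> L" "\<And>s p. s \<in> {0..r} \<Longrightarrow> 0 \<le> h s p + - \<nu> * p + \<kappa>" and t: "0 \<le> t" "0 < \<sigma>"
  shows "U (\<nu> * \<sigma>, t + \<sigma>) \<le> U (0, t) + \<kappa> * \<sigma>"
proof -
  define \<tau> where "\<tau> = (r / \<nu> - \<sigma>) / 2"
  have \<tau>: "\<tau> > 0" "\<nu> * (\<sigma> + \<tau>) < r" using \<nu> by (auto simp: \<tau>_def field_simps)
  define g where "g = r - \<nu> * (\<sigma> + \<tau>)"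
  have g: "g > 0" using \<tau> by (simp add: g_def)
  have "U (0 + \<nu> * \<sigma>, t + \<sigma>) \<le> U (0, t) + \<kappa> * \<sigma>"
  proof (rule transport[where l = 0 and r = r and A = "{0<..<r}" and tb = "t + \<sigma> + \<tau>"
        and cb = "min \<nu> (g / (\<sigma> + \<tau>))"])
    show "usc_on ({0..r} \<times> {t..t + \<sigma> + \<tau>}) U" using U(1) \<nu> t by (auto intro: usc_on_subset)
    show "b + \<nu> * p \<le> \<kappa>" if a: "x \<in> {0<..<r}" "x \<in> {0..r}" "t < y" "y < t + \<sigma> + \<tau>"
      "upper_jet ({0..r} \<times> {t..t + \<sigma> + \<tau>}) U x y p b" for x y p b
    proof -
      have "upper_jet (strip L) U x y p b"
        by (rule upper_jet_box_strip[OF a(5,3,4), of "min x (r - x)"]) (use a in auto)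
      then have "b + h x p \<le> 0" by (rule strip_subD[OF U(2), rotated 3]) (use a \<nu> t in auto)
      then show ?thesis using \<nu>(4)[OF a(2), of p] by linarith
    qed
    show "min \<nu> (g / (\<sigma> + \<tau>)) * (y - t) \<le> \<bar>x - 0 - \<nu> * (y - t)\<bar>"
      if a: "x \<in> {0..r}" "x \<notin> {0<..<r}" "y \<in> {t..t + \<sigma> + \<tau>}" for x y
    proof -
      have y: "0 \<le> y - t" "y - t \<le> \<sigma> + \<tau>" using a by auto
      consider "x = 0" | "x = r" using a by force
      then show ?thesis
      proof cases
        case 1
        have "min \<nu> (g / (\<sigma> + \<tau>)) * (y - t) \<le> \<nu> * (y - t)" using y by (intro mult_right_mono) auto
        then show ?thesis using 1 y \<nu> by (simp add: abs_mult)
      next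
        case 2
        have "min \<nu> (g / (\<sigma> + \<tau>)) * (y - t) \<le> g / (\<sigma> + \<tau>) * (\<sigma> + \<tau>)"
          using y g t \<tau> by (intro mult_mono) auto
        also have "\<dots> = g" using t \<tau> by simp
        also have "g \<le> r - \<nu> * (y - t)" using y \<nu> by (simp add: g_def)
        finally show ?thesis using 2 by auto
      qed
    qed
    have "0 \<le> \<nu> * \<sigma>" using \<nu>(1) t(2) by simp
    then show "0 \<in> {0..r}" "0 + \<nu> * \<sigma> \<in> {0..r}" using \<nu> by auto
  qed (use t \<tau> \<nu> g in auto)
  then show ?thesis by simp
qed

text \<open>Here the line ends on the base, so the base cannot be treated as a separated side. It
  belongs to the set where jets are tested, and the hypothesis \<open>vertex\<close> supplies the
  inequality there.\<close>

lemma transport_inward: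
  assumes U: "usc_on (strip L) U" "strip_sub L h U"
    and \<nu>: "0 < \<nu>" "\<nu> * \<sigma> < r" "r \<le> L" "\<And>s p. s \<in> {0..r} \<Longrightarrow> 0 \<le> h s p + \<nu> * p + \<kappa>" and t: "0 \<le> t" "0 < \<sigma>"
    and vertex: "\<And>y p b. t < y \<Longrightarrow> upper_jet (strip L) U 0 y p b \<Longrightarrow> b + - \<nu> * p \<le> \<kappa>"
  shows "U (0, t + \<sigma>) \<le> U (\<nu> * \<sigma>, t) + \<kappa> * \<sigma>"
proof -
  have ns: "0 < \<nu> * \<sigma>" using \<nu>(1) t(2) by simp
  then have r0: "0 < r" using \<nu>(2) by linarith
  have "U (\<nu> * \<sigma> + - \<nu> * \<sigma>, t + \<sigma>) \<le> U (\<nu> * \<sigma>, t) + \<kappa> * \<sigma>"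
  proof (rule transport[where l = 0 and r = r and A = "{0..<r}" and tb = "t + \<sigma> + 1" and cb = "\<nu>"])
    show "usc_on ({0..r} \<times> {t..t + \<sigma> + 1}) U" using U(1) \<nu> t by (auto intro: usc_on_subset)
    show "b + - \<nu> * p \<le> \<kappa>" if a: "x \<in> {0..<r}" "x \<in> {0..r}" "t < y" "y < t + \<sigma> + 1"
      "upper_jet ({0..r} \<times> {t..t + \<sigma> + 1}) U x y p b" for x y p b
    proof -
      have j: "upper_jet (strip L) U x y p b"
        by (rule upper_jet_box_strip[OF a(5,3,4), of "r - x"]) (use a in auto)
      show ?thesis
      proof (cases "x = 0")
        case True
        then show ?thesis using vertex[OF a(3)] j by simp
      next
        case False
        then have "b + h x p \<le> 0" using strip_subD[OF U(2) _ _ _ j] a \<nu> t by auto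
        then show ?thesis using \<nu>(4)[OF a(2), of p] by linarith
      qed
    qed
    show "\<nu> * (y - t) \<le> \<bar>x - \<nu> * \<sigma> - - \<nu> * (y - t)\<bar>"
      if a: "x \<in> {0..r}" "x \<notin> {0..<r}" "y \<in> {t..t + \<sigma> + 1}" for x y
      using a \<nu> by auto
  qed (use t \<nu> ns r0 in auto)
  then show ?thesis by simp
qed

section \<open>Critical slopes at the base of a strip\<close>

lemma strip_hamiltonian_continuous:
  assumes "strip_hamiltonian L h" "s0 \<in> {0..L}" "e > 0"
  obtains d where "d > 0" "\<And>s p. s \<in> {0..L} \<Longrightarrow> \<bar>s - s0\<bar> < d \<Longrightarrow> \<bar>p - p0\<bar> < d \<Longrightarrow> \<bar>h s p - h s0 p0\<bar> < e"
proof -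
  have "continuous_on ({0..L} \<times> UNIV) (\<lambda>(s, p). h s p)"
    using assms(1) unfolding strip_hamiltonian_def by auto
  then obtain d where d: "d > 0" "\<And>z. z \<in> {0..L} \<times> UNIV \<Longrightarrow> dist z (s0, p0) < d \<Longrightarrow>
      dist ((\<lambda>(s, p). h s p) z) ((\<lambda>(s, p). h s p) (s0, p0)) < e"
    using assms(2,3) unfolding continuous_on_iff by (metis UNIV_I mem_Sigma_iff)
  show ?thesis
  proof (rule that[of "d/2"])
    fix s p assume *: "s \<in> {0..L}" "\<bar>s - s0\<bar> < d/2" "\<bar>p - p0\<bar> < d/2"
    have "dist (s, p) (s0, p0) \<le> \<bar>s - s0\<bar> + \<bar>p - p0\<bar>"
      using norm_Pair_le[of "s - s0" "p - p0"] by (simp add: dist_norm)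
    then show "\<bar>h s p - h s0 p0\<bar> < e" using d(2)[of "(s, p)"] * by (simp add: dist_real_def)
  qed (use d in simp)
qed

text \<open>If p + \<eta> were not a slope, V would dip below the plane of slope p + \<eta>
  arbitrarily close to (0, t0). After penalising this plane, its difference with V has a negative
  minimum over a small box. The jet of slope p excludes minima on the base, the penalty excludes the
  outer faces, and an interior minimum yields a jet close to (p, a), which the supersolution
  property forbids because a + h 0 p < 0.\<close>

lemma critical_slope:
  assumes h: "strip_hamiltonian L h" and t0: "0 < t0"
    and V: "usc_on (strip L) (\<lambda>z. - V z)" "strip_super L h V"
    and jet: "lower_jet (strip L) V 0 t0 p a" and neg: "a + h 0 p < 0"
  shows "\<exists>\<eta>>0. lower_jet (strip L) V 0 t0 (p + \<eta>) a"
proof -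
  have L: "0 < L" using h by (simp add: strip_hamiltonian_def)
  define e where "e = - (a + h 0 p) / 2"
  have e: "e > 0" "a + h 0 p = - 2 * e" using neg by (auto simp: e_def)
  obtain d0 where d0: "d0 > 0" "\<And>s p'. s \<in> {0..L} \<Longrightarrow> \<bar>s - 0\<bar> < d0 \<Longrightarrow> \<bar>p' - p\<bar> < d0 \<Longrightarrow> \<bar>h s p' - h 0 p\<bar> < e"
    using strip_hamiltonian_continuous[OF h _ e(1), of 0 p] L by auto
  \<comment> \<open>3 \<eta> < d0 keeps the slope found below in the range where h varies by less
    than e, and 5 \<eta> < e bounds the change of the time slope; together they stay below the
    margin 2 e.\<close>
  define \<eta> where "\<eta> = min (d0 / 4) (e / 6)"
  have \<eta>: "\<eta> > 0" "3 * \<eta> < d0" "5 * \<eta> < e" using d0 e by (auto simp: \<eta>_def)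
  have "lower_jet (strip L) V 0 t0 (p + \<eta>) a"
  proof (rule ccontr)
    assume "\<not> ?thesis"
    then obtain \<epsilon>' where \<epsilon>': "\<epsilon>' > 0" "\<And>d. d > 0 \<Longrightarrow> \<exists>s k. \<bar>s\<bar> < d \<and> \<bar>k\<bar> < d \<and> (0 + s, t0 + k) \<in> strip L \<and>
        V (0 + s, t0 + k) < V (0, t0) + (p + \<eta>) * s + a * k - \<epsilon>' * (\<bar>s\<bar> + \<bar>k\<bar>)"
      unfolding lower_jet_def by (meson not_le)
    define \<epsilon> where "\<epsilon> = min \<epsilon>' \<eta> / 4"
    have \<epsilon>: "\<epsilon> > 0" "4 * \<epsilon> \<le> \<epsilon>'" "4 * \<epsilon> \<le> \<eta>" using \<epsilon>' \<eta> by (auto simp: \<epsilon>_def)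
    obtain d1 where d1: "d1 > 0" "\<And>s k. \<bar>s\<bar> < d1 \<Longrightarrow> \<bar>k\<bar> < d1 \<Longrightarrow> (0 + s, t0 + k) \<in> strip L \<Longrightarrow>
        V (0, t0) + p * s + a * k - \<epsilon> * (\<bar>s\<bar> + \<bar>k\<bar>) \<le> V (0 + s, t0 + k)"
      using lower_jetD[OF jet \<epsilon>(1)] by blast
    define \<delta> where "\<delta> = Min {d1, d0, t0, L} / 2"
    have \<delta>: "\<delta> > 0" "\<delta> < d1" "\<delta> < d0" "\<delta> < t0" "\<delta> < L"
      using d1 d0 t0 L by (auto simp: \<delta>_def)
    define D where "D = {0..\<delta>} \<times> {t0 - \<delta>..t0 + \<delta>}"
    have DS: "D \<subseteq> strip L" using \<delta> by (auto simp: D_def)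
    have low: "V (0, t0) + p * s + a * (t - t0) - \<epsilon> * (s + \<bar>t - t0\<bar>) \<le> V (s, t)" if "(s, t) \<in> D" for s t
      using d1(2)[of s "t - t0"] that DS \<delta> by (auto simp: D_def)
    \<comment> \<open>At points of size at most w / 2 the quadratic penalty is at most \<epsilon>
      times their size, hence small against the violation.\<close>
    define w where "w = \<delta> * \<epsilon> / \<eta>"
    have w: "w > 0" "4 * w \<le> \<delta>" "\<eta> / \<delta> * w = \<epsilon>"
    proof -
      have "\<delta> * (4 * \<epsilon>) \<le> \<delta> * \<eta>" using \<delta> \<epsilon> by (intro mult_left_mono) auto
      then show "4 * w \<le> \<delta>" using \<eta>(1) by (simp add: w_def field_simps)
      show "w > 0" using \<delta>(1) \<epsilon>(1) \<eta>(1) by (simp add: w_def)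
      show "\<eta> / \<delta> * w = \<epsilon>" using \<delta>(1) \<eta>(1) by (simp add: w_def)
    qed
    then have "w / 4 > 0" by simp
    from \<epsilon>'(2)[OF this] obtain s1 k1 where viol: "\<bar>s1\<bar> < w / 4" "\<bar>k1\<bar> < w / 4" "(0 + s1, t0 + k1) \<in> strip L"
        "V (0 + s1, t0 + k1) < V (0, t0) + (p + \<eta>) * s1 + a * k1 - \<epsilon>' * (\<bar>s1\<bar> + \<bar>k1\<bar>)"
      by blast
    define \<rho> where "\<rho> = \<bar>s1\<bar> + \<bar>k1\<bar>"
    have \<rho>: "0 < \<rho>"
    proof (rule ccontr)
      assume "\<not> 0 < \<rho>"
      then have "s1 = 0" "k1 = 0" by (auto simp: \<rho>_def)
      then show False using viol(4) by simp
    qed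
    have \<rho>2: "\<rho> \<le> w / 2" using viol by (simp add: \<rho>_def)
    then have "\<rho> < \<delta>" using w \<delta>(1) by linarith
    have s1: "0 \<le> s1" using viol(3) by simp
    have viD: "(s1, t0 + k1) \<in> D" using \<open>\<rho> < \<delta>\<close> s1 unfolding D_def \<rho>_def by auto
    \<comment> \<open>r smooths |k|. With r = \<rho> / 4 the whole penalty at the violating point is
      at most 7/2 \<epsilon> \<rho>, below the violation \<epsilon>' \<rho> \<ge> 4 \<epsilon>
      \<rho>.\<close>
    define r where "r = \<rho> / 4"
    have r: "r > 0" using \<rho> by (simp add: r_def)
    \<comment> \<open>The time penalty carries 2 \<epsilon> against the error \<epsilon> of the jet,
      which rules out a negative minimum with s = 0. On the outer faces the quadratic term is at
      least 2 \<eta> \<delta>, no less than the largest gain (\<eta> + \<epsilon>) s of the steeper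
      plane.\<close>
    define \<Phi> where "\<Phi> = (\<lambda>(s, t). V (0, t0) + (p + \<eta>) * s + a * (t - t0)
        - 2 * \<epsilon> * sqrt ((t - t0)\<^sup>2 + r\<^sup>2) - 2 * \<eta> / \<delta> * (s\<^sup>2 + (t - t0)\<^sup>2))"
    have sq: "\<bar>k\<bar> \<le> sqrt (k\<^sup>2 + r\<^sup>2)" "sqrt (k\<^sup>2 + r\<^sup>2) \<le> \<bar>k\<bar> + r" for k
    proof -
      show "\<bar>k\<bar> \<le> sqrt (k\<^sup>2 + r\<^sup>2)" by (rule real_le_rsqrt) simp
      show "sqrt (k\<^sup>2 + r\<^sup>2) \<le> \<bar>k\<bar> + r" using sqrt_add_le_add_sqrt[of "k\<^sup>2" "r\<^sup>2"] r by simp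
    qed
    have uscF: "usc_on D (\<lambda>z. - V z + \<Phi> z)"
    proof (rule usc_on_add[OF usc_on_subset[OF V(1) DS] usc_on_continuous])
      show "continuous_on D \<Phi>"
        unfolding \<Phi>_def case_prod_unfold by (intro continuous_intros) (use \<delta> in auto)
    qed
    have cD: "compact D" unfolding D_def by (intro compact_Times) auto
    have "D \<noteq> {}" using viD by blast
    obtain z where z: "z \<in> D" "\<And>y. y \<in> D \<Longrightarrow> - V y + \<Phi> y \<le> - V z + \<Phi> z"
      by (rule usc_on_attains_max[OF cD \<open>D \<noteq> {}\<close> uscF]) (rule that)
    obtain s t where st: "z = (s, t)" by (cases z)
    define k where "k = t - t0"
    have sk: "0 \<le> s" "s \<le> \<delta>" "\<bar>k\<bar> \<le> \<delta>" using z(1) st by (auto simp: D_def k_def)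
    have vneg: "V (s1, t0 + k1) - \<Phi> (s1, t0 + k1) < 0"
    proof -
      have "2 * \<epsilon> * sqrt (k1\<^sup>2 + r\<^sup>2) \<le> 2 * \<epsilon> * (\<rho> + r)"
        using sq(2)[of k1] \<epsilon> s1 by (intro mult_left_mono) (auto simp: \<rho>_def)
      moreover have "2 * \<eta> / \<delta> * (s1\<^sup>2 + k1\<^sup>2) \<le> \<epsilon> * \<rho>"
      proof -
        have "s1\<^sup>2 + k1\<^sup>2 \<le> \<rho>\<^sup>2" using s1 by (simp add: \<rho>_def power2_eq_square algebra_simps)
        then have "2 * \<eta> / \<delta> * (s1\<^sup>2 + k1\<^sup>2) \<le> 2 * \<eta> / \<delta> * \<rho>\<^sup>2"
          using \<eta> \<delta> by (intro mult_left_mono) auto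
        also have "\<dots> = 2 * \<eta> / \<delta> * \<rho> * \<rho>" by (simp add: power2_eq_square)
        also have "\<dots> \<le> \<epsilon> * \<rho>"
        proof (rule mult_right_mono)
          show "2 * \<eta> / \<delta> * \<rho> \<le> \<epsilon>" proof -
            have "2 * \<eta> / \<delta> * \<rho> \<le> 2 * \<eta> / \<delta> * (w / 2)"
              using \<rho>2 \<eta> \<delta> by (intro mult_left_mono) auto
            also have "\<dots> = \<epsilon>" using w(3) by simp
            finally show ?thesis .
          qed
        qed (use \<rho> in simp)
        finally show ?thesis .
      qed
      moreover have "4 * \<epsilon> * \<rho> \<le> \<epsilon>' * \<rho>" using \<epsilon> \<rho> by (intro mult_right_mono) auto
      moreover have "2 * \<epsilon> * (\<rho> + r) + \<epsilon> * \<rho> = 7/2 * (\<epsilon> * \<rho>)" by (simp add: r_def algebra_simps)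
      moreover have "0 < \<epsilon> * \<rho>" using \<epsilon> \<rho> by simp
      moreover have "\<Phi> (s1, t0 + k1) = V (0, t0) + (p + \<eta>) * s1 + a * k1
          - 2 * \<epsilon> * sqrt (k1\<^sup>2 + r\<^sup>2) - 2 * \<eta> / \<delta> * (s1\<^sup>2 + k1\<^sup>2)" by (simp add: \<Phi>_def)
      moreover have "V (s1, t0 + k1) < V (0, t0) + (p + \<eta>) * s1 + a * k1 - \<epsilon>' * \<rho>"
        using viol(4) by (simp add: \<rho>_def)
      ultimately show ?thesis by linarith
    qed
    have zneg: "V (s, t) - \<Phi> (s, t) < 0" using z(2)[OF viD] vneg st by simp
    have lowz: "V (0, t0) + p * s + a * k - \<epsilon> * (s + \<bar>k\<bar>) \<le> V (s, t)"
      using low[of s t] z(1) st by (simp add: k_def)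
    have \<Phi>z: "\<Phi> (s, t) \<le> V (0, t0) + (p + \<eta>) * s + a * k - 2 * \<epsilon> * \<bar>k\<bar> - 2 * \<eta> / \<delta> * (s\<^sup>2 + k\<^sup>2)"
      using sq(1)[of k] \<epsilon> by (simp add: \<Phi>_def k_def)
    have key: "2 * \<eta> / \<delta> * (s\<^sup>2 + k\<^sup>2) < (\<eta> + \<epsilon>) * s - \<epsilon> * \<bar>k\<bar>"
    proof -
      have "(p + \<eta>) * s = p * s + \<eta> * s" "\<epsilon> * (s + \<bar>k\<bar>) = \<epsilon> * s + \<epsilon> * \<bar>k\<bar>" "(\<eta> + \<epsilon>) * s = \<eta> * s + \<epsilon> * s"
        by (simp_all add: algebra_simps)
      then show ?thesis using lowz \<Phi>z zneg by linarith
    qed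
    have "s > 0"
    proof (rule ccontr)
      assume "\<not> s > 0"
      then have "s = 0" using sk by simp
      moreover have "0 \<le> 2 * \<eta> / \<delta> * k\<^sup>2" "0 \<le> \<epsilon> * \<bar>k\<bar>" using \<eta> \<delta> \<epsilon> by auto
      ultimately show False using key by simp
    qed
    have inside: "s < \<delta> \<and> \<bar>k\<bar> < \<delta>"
    proof (rule ccontr)
      assume "\<not> ?thesis"
      then have "s = \<delta> \<or> \<bar>k\<bar> = \<delta>" using sk by auto
      then have "\<delta>\<^sup>2 \<le> s\<^sup>2 + k\<^sup>2" by (metis le_add_same_cancel1 le_add_same_cancel2 power2_abs zero_le_power2)
      then have "2 * \<eta> / \<delta> * \<delta>\<^sup>2 \<le> 2 * \<eta> / \<delta> * (s\<^sup>2 + k\<^sup>2)"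
        using \<eta> \<delta> by (intro mult_left_mono) auto
      moreover have "2 * \<eta> / \<delta> * \<delta>\<^sup>2 = 2 * \<eta> * \<delta>" using \<delta> by (simp add: power2_eq_square)
      moreover have "(\<eta> + \<epsilon>) * s \<le> (2 * \<eta>) * \<delta>" using sk \<epsilon> \<eta> by (intro mult_mono) auto
      moreover have "0 \<le> \<epsilon> * \<bar>k\<bar>" using \<epsilon> by simp
      ultimately show False using key by linarith
    qed
    define P where "P = p + \<eta> - 4 * \<eta> / \<delta> * s"
    define A where "A = a - 2 * \<epsilon> * (k / sqrt (k\<^sup>2 + r\<^sup>2)) - 4 * \<eta> / \<delta> * k"
    have rpos: "k\<^sup>2 + r\<^sup>2 > 0" using r by (simp add: add_nonneg_pos)
    have "(\<Phi> has_derivative (\<lambda>(h, l). P * h + A * l)) (at (s, t) within strip L)"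
      unfolding \<Phi>_def P_def A_def case_prod_unfold
      using rpos \<delta>(1) by (auto intro!: derivative_eq_intros simp: fun_eq_iff k_def[symmetric] field_simps)
    then have "lower_jet (strip L) V s t P A"
    proof (rule local_min_lower_jet[where d = "Min {s, \<delta> - s, \<delta> - \<bar>k\<bar>}"])
      show "Min {s, \<delta> - s, \<delta> - \<bar>k\<bar>} > 0" using \<open>s > 0\<close> inside by simp
      fix h l assume "\<bar>h\<bar> < Min {s, \<delta> - s, \<delta> - \<bar>k\<bar>}" "\<bar>l\<bar> < Min {s, \<delta> - s, \<delta> - \<bar>k\<bar>}"
      then have "(s + h, t + l) \<in> D" by (auto simp: D_def k_def)
      from z(2)[OF this] show "V (s, t) - \<Phi> (s, t) \<le> V (s + h, t + l) - \<Phi> (s + h, t + l)"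
        by (simp add: st)
    qed
    moreover have "0 < t" using inside \<delta> by (auto simp: k_def)
    ultimately have ge: "0 \<le> A + h s P"
      using strip_superD[OF V(2)] \<open>s > 0\<close> inside \<delta> by auto
    have "0 \<le> 4 * \<eta> / \<delta> * s" "4 * \<eta> / \<delta> * s \<le> 4 * \<eta> / \<delta> * \<delta>"
      using \<eta> \<delta> inside \<open>s > 0\<close> by (auto intro!: mult_left_mono simp del: times_divide_eq_left)
    then have "\<bar>P - p\<bar> \<le> 3 * \<eta>" using \<delta> \<eta> by (simp add: P_def abs_le_iff)
    moreover have "\<bar>A - a\<bar> \<le> 5 * \<eta>"
    proof -
      have "\<bar>k / sqrt (k\<^sup>2 + r\<^sup>2)\<bar> \<le> 1" using sq(1)[of k] rpos by (simp add: abs_mult)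
      then have "\<bar>2 * \<epsilon> * (k / sqrt (k\<^sup>2 + r\<^sup>2))\<bar> \<le> 2 * \<epsilon> * 1"
        using \<epsilon> unfolding abs_mult by (intro mult_mono) auto
      moreover have "\<bar>4 * \<eta> / \<delta> * k\<bar> \<le> 4 * \<eta> / \<delta> * \<delta>"
        using \<eta> \<delta> sk unfolding abs_mult by (intro mult_mono) auto
      moreover have "4 * \<eta> / \<delta> * \<delta> = 4 * \<eta>" using \<delta>(1) by simp
      ultimately show ?thesis using \<epsilon> unfolding A_def by linarith
    qed
    moreover have "\<bar>h s P - h 0 p\<bar> < e"
      using d0(2)[of s P] \<open>\<bar>P - p\<bar> \<le> 3 * \<eta>\<close> \<eta> \<delta> sk inside by auto
    ultimately show False using ge e(2) \<eta> by linarith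
  qed
  then show ?thesis using \<eta> by blast
qed

lemma lower_jet_strip_mono:
  "lower_jet (strip L) V 0 t p a \<Longrightarrow> p' \<le> p \<Longrightarrow> lower_jet (strip L) V 0 t p' a"
  by (erule lower_jet_mono) auto

text \<open>
  The jets at the base form a closed convex set, and by \<open>critical_slope\<close> the slope can be
  increased wherever \<open>a + h 0 p < 0\<close>, which holds on the whole segment from \<open>(p, a)\<close> to
  \<open>(q, b)\<close>.
\<close>

lemma lower_jet_connect:
  assumes h: "strip_hamiltonian L h" and t0: "0 < t0"
    and V: "usc_on (strip L) (\<lambda>z. - V z)" "strip_super L h V"
    and jet: "lower_jet (strip L) V 0 t0 p a" "a + h 0 p < 0"
    and jet0: "lower_jet (strip L) V 0 t0 p0 b" and neg: "b + h 0 q < 0"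
  shows "lower_jet (strip L) V 0 t0 q b"
proof -
  have conv: "convex_on UNIV (h 0)" using h by (auto simp: strip_hamiltonian_def)
  define P where "P l = (1 - l) * p + l * q" for l
  define A where "A l = (1 - l) * a + l * b" for l
  define X where "X = {l \<in> {0..1}. lower_jet (strip L) V 0 t0 (P l) (A l)}"
  have X0: "0 \<in> X" using jet(1) by (simp add: X_def P_def A_def)
  have bdd: "bdd_above X" by (auto simp: X_def)
  define l where "l = Sup X"
  have l: "0 \<le> l" "l \<le> 1"
  proof -
    show "0 \<le> l" unfolding l_def by (rule cSup_upper[OF X0 bdd])
    have "x \<le> 1" if "x \<in> X" for x using that by (simp add: X_def)
    then show "l \<le> 1" unfolding l_def using X0 by (intro cSup_least) blast
  qed
  have jl: "lower_jet (strip L) V 0 t0 (P l) (A l)"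
  proof (rule lower_jet_closed)
    fix \<epsilon> :: real assume "\<epsilon> > 0"
    define c where "c = \<bar>q - p\<bar> + \<bar>b - a\<bar> + 1"
    have c: "c > 0" by (simp add: c_def add_nonneg_pos)
    have "l - \<epsilon> / c < l" using c \<open>\<epsilon> > 0\<close> by simp
    then obtain x where x: "x \<in> X" "l - \<epsilon> / c < x" unfolding l_def using less_cSupE X0 by blast
    have "x \<le> l" unfolding l_def by (rule cSup_upper[OF x(1) bdd])
    then have "\<bar>x - l\<bar> * c \<le> \<epsilon>" using x(2) c by (simp add: field_simps)
    moreover have "\<bar>x - l\<bar> * \<bar>q - p\<bar> \<le> \<bar>x - l\<bar> * c" "\<bar>x - l\<bar> * \<bar>b - a\<bar> \<le> \<bar>x - l\<bar> * c"
      by (intro mult_left_mono; simp add: c_def)+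
    moreover have "P x - P l = (x - l) * (q - p)" "A x - A l = (x - l) * (b - a)"
      by (simp_all add: P_def A_def algebra_simps)
    ultimately show "\<exists>p' a'. \<bar>p' - P l\<bar> \<le> \<epsilon> \<and> \<bar>a' - A l\<bar> \<le> \<epsilon> \<and> lower_jet (strip L) V 0 t0 p' a'"
      using x(1) by (intro exI[of _ "P x"] exI[of _ "A x"]) (auto simp: X_def abs_mult)
  qed
  have "h 0 ((1 - l) *\<^sub>R p + l *\<^sub>R q) \<le> (1 - l) * h 0 p + l * h 0 q"
    using conv l by (intro convex_onD) auto
  then have "A l + h 0 (P l) \<le> (1 - l) * (a + h 0 p) + l * (b + h 0 q)"
    by (simp add: P_def A_def algebra_simps)
  also have "\<dots> < 0"
  proof (cases "l = 1")
    case False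
    then have "(1 - l) * (a + h 0 p) < 0" using l jet(2) by (intro mult_pos_neg) auto
    moreover have "l * (b + h 0 q) \<le> 0" using l neg by (intro mult_nonneg_nonpos) auto
    ultimately show ?thesis by linarith
  qed (use neg in simp)
  finally obtain \<eta> where \<eta>: "\<eta> > 0" "lower_jet (strip L) V 0 t0 (P l + \<eta>) (A l)"
    using critical_slope[OF h t0 V jl] by blast
  have "l = 1"
  proof (rule ccontr)
    assume "l \<noteq> 1"
    then have l1: "l < 1" using l by simp
    \<comment> \<open>Mixing in the jet (p0, b) moves the time slope towards b. Its space slope may
      be too small, but for this \<theta> the gain \<eta> at l pays for the deficit, and
      monotonicity then lowers the slope to the point of the segment.\<close>
    define c where "c = \<bar>q - p0\<bar> + \<eta>"
    have c: "c > 0" using \<eta> by (simp add: c_def add_nonneg_pos)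
    define \<theta> where "\<theta> = \<eta> / (2 * c)"
    have "\<eta> < 2 * c" using \<eta>(1) by (simp add: c_def add_pos_nonneg)
    then have \<theta>: "0 < \<theta>" "\<theta> < 1" using \<eta>(1) c by (auto simp: \<theta>_def)
    have j: "lower_jet (strip L) V 0 t0 ((1 - \<theta>) * (P l + \<eta>) + \<theta> * p0) ((1 - \<theta>) * A l + \<theta> * b)"
      using lower_jet_convex[OF \<eta>(2) jet0, of \<theta>] \<theta> by simp
    define l' where "l' = l + \<theta> * (1 - l)"
    have l': "l < l'" "l' \<le> 1"
    proof -
      show "l < l'" using \<theta> l1 by (simp add: l'_def)
      have "\<theta> * (1 - l) \<le> 1 * (1 - l)" using \<theta> l1 by (intro mult_right_mono) auto
      then show "l' \<le> 1" by (simp add: l'_def)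
    qed
    have "A l' = (1 - \<theta>) * A l + \<theta> * b" by (simp add: A_def l'_def algebra_simps)
    moreover have "P l' \<le> (1 - \<theta>) * (P l + \<eta>) + \<theta> * p0"
    proof -
      have "P l' = (1 - \<theta>) * P l + \<theta> * q" by (simp add: P_def l'_def algebra_simps)
      moreover have "\<theta> * (q - p0) \<le> (1 - \<theta>) * \<eta>"
      proof -
        have "\<theta> * (q - p0) + \<theta> * \<eta> \<le> \<theta> * c"
          unfolding distrib_left[symmetric] using \<theta> by (intro mult_left_mono) (auto simp: c_def)
        also have "\<dots> = \<eta> / 2" using c by (simp add: \<theta>_def)
        finally show ?thesis using \<eta> by (simp add: algebra_simps)
      qed
      ultimately show ?thesis by (simp add: algebra_simps)
    qed
    ultimately have "lower_jet (strip L) V 0 t0 (P l') (A l')"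
      using lower_jet_strip_mono[OF j] by simp
    then have "l' \<in> X" using l' l by (auto simp: X_def)
    then show False using cSup_upper[OF _ bdd] l'(1) unfolding l_def by force
  qed
  then show ?thesis using jl by (simp add: P_def A_def)
qed

text \<open>
  One branch at a maximum point of the time-doubled difference \<open>W - V\<close>.  Transport for \<open>W\<close> bounds
  the slopes of the lower jets of \<open>V\<close> from below; if \<open>m\<close> were not among them, the critical slope
  \<open>p < m\<close> would satisfy \<open>a + h 0 p \<ge> 0\<close>, and transport along a tilted supporting line
  of \<open>h 0\<close> at \<open>p\<close> would produce a larger slope.
\<close>

lemma branch_slope:
  assumes h: "strip_hamiltonian L h" and t: "0 < t" and "a < b" "b + h 0 m \<le> 0"
    and V: "usc_on (strip L) (\<lambda>z. - V z)" "strip_super L h V"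
    and W: "\<And>\<nu> \<kappa>. 0 < \<nu> \<Longrightarrow> tilt (h 0) \<nu> \<kappa> \<Longrightarrow>
      \<exists>d>0. \<forall>\<sigma>. 0 < \<sigma> \<longrightarrow> \<sigma> < d \<longrightarrow> W (0, t') \<le> W (\<nu> * \<sigma>, t' - \<sigma>) + \<kappa> * \<sigma>"
    and joint: "\<And>\<epsilon>. \<epsilon> > 0 \<Longrightarrow> \<exists>d>0. \<forall>s k k'. 0 \<le> s \<longrightarrow> s < d \<longrightarrow> \<bar>k\<bar> < d \<longrightarrow> \<bar>k'\<bar> < d \<longrightarrow>
      W (s, t' + k') - V (s, t + k) \<le> W (0, t') - V (0, t) + b * k' - a * k + \<epsilon> * (\<bar>k\<bar> + \<bar>k'\<bar>)"
  shows "lower_jet (strip L) V 0 t m a"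
proof (rule ccontr)
  assume no: "\<not> lower_jet (strip L) V 0 t m a"
  \<comment> \<open>Going back along the line gives W (0, t') \<le> W (s, t' - \<sigma>) + \<kappa>
    \<sigma> with s = \<nu> \<sigma>. Inserting k' = -\<sigma> in \<open>joint\<close> eliminates W
    and leaves a lower bound for V with slope (b - \<kappa>) / \<nu>.\<close>
  have slope: "lower_jet (strip L) V 0 t ((b - \<kappa>) / \<nu>) a" if \<nu>: "0 < \<nu>" "tilt (h 0) \<nu> \<kappa>" for \<nu> \<kappa>
  proof (rule lower_jetI)
    fix \<epsilon> :: real assume "\<epsilon> > 0"
    obtain d1 where d1: "d1 > 0" "\<And>\<sigma>. 0 < \<sigma> \<Longrightarrow> \<sigma> < d1 \<Longrightarrow> W (0, t') \<le> W (\<nu> * \<sigma>, t' - \<sigma>) + \<kappa> * \<sigma>"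
      using W[OF \<nu>] by blast
    \<comment> \<open>The error in \<sigma> = s / \<nu> is charged to |s|, hence the factor
      \<nu>.\<close>
    define \<epsilon>' where "\<epsilon>' = min \<epsilon> (\<epsilon> * \<nu>)"
    have \<epsilon>': "\<epsilon>' > 0" "\<epsilon>' \<le> \<epsilon>" "\<epsilon>' / \<nu> \<le> \<epsilon>" using \<open>\<epsilon> > 0\<close> \<nu>
      by (auto simp: \<epsilon>'_def min_less_iff_conj divide_le_eq)
    obtain d2 where d2: "d2 > 0" "\<And>s k k'. 0 \<le> s \<Longrightarrow> s < d2 \<Longrightarrow> \<bar>k\<bar> < d2 \<Longrightarrow> \<bar>k'\<bar> < d2 \<Longrightarrow>
      W (s, t' + k') - V (s, t + k) \<le> W (0, t') - V (0, t) + b * k' - a * k + \<epsilon>' * (\<bar>k\<bar> + \<bar>k'\<bar>)"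
      using joint[OF \<epsilon>'(1)] by blast
    show "\<exists>d>0. \<forall>s k. \<bar>s\<bar> < d \<longrightarrow> \<bar>k\<bar> < d \<longrightarrow> (0 + s, t + k) \<in> strip L \<longrightarrow>
        V (0, t) + (b - \<kappa>) / \<nu> * s + a * k - \<epsilon> * (\<bar>s\<bar> + \<bar>k\<bar>) \<le> V (0 + s, t + k)"
    proof (intro exI[of _ "Min {d2, d1 * \<nu>, d2 * \<nu>}"] conjI allI impI)
      show "Min {d2, d1 * \<nu>, d2 * \<nu>} > 0" using d1 d2 \<nu> by auto
      fix s k assume *: "\<bar>s\<bar> < Min {d2, d1 * \<nu>, d2 * \<nu>}" "\<bar>k\<bar> < Min {d2, d1 * \<nu>, d2 * \<nu>}" "(0 + s, t + k) \<in> strip L"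
      define \<sigma> where "\<sigma> = s / \<nu>"
      have s: "0 \<le> s" "0 \<le> \<sigma>" "\<sigma> < d1" "\<sigma> < d2" "\<nu> * \<sigma> = s"
        using * \<nu> by (auto simp: \<sigma>_def divide_less_eq)
      have "W (0, t') \<le> W (s, t' - \<sigma>) + \<kappa> * \<sigma>"
      proof (cases "s = 0")
        case False
        then have "0 < \<sigma>" using s \<nu> by (auto simp: \<sigma>_def)
        then show ?thesis using d1(2)[of \<sigma>] s by simp
      qed (simp add: \<sigma>_def)
      moreover have "W (s, t' - \<sigma>) - V (s, t + k) \<le> W (0, t') - V (0, t) + b * (- \<sigma>) - a * k + \<epsilon>' * (\<bar>k\<bar> + \<bar>- \<sigma>\<bar>)"
        using d2(2)[of s k "- \<sigma>"] * s by simp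
      moreover have "\<epsilon>' * (\<bar>k\<bar> + \<bar>- \<sigma>\<bar>) \<le> \<epsilon> * (\<bar>s\<bar> + \<bar>k\<bar>)"
      proof -
        have "\<epsilon>' * \<bar>k\<bar> \<le> \<epsilon> * \<bar>k\<bar>" using \<epsilon>' by (intro mult_right_mono) auto
        moreover have "\<epsilon>' * \<sigma> = \<epsilon>' / \<nu> * s" by (simp add: \<sigma>_def)
        moreover have "\<epsilon>' / \<nu> * s \<le> \<epsilon> * s" using \<epsilon>' s by (intro mult_right_mono) auto
        ultimately show ?thesis using s by (simp add: algebra_simps)
      qed
      moreover have "(b - \<kappa>) / \<nu> * s = b * \<sigma> - \<kappa> * \<sigma>" by (simp add: \<sigma>_def diff_divide_distrib left_diff_distrib)
      ultimately show "V (0, t) + (b - \<kappa>) / \<nu> * s + a * k - \<epsilon> * (\<bar>s\<bar> + \<bar>k\<bar>) \<le> V (0 + s, t + k)"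
        by simp
    qed
  qed
  have L: "0 \<in> {0..L}" and conv: "convex_on UNIV (h 0)" using h by (auto simp: strip_hamiltonian_def)
  obtain \<delta> C where growth: "\<delta> > 0" "\<And>p. \<delta> * \<bar>p\<bar> - C \<le> h 0 p"
    using h L unfolding strip_hamiltonian_def by blast
  obtain \<nu>0 \<kappa>0 where n0: "\<nu>0 > 0" "\<And>s. s \<in> {0..L} \<Longrightarrow> tilt (h s) \<nu>0 \<kappa>0"
    by (rule tilt_small_slope[OF h]) (rule that)
  note j0 = slope[OF n0(1) n0(2)[OF L]]
  \<comment> \<open>X is nonempty by the slope obtained from an arbitrary admissible line, and
    bounded by m because slopes may be lowered.\<close>
  define X where "X = {p. lower_jet (strip L) V 0 t p a}"
  have Xne: "(b - \<kappa>0) / \<nu>0 \<in> X" using j0 by (simp add: X_def)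
  have Xm: "p < m" if "p \<in> X" for p
    using lower_jet_strip_mono[of L V t p a m] that no by (fastforce simp: X_def)
  then have bdd: "bdd_above X" by (auto intro!: bdd_aboveI[of _ m] less_imp_le)
  define p where "p = Sup X"
  have "p \<in> X" unfolding X_def
  proof (rule CollectI, rule lower_jet_closed)
    fix \<epsilon> :: real assume "\<epsilon> > 0"
    then have "p - \<epsilon> < p" by simp
    then obtain x where "x \<in> X" "p - \<epsilon> < x" unfolding p_def using less_cSupE Xne by blast
    moreover have "x \<le> p" unfolding p_def by (rule cSup_upper[OF \<open>x \<in> X\<close> bdd])
    ultimately show "\<exists>p' a'. \<bar>p' - p\<bar> \<le> \<epsilon> \<and> \<bar>a' - a\<bar> \<le> \<epsilon> \<and> lower_jet (strip L) V 0 t p' a'"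
      using \<open>\<epsilon> > 0\<close> by (intro exI[of _ x] exI[of _ a]) (auto simp: X_def)
  qed
  have "0 \<le> a + h 0 p"
  proof (rule ccontr)
    assume "\<not> 0 \<le> a + h 0 p"
    then obtain \<eta> where "\<eta> > 0" "p + \<eta> \<in> X"
      using critical_slope[OF h t V, of p a] \<open>p \<in> X\<close> by (auto simp: X_def)
    then show False using cSup_upper[OF \<open>p + \<eta> \<in> X\<close> bdd] by (simp add: p_def)
  qed
  then have "- b < h 0 p" "h 0 m < h 0 p" using assms(3,4) by auto
  then obtain \<nu> \<kappa> where \<nu>: "\<nu> > 0" "tilt (h 0) \<nu> \<kappa>" "\<kappa> + \<nu> * p < b"
    using tilt_support[OF conv growth Xm[OF \<open>p \<in> X\<close>], of b] by blast
  have "(b - \<kappa>) / \<nu> \<in> X" using slope[OF \<nu>(1,2)] by (simp add: X_def)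
  then have "(b - \<kappa>) / \<nu> \<le> p" unfolding p_def by (rule cSup_upper[OF _ bdd])
  then show False using \<nu> by (simp add: divide_le_eq algebra_simps)
qed

section \<open>Test functions and jets\<close>

lemma C1_test_function:
  assumes "lower_jet S f s t p a"
  obtains \<phi> where "\<And>T. C1_on T \<phi>" "\<And>T. T \<subseteq> S \<Longrightarrow> subtangent T f \<phi> (s, t)"
    "((\<lambda>r. \<phi> (r, t)) has_real_derivative p) (at s)" "((\<lambda>r. \<phi> (s, r)) has_real_derivative a) (at t)"
proof -
  have err: "\<exists>d>0. \<forall>(i::unit) h k. (s + h, t + k) \<in> S \<longrightarrow> \<bar>h\<bar> < d \<longrightarrow> \<bar>k\<bar> < d \<longrightarrow>
      f (s, t) + p * h + a * k - f (s + h, t + k) \<le> \<epsilon> * (\<bar>h\<bar> + \<bar>k\<bar>)" if \<epsilon>: "\<epsilon> > 0" for \<epsilon>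
  proof -
    obtain d where d: "d > 0" "\<And>h k. \<bar>h\<bar> < d \<Longrightarrow> \<bar>k\<bar> < d \<Longrightarrow> (s + h, t + k) \<in> S \<Longrightarrow>
        f (s, t) + p * h + a * k - \<epsilon> * (\<bar>h\<bar> + \<bar>k\<bar>) \<le> f (s + h, t + k)"
      by (rule lower_jetD[OF assms \<epsilon>]) (rule that)
    show ?thesis
    proof (intro exI[of _ d] conjI allI impI)
      fix h k assume "(s + h, t + k) \<in> S" "\<bar>h\<bar> < d" "\<bar>k\<bar> < d"
      then show "f (s, t) + p * h + a * k - f (s + h, t + k) \<le> \<epsilon> * (\<bar>h\<bar> + \<bar>k\<bar>)"
        using d(2)[of h k] by linarith
    qed (rule d(1))
  qed
  obtain \<sigma> \<sigma>' d where \<sigma>: "continuous_on UNIV \<sigma>'" "\<And>r. (\<sigma> has_real_derivative \<sigma>' r) (at r)"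
      "\<sigma> 0 = 0" "\<sigma>' 0 = 0" "\<And>r. 0 \<le> \<sigma> r" "d > 0"
    and bd: "\<And>(i::unit) h k. (s + h, t + k) \<in> S \<Longrightarrow> \<bar>h\<bar> < d \<Longrightarrow> \<bar>k\<bar> < d \<Longrightarrow>
      f (s, t) + p * h + a * k - f (s + h, t + k) \<le> \<sigma> h + \<sigma> k"
    by (rule C1_modulus[where B = "\<lambda>(_::unit) h k. (s + h, t + k) \<in> S" and
          e = "\<lambda>_ h k. f (s, t) + p * h + a * k - f (s + h, t + k)", OF err]) (assumption, rule that)
  have D\<sigma>: "((\<lambda>x. c * (x - y) - \<sigma> (x - y)) has_real_derivative c - \<sigma>' (x - y)) (at x)" for c x y
    by (auto intro!: derivative_eq_intros DERIV_chain2[OF \<sigma>(2)])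
  define \<phi> where "\<phi> = (\<lambda>(x, y). (p * (x - s) - \<sigma> (x - s)) + (a * (y - t) - \<sigma> (y - t)))"
  show ?thesis
  proof (rule that[of \<phi>])
    have c: "continuous_on UNIV (\<lambda>x. c - \<sigma>' (x - y))" for c y
      by (intro continuous_intros continuous_on_compose2[OF \<sigma>(1)]) auto
    show "C1_on T \<phi>" for T
      by (rule C1_on_separated[OF c c D\<sigma> D\<sigma>]) (simp add: \<phi>_def)
    show "((\<lambda>r. \<phi> (r, t)) has_real_derivative p) (at s)"
      using D\<sigma>[of p s s] \<sigma>(3,4) by (simp add: \<phi>_def)
    show "((\<lambda>r. \<phi> (s, r)) has_real_derivative a) (at t)"
      using D\<sigma>[of a t t] \<sigma>(3,4) by (simp add: \<phi>_def)
    show "subtangent T f \<phi> (s, t)" if "T \<subseteq> S" for T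
    proof (rule subtangent_boxI[OF \<sigma>(6)])
      fix h k assume "\<bar>h\<bar> < d" "\<bar>k\<bar> < d" "(s + h, t + k) \<in> T"
      then show "f (s, t) - \<phi> (s, t) \<le> f (s + h, t + k) - \<phi> (s + h, t + k)"
        using bd[of h k] that \<sigma>(3) by (auto simp: \<phi>_def)
    qed
  qed
qed

lemma vector_derivative_within_open:
  fixes g :: "real \<Rightarrow> real"
  assumes "(g has_vector_derivative D) (at s within I)" "open I" "s \<in> I"
  shows "vector_derivative g (at s within I) = D"
  using vector_derivative_at[of g D s] assms(1) unfolding at_within_open[OF assms(3,2)] by blast

lemma C1_on_open_partials:
  assumes "C1_on ({0<..<L} \<times> {0<..}) \<phi>" "0 < s" "s < L" "0 < t"
  shows "(\<phi> has_derivative (\<lambda>(h, k). partial_s {0<..<L} \<phi> s t * h + partial_t \<phi> s t * k))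
    (at (s, t) within {0<..<L} \<times> {0<..})"
  by (rule C1_on_partials[OF assms(1)])
    (use assms in \<open>auto intro: vector_derivative_within_open simp: interior_open\<close>)

lemma lower_jet_strip_open:
  assumes "lower_jet ({0<..<L} \<times> {0<..}) f s t p a" "0 < s" "s < L" "0 < t"
  shows "lower_jet (strip L) f s t p a"
  by (rule lower_jet_local[OF assms(1), of "Min {s, L - s, t}"]) (use assms in auto)

lemma partials_eq:
  assumes "((\<lambda>r. \<phi> (r, t)) has_real_derivative p) (at s)" "((\<lambda>r. \<phi> (s, r)) has_real_derivative a) (at t)"
    and "0 < s" "s < L"
  shows "partial_s {0<..<L} \<phi> s t = p" "partial_t \<phi> s t = a"
proof -
  show "partial_s {0<..<L} \<phi> s t = p" unfolding partial_s_def
    using assms by (intro vector_derivative_within_open)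
      (auto simp: has_real_derivative_iff_has_vector_derivative intro: has_vector_derivative_at_within)
  show "partial_t \<phi> s t = a" unfolding partial_t_def
    using assms by (intro vector_derivative_at) (simp add: has_real_derivative_iff_has_vector_derivative)
qed

text \<open>The definition tests on the open rectangle and the jets live on the closed strip; at an
  interior point both see the same neighbourhood.\<close>

lemma HJ_supersolution_iff: "HJ_supersolution L h U \<longleftrightarrow> strip_super L h U"
proof
  assume H: "HJ_supersolution L h U"
  show "strip_super L h U" unfolding strip_super_def
  proof (intro ballI allI impI)
    fix s t p a assume st: "s \<in> {0<..<L}" "0 < t" and j: "lower_jet (strip L) U s t p a"
    obtain \<phi> where \<phi>: "\<And>T. C1_on T \<phi>" "\<And>T. T \<subseteq> strip L \<Longrightarrow> subtangent T U \<phi> (s, t)"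
      "((\<lambda>r. \<phi> (r, t)) has_real_derivative p) (at s)" "((\<lambda>r. \<phi> (s, r)) has_real_derivative a) (at t)"
      by (rule C1_test_function[OF j]) (rule that)
    have "{0<..<L} \<times> {0<..} \<subseteq> strip L" by auto
    then have "partial_t \<phi> s t + h s (partial_s {0<..<L} \<phi> s t) \<ge> 0"
      using H st \<phi>(1,2) unfolding HJ_supersolution_def by blast
    then show "0 \<le> a + h s p" using partials_eq[OF \<phi>(3,4), of L] st by simp
  qed
next
  assume H: "strip_super L h U"
  show "HJ_supersolution L h U" unfolding HJ_supersolution_def
  proof (intro ballI allI impI, elim conjE)
    fix s t \<phi> assume st: "s \<in> {0<..<L}" "0 < (t::real)"
      and \<phi>: "C1_on ({0<..<L} \<times> {0<..}) \<phi>" "subtangent ({0<..<L} \<times> {0<..}) U \<phi> (s, t)"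
    have "lower_jet (strip L) U s t (partial_s {0<..<L} \<phi> s t) (partial_t \<phi> s t)"
      by (rule lower_jet_strip_open[OF lower_jet_of_subtangent[OF C1_on_open_partials[OF \<phi>(1)] \<phi>(2)]])
        (use st in auto)
    then show "partial_t \<phi> s t + h s (partial_s {0<..<L} \<phi> s t) \<ge> 0"
      using strip_superD[OF H] st by auto
  qed
qed

lemma HJ_subsolution_iff: "HJ_subsolution L h U \<longleftrightarrow> strip_sub L h U"
proof
  assume H: "HJ_subsolution L h U"
  show "strip_sub L h U" unfolding strip_sub_def
  proof (intro ballI allI impI)
    fix s t p a assume st: "s \<in> {0<..<L}" "0 < t" and j: "upper_jet (strip L) U s t p a"
    obtain \<phi> where \<phi>: "\<And>T. C1_on T \<phi>" "\<And>T. T \<subseteq> strip L \<Longrightarrow> subtangent T (\<lambda>z. - U z) \<phi> (s, t)"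
      "((\<lambda>r. \<phi> (r, t)) has_real_derivative - p) (at s)" "((\<lambda>r. \<phi> (s, r)) has_real_derivative - a) (at t)"
      by (rule C1_test_function[OF j]) (rule that)
    define \<psi> where "\<psi> z = - \<phi> z" for z
    have sub: "{0<..<L} \<times> {0<..} \<subseteq> strip L" by auto
    have "supertangent ({0<..<L} \<times> {0<..}) U \<psi> (s, t)"
      unfolding supertangent_uminus using \<phi>(2)[OF sub] by (simp add: \<psi>_def)
    moreover have "C1_on ({0<..<L} \<times> {0<..}) \<psi>" unfolding \<psi>_def by (rule C1_on_uminus[OF \<phi>(1)])
    ultimately have "partial_t \<psi> s t + h s (partial_s {0<..<L} \<psi> s t) \<le> 0"
      using H st unfolding HJ_subsolution_def by blast
    moreover have "((\<lambda>r. \<psi> (r, t)) has_real_derivative p) (at s)" "((\<lambda>r. \<psi> (s, r)) has_real_derivative a) (at t)"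
      unfolding \<psi>_def using DERIV_minus[OF \<phi>(3)] DERIV_minus[OF \<phi>(4)] by simp_all
    ultimately show "a + h s p \<le> 0" using partials_eq[of \<psi> t p s a L] st by simp
  qed
next
  assume H: "strip_sub L h U"
  show "HJ_subsolution L h U" unfolding HJ_subsolution_def
  proof (intro ballI allI impI, elim conjE)
    fix s t \<phi> assume st: "s \<in> {0<..<L}" "0 < (t::real)"
      and \<phi>: "C1_on ({0<..<L} \<times> {0<..}) \<phi>" "supertangent ({0<..<L} \<times> {0<..}) U \<phi> (s, t)"
    have "((\<lambda>z. - \<phi> z) has_derivative (\<lambda>(h, k). - partial_s {0<..<L} \<phi> s t * h + - partial_t \<phi> s t * k))
        (at (s, t) within {0<..<L} \<times> {0<..})"
      using has_derivative_minus[OF C1_on_open_partials[OF \<phi>(1)]] st by (simp add: case_prod_unfold)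
    from lower_jet_of_subtangent[OF this \<phi>(2)[unfolded supertangent_uminus]]
    have "upper_jet (strip L) U s t (partial_s {0<..<L} \<phi> s t) (partial_t \<phi> s t)"
      by (rule lower_jet_strip_open) (use st in auto)
    then show "partial_t \<phi> s t + h s (partial_s {0<..<L} \<phi> s t) \<le> 0"
      using strip_subD[OF H] st by auto
  qed
qed

section \<open>Semicontinuous envelopes\<close>

lemma locally_bounded_box:
  assumes "locally_bounded S u" "z \<in> S"
  obtains d B where "d > 0" "\<And>x. x \<in> S \<Longrightarrow> dist x z < d \<Longrightarrow> \<bar>u x\<bar> \<le> B"
proof -
  obtain e where "e > 0" "bounded (u ` (S \<inter> ball z e))"
    using assms unfolding locally_bounded_def by blast
  then obtain B where "\<forall>y \<in> u ` (S \<inter> ball z e). norm y \<le> B" unfolding bounded_iff by blast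
  then show ?thesis using \<open>e > 0\<close> by (intro that[of e B]) (auto simp: dist_commute)
qed

lemma eventually_within_box:
  fixes z :: "'b::metric_space"
  shows "eventually P (inf (nhds z) (principal S)) \<longleftrightarrow> (\<exists>d>0. \<forall>x\<in>S. dist x z < d \<longrightarrow> P x)"
  unfolding eventually_inf_principal eventually_nhds_metric by blast

text \<open>\<open>real_of_ereal\<close> sends infinite values to 0. Local boundedness, and z itself
  being a point of S, exclude this, so the real envelope obeys the usual limsup rules.\<close>

lemma ereal_usc_envelope:
  assumes "locally_bounded S u" "z \<in> S"
  shows "ereal (usc_envelope S u z) = Limsup (inf (nhds z) (principal S)) (\<lambda>y. ereal (u y))"
proof -
  let ?F = "inf (nhds z) (principal S)"
  obtain d B where d: "d > 0" "\<And>x. x \<in> S \<Longrightarrow> dist x z < d \<Longrightarrow> \<bar>u x\<bar> \<le> B"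
    by (rule locally_bounded_box[OF assms]) (rule that)
  have "?F \<noteq> bot"
  proof
    assume "?F = bot"
    then have "eventually (\<lambda>_. False) ?F" by simp
    then show False unfolding eventually_within_box using assms(2) by force
  qed
  moreover have "eventually (\<lambda>x. ereal (- B) \<le> ereal (u x)) ?F" "eventually (\<lambda>x. ereal (u x) \<le> ereal B) ?F"
    unfolding eventually_within_box using d by (force simp: abs_le_iff)+
  ultimately have "ereal (- B) \<le> Limsup ?F (\<lambda>y. ereal (u y))" "Limsup ?F (\<lambda>y. ereal (u y)) \<le> ereal B"
    by (auto intro: le_Limsup Limsup_bounded)
  then have "\<bar>Limsup ?F (\<lambda>y. ereal (u y))\<bar> \<noteq> \<infinity>" by auto
  then show ?thesis unfolding usc_envelope_def by (rule ereal_real')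
qed

lemma usc_envelope_lessD:
  fixes S :: "'b::metric_space set"
  assumes "locally_bounded S u" "z \<in> S" "usc_envelope S u z < y"
  obtains d where "d > 0" "\<And>x. x \<in> S \<Longrightarrow> dist x z < d \<Longrightarrow> u x < y"
proof -
  have "Limsup (inf (nhds z) (principal S)) (\<lambda>y. ereal (u y)) < ereal y"
    using ereal_usc_envelope[OF assms(1,2)] assms(3) by (metis ereal_less_le less_ereal.simps(1))
  from Limsup_lessD[OF this] show ?thesis
    unfolding eventually_within_box using that by auto
qed

lemma usc_envelope_le:
  fixes S :: "'b::metric_space set"
  assumes "locally_bounded S u" "z \<in> S" "d > 0" "\<And>x. x \<in> S \<Longrightarrow> dist x z < d \<Longrightarrow> u x \<le> y"
  shows "usc_envelope S u z \<le> y"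
proof -
  have "Limsup (inf (nhds z) (principal S)) (\<lambda>y. ereal (u y)) \<le> ereal y"
    by (rule Limsup_bounded) (use assms in \<open>auto simp: eventually_within_box\<close>)
  then show ?thesis using ereal_usc_envelope[OF assms(1,2)] by (metis ereal_less_eq(3))
qed

lemma usc_envelope_ge:
  fixes S :: "'b::metric_space set"
  assumes "locally_bounded S u" "z \<in> S"
  shows "u z \<le> usc_envelope S u z"
proof (rule ccontr)
  assume "\<not> ?thesis"
  then have "usc_envelope S u z < u z" by simp
  then obtain d where "d > 0" "\<And>x. x \<in> S \<Longrightarrow> dist x z < d \<Longrightarrow> u x < u z"
    using usc_envelope_lessD[OF assms] by blast
  from this(2)[OF assms(2)] this(1) show False by simp
qed

lemma usc_on_usc_envelope:
  fixes S :: "'b::metric_space set"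
  assumes "locally_bounded S u"
  shows "usc_on S (usc_envelope S u)"
  unfolding usc_on_def
proof (intro ballI allI impI)
  fix z y assume z: "z \<in> S" "usc_envelope S u z < y"
  then obtain y' where y': "usc_envelope S u z < y'" "y' < y" using dense by blast
  obtain d where d: "d > 0" "\<And>x. x \<in> S \<Longrightarrow> dist x z < d \<Longrightarrow> u x < y'"
    using usc_envelope_lessD[OF assms z(1) y'(1)] by blast
  have "usc_envelope S u x < y" if x: "x \<in> S" "dist x z < d/2" for x
  proof -
    have "usc_envelope S u x \<le> y'"
    proof (rule usc_envelope_le[OF assms x(1), of "d/2"])
      fix x' assume "x' \<in> S" "dist x' x < d/2"
      then have "dist x' z < d" using x(2) dist_triangle_half_r by (metis dist_commute dist_triangle_half_l)
      then show "u x' \<le> y'" using d(2)[OF \<open>x' \<in> S\<close>] by simp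
    qed (use d in simp)
    then show ?thesis using y' by simp
  qed
  then show "\<exists>d>0. \<forall>x\<in>S. dist x z < d \<longrightarrow> usc_envelope S u x < y"
    using d(1) by (intro exI[of _ "d/2"]) auto
qed

lemma usc_envelope_continuous:
  fixes S :: "'b::metric_space set"
  assumes "locally_bounded S u" "continuous_on S u" "z \<in> S"
  shows "usc_envelope S u z = u z"
proof (rule antisym[OF _ usc_envelope_ge[OF assms(1,3)]])
  show "usc_envelope S u z \<le> u z"
  proof (rule field_le_epsilon)
    fix e :: real assume "e > 0"
    then have "u z < u z + e" by simp
    then obtain d where d: "d > 0" "\<And>x. x \<in> S \<Longrightarrow> dist x z < d \<Longrightarrow> u x < u z + e"
      using usc_onD[OF usc_on_continuous[OF assms(2)] assms(3)] by blast
    show "usc_envelope S u z \<le> u z + e"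
      by (rule usc_envelope_le[OF assms(1,3) d(1)]) (use d in fastforce)
  qed
qed

lemma lsc_envelope_uminus: "lsc_envelope S u z = - usc_envelope S (\<lambda>z. - u z) z"
  unfolding lsc_envelope_def usc_envelope_def using ereal_Limsup_uminus[of _ "\<lambda>y. ereal (u y)"]
  by simp

lemma locally_bounded_uminus: "locally_bounded S u \<Longrightarrow> locally_bounded S (\<lambda>z. - u z)"
  unfolding locally_bounded_def bounded_iff by (simp add: image_iff)

lemma lsc_envelope_le:
  fixes S :: "'b::metric_space set"
  assumes "locally_bounded S u" "z \<in> S"
  shows "lsc_envelope S u z \<le> u z"
  using usc_envelope_ge[OF locally_bounded_uminus[OF assms(1)] assms(2)] by (simp add: lsc_envelope_uminus)

lemma usc_on_lsc_envelope:
  fixes S :: "'b::metric_space set"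
  assumes "locally_bounded S u"
  shows "usc_on S (\<lambda>z. - lsc_envelope S u z)"
  using usc_on_usc_envelope[OF locally_bounded_uminus[OF assms]] by (simp add: lsc_envelope_uminus)

lemma lsc_envelope_continuous:
  fixes S :: "'b::metric_space set"
  assumes "locally_bounded S u" "continuous_on S u" "z \<in> S"
  shows "lsc_envelope S u z = u z"
  using usc_envelope_continuous[OF locally_bounded_uminus[OF assms(1)] continuous_on_minus[OF assms(2)] assms(3)]
  by (simp add: lsc_envelope_uminus)

lemma continuous_on_envelopes:
  fixes S :: "'b::metric_space set"
  assumes "locally_bounded S u" "\<And>z. z \<in> S \<Longrightarrow> usc_envelope S u z \<le> lsc_envelope S u z"
  shows "continuous_on S u"
  unfolding continuous_on_iff
proof (intro ballI allI impI)
  fix z and e :: real assume z: "z \<in> S" and "e > 0"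
  have 1: "usc_envelope S u z < u z + e" "usc_envelope S (\<lambda>z. - u z) z < - u z + e"
    using assms(2)[OF z] usc_envelope_ge[OF assms(1) z] lsc_envelope_le[OF assms(1) z] \<open>e > 0\<close>
    by (auto simp: lsc_envelope_uminus)
  obtain d1 where d1: "d1 > 0" "\<And>x. x \<in> S \<Longrightarrow> dist x z < d1 \<Longrightarrow> u x < u z + e"
    using usc_envelope_lessD[OF assms(1) z 1(1)] by blast
  obtain d2 where d2: "d2 > 0" "\<And>x. x \<in> S \<Longrightarrow> dist x z < d2 \<Longrightarrow> - u x < - u z + e"
    using usc_envelope_lessD[OF locally_bounded_uminus[OF assms(1)] z 1(2)] by blast
  show "\<exists>d>0. \<forall>x\<in>S. dist x z < d \<longrightarrow> dist (u x) (u z) < e"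
  proof (intro exI[of _ "min d1 d2"] conjI ballI impI)
    fix x assume "x \<in> S" "dist x z < min d1 d2"
    then show "dist (u x) (u z) < e" using d1(2)[of x] d2(2)[of x] by (auto simp: dist_real_def)
  qed (use d1 d2 in simp)
qed

section \<open>Geometry of an embedded network\<close>

text \<open>P i has to be inherited by smaller radii, so that the minimum over I works; inserting 1
  covers an empty I.\<close>

lemma finite_common_radius:
  fixes P :: "'i \<Rightarrow> real \<Rightarrow> bool"
  assumes "finite I" "\<And>i. i \<in> I \<Longrightarrow> \<exists>d>0. \<forall>d'. 0 < d' \<longrightarrow> d' \<le> d \<longrightarrow> P i d'"
  shows "\<exists>d>0. \<forall>i\<in>I. P i d"
proof -
  have "\<exists>D. \<forall>i\<in>I. D i > 0 \<and> (\<forall>d'. 0 < d' \<longrightarrow> d' \<le> D i \<longrightarrow> P i d')"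
    by (rule bchoice) (use assms(2) in blast)
  then obtain D where D: "\<And>i. i \<in> I \<Longrightarrow> D i > 0" "\<And>i d'. i \<in> I \<Longrightarrow> 0 < d' \<Longrightarrow> d' \<le> D i \<Longrightarrow> P i d'" by blast
  define d where "d = Min (insert 1 (D ` I))"
  have fin: "finite (insert 1 (D ` I))" using assms(1) by simp
  have "d \<in> insert 1 (D ` I)" unfolding d_def by (rule Min_in[OF fin]) simp
  then have "d > 0" using D(1) by auto
  moreover have "d \<le> D i" if "i \<in> I" for i unfolding d_def using that by (intro Min_le[OF fin]) simp
  ultimately show ?thesis using D(2) by blast
qed

lemma len_inv_arc [simp]: "len (inv_arc \<gamma>) = len \<gamma>"
  by (simp add: inv_arc_def)

lemma crv_inv_arc: "s \<in> {0..len \<gamma>} \<Longrightarrow> crv (inv_arc \<gamma>) s = crv \<gamma> (len \<gamma> - s)"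
  by (simp add: inv_arc_def)

text \<open>Equality of arcs includes the values outside the parameter interval; there
  extensionality of the curve matches the default value of \<open>restrict\<close>.\<close>

lemma inv_inv_arc:
  assumes "crv \<gamma> \<in> extensional {0..len \<gamma>}"
  shows "inv_arc (inv_arc \<gamma>) = \<gamma>"
proof (rule net_arc.expand, intro conjI)
  show "crv (inv_arc (inv_arc \<gamma>)) = crv \<gamma>"
    using assms by (auto simp: inv_arc_def fun_eq_iff restrict_def extensional_def)
qed simp

section \<open>Arcs and neighbourhoods of vertices\<close>

context
  fixes E :: "'a::euclidean_space net_arc set"
  assumes emb: "embedded_network E"
begin

lemma finite_arcs: "finite E"
  using emb by (simp add: embedded_network_def)

lemma inv_arc_in: "\<gamma> \<in> E \<Longrightarrow> inv_arc \<gamma> \<in> E"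
  using emb by (simp add: embedded_network_def)

lemma len_pos: "\<gamma> \<in> E \<Longrightarrow> 0 < len \<gamma>"
  using emb by (simp add: embedded_network_def regular_arc_def)

lemma inv_inv_arc_in: "\<gamma> \<in> E \<Longrightarrow> inv_arc (inv_arc \<gamma>) = \<gamma>"
  using emb by (intro inv_inv_arc) (simp add: embedded_network_def regular_arc_def)

lemma no_loop: "\<gamma> \<in> E \<Longrightarrow> crv \<gamma> 0 \<noteq> crv \<gamma> (len \<gamma>)"
  using emb by (simp add: embedded_network_def)

lemma continuous_crv: assumes "\<gamma> \<in> E" shows "continuous_on {0..len \<gamma>} (crv \<gamma>)"
proof -
  have "regular_arc \<gamma>" using emb assms by (simp add: embedded_network_def)
  then have "\<And>s. s \<in> {0..len \<gamma>} \<Longrightarrow> \<exists>D. (crv \<gamma> has_vector_derivative D) (at s within {0..len \<gamma>})"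
    unfolding regular_arc_def by blast
  then show ?thesis
    unfolding continuous_on_eq_continuous_within using has_vector_derivative_continuous by blast
qed

text \<open>A simple arc may only close up at its two end points, and the absence of loops excludes
  this.\<close>

lemma inj_crv: assumes "\<gamma> \<in> E" shows "inj_on (crv \<gamma>) {0..len \<gamma>}"
proof (rule inj_onI)
  have S: "simple_arc \<gamma>" using emb assms by (simp add: embedded_network_def)
  have lt: "\<not> s < r" if "s \<in> {0..len \<gamma>}" "r \<in> {0..len \<gamma>}" "crv \<gamma> s = crv \<gamma> r" for s r
    using S no_loop[OF assms] that unfolding simple_arc_def by metis
  fix s r assume "s \<in> {0..len \<gamma>}" "r \<in> {0..len \<gamma>}" "crv \<gamma> s = crv \<gamma> r"
  then show "s = r" using lt[of s r] lt[of r s] by simp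
qed

lemma crv_in_network: "\<gamma> \<in> E \<Longrightarrow> s \<in> {0..len \<gamma>} \<Longrightarrow> crv \<gamma> s \<in> network E"
  unfolding network_def by blast

lemma vertices_subset: "vertices E \<subseteq> network E"
  using len_pos unfolding vertices_def network_def by fastforce

lemma compact_network: "compact (network E)"
  unfolding network_def
  by (intro compact_UN finite_arcs compact_continuous_image continuous_crv) auto

lemma interior_not_vertex:
  assumes "\<gamma> \<in> E" "s \<in> {0..len \<gamma>}" "crv \<gamma> s \<in> vertices E"
  shows "s = 0 \<or> s = len \<gamma>"
proof (rule ccontr)
  assume "\<not> ?thesis"
  then have "crv \<gamma> s \<in> arc_interior \<gamma>" using assms(2) by (auto simp: arc_interior_def)
  moreover have "arc_interior \<gamma> \<inter> vertices E = {}" using emb assms(1) by (simp add: embedded_network_def)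
  ultimately show False using assms(3) by blast
qed

lemma interior_disjoint:
  assumes "\<gamma> \<in> E" "\<gamma>' \<in> E" "\<gamma>' \<noteq> \<gamma>" "\<gamma>' \<noteq> inv_arc \<gamma>"
  shows "arc_interior \<gamma> \<inter> arc_interior \<gamma>' = {}"
proof -
  have "\<forall>\<gamma>\<in>E. \<forall>\<gamma>'\<in>E. \<gamma>' \<noteq> \<gamma> \<and> \<gamma>' \<noteq> inv_arc \<gamma> \<longrightarrow> arc_interior \<gamma> \<inter> arc_interior \<gamma>' = {}"
    using emb unfolding embedded_network_def by blast
  then show ?thesis using assms by blast
qed

lemma endpoint_vertex: "\<gamma> \<in> E \<Longrightarrow> crv \<gamma> 0 \<in> vertices E" "\<gamma> \<in> E \<Longrightarrow> crv \<gamma> (len \<gamma>) \<in> vertices E"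
  unfolding vertices_def by auto

lemma arcs_from_D: "\<gamma> \<in> arcs_from E x \<Longrightarrow> \<gamma> \<in> E" "\<gamma> \<in> arcs_from E x \<Longrightarrow> crv \<gamma> 0 = x"
  unfolding arcs_from_def by auto

lemma finite_arcs_from: "finite (arcs_from E x)"
  using finite_arcs unfolding arcs_from_def by simp

lemma inv_arc_from:
  assumes "\<gamma> \<in> E" "crv \<gamma> (len \<gamma>) = x"
  shows "inv_arc \<gamma> \<in> arcs_from E x"
  using assms inv_arc_in len_pos[OF assms(1)] by (simp add: arcs_from_def crv_inv_arc)

lemma inv_arc_not_from:
  assumes "\<gamma> \<in> arcs_from E x"
  shows "inv_arc \<gamma> \<notin> arcs_from E x"
proof
  assume "inv_arc \<gamma> \<in> arcs_from E x"
  then have "crv (inv_arc \<gamma>) 0 = x" by (rule arcs_from_D)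
  then show False
    using crv_inv_arc[of 0 \<gamma>] arcs_from_D[OF assms] no_loop[of \<gamma>] len_pos[of \<gamma>] by simp
qed

lemma arcs_from_nonempty:
  assumes "x \<in> vertices E" shows "arcs_from E x \<noteq> {}"
proof -
  obtain \<gamma> where "\<gamma> \<in> E" "x = crv \<gamma> 0 \<or> x = crv \<gamma> (len \<gamma>)" using assms unfolding vertices_def by blast
  then show ?thesis using inv_arc_from[of \<gamma> x] by (auto simp: arcs_from_def)
qed

text \<open>Parameters that stay \<delta> away from the ends located at x form a compact set whose
  image misses x, and finitely many arcs give a common positive distance. A point near a terminal
  end at x is described by the reversed arc.\<close>

lemma near_vertex:
  assumes x: "x \<in> vertices E" and "\<delta> > 0"
  obtains e where "e > 0" "\<And>y. y \<in> network E \<Longrightarrow> dist y x < e \<Longrightarrow>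
    \<exists>\<gamma>\<in>arcs_from E x. \<exists>s. 0 \<le> s \<and> s < \<delta> \<and> s \<le> len \<gamma> \<and> y = crv \<gamma> s"
proof -
  define C where "C \<gamma> = {s \<in> {0..len \<gamma>}. (crv \<gamma> 0 = x \<longrightarrow> \<delta> \<le> s) \<and> (crv \<gamma> (len \<gamma>) = x \<longrightarrow> s \<le> len \<gamma> - \<delta>)}" for \<gamma>
  have "\<exists>d>0. \<forall>\<gamma>\<in>E. \<forall>s\<in>C \<gamma>. d \<le> dist (crv \<gamma> s) x"
  proof (rule finite_common_radius[OF finite_arcs])
    fix \<gamma> assume \<gamma>: "\<gamma> \<in> E"
    have "C \<gamma> = (if crv \<gamma> 0 = x then {\<delta>..} else UNIV) \<inter> (if crv \<gamma> (len \<gamma>) = x then {..len \<gamma> - \<delta>} else UNIV) \<inter> {0..len \<gamma>}"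
      by (auto simp: C_def)
    then have "compact (C \<gamma>)" by (simp add: closed_Int_compact closed_Int)
    moreover have sub: "C \<gamma> \<subseteq> {0..len \<gamma>}" by (auto simp: C_def)
    ultimately have "compact (crv \<gamma> ` C \<gamma>)"
      by (intro compact_continuous_image continuous_on_subset[OF continuous_crv[OF \<gamma>]])
    then have cl: "closed (crv \<gamma> ` C \<gamma>)" by (rule compact_imp_closed)
    have "x \<notin> crv \<gamma> ` C \<gamma>"
    proof
      assume "x \<in> crv \<gamma> ` C \<gamma>"
      then obtain s where s: "s \<in> C \<gamma>" "x = crv \<gamma> s" by blast
      then have "s = 0 \<or> s = len \<gamma>" using interior_not_vertex[OF \<gamma>, of s] x sub by blast
      then show False using s \<open>\<delta> > 0\<close> by (auto simp: C_def)
    qed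
    then obtain d where "d > 0" "\<forall>y \<in> crv \<gamma> ` C \<gamma>. d \<le> dist x y"
      using separate_point_closed[OF cl] by blast
    then show "\<exists>d>0. \<forall>d'. 0 < d' \<longrightarrow> d' \<le> d \<longrightarrow> (\<forall>s\<in>C \<gamma>. d' \<le> dist (crv \<gamma> s) x)"
      by (intro exI[of _ d]) (force simp: dist_commute)
  qed
  then obtain e where e: "e > 0" "\<And>\<gamma> s. \<gamma> \<in> E \<Longrightarrow> s \<in> C \<gamma> \<Longrightarrow> e \<le> dist (crv \<gamma> s) x" by blast
  show ?thesis
  proof (rule that[OF e(1)])
    fix y assume "y \<in> network E" "dist y x < e"
    then obtain \<gamma> s where \<gamma>: "\<gamma> \<in> E" "s \<in> {0..len \<gamma>}" "y = crv \<gamma> s" "dist (crv \<gamma> s) x < e"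
      unfolding network_def by blast
    then have "s \<notin> C \<gamma>" using e(2)[OF \<gamma>(1)] by force
    then consider "crv \<gamma> 0 = x" "s < \<delta>" | "crv \<gamma> (len \<gamma>) = x" "len \<gamma> - s < \<delta>"
      using \<gamma>(2) by (auto simp: C_def)
    then show "\<exists>\<gamma>\<in>arcs_from E x. \<exists>s. 0 \<le> s \<and> s < \<delta> \<and> s \<le> len \<gamma> \<and> y = crv \<gamma> s"
    proof cases
      case 1
      then show ?thesis using \<gamma> by (intro bexI[of _ \<gamma>] exI[of _ s]) (auto simp: arcs_from_def)
    next
      case 2
      then show ?thesis using \<gamma> inv_arc_from[OF \<gamma>(1) 2(1)]
        by (intro bexI[of _ "inv_arc \<gamma>"] exI[of _ "len \<gamma> - s"]) (auto simp: crv_inv_arc)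
    qed
  qed
qed

subsection \<open>Functions prescribed along the arcs issuing from a vertex\<close>

text \<open>Arcs that differ and are not reversals of each other meet only at vertices, where every
  k vanishes, so the contributions can be summed after extension by 0. Without loops an arc and its
  reversal cannot both issue from x, hence no value is counted twice. The finitely many closed arcs
  give continuity.\<close>

lemma glue_at_vertex:
  fixes k :: "'a net_arc \<Rightarrow> real \<Rightarrow> real"
  assumes x: "x \<in> vertices E"
    and k0: "\<And>\<gamma>. \<gamma> \<in> arcs_from E x \<Longrightarrow> k \<gamma> 0 = 0" "\<And>\<gamma>. \<gamma> \<in> arcs_from E x \<Longrightarrow> k \<gamma> (len \<gamma>) = 0"
    and kc: "\<And>\<gamma>. \<gamma> \<in> arcs_from E x \<Longrightarrow> continuous_on UNIV (k \<gamma>)"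
  defines "G \<equiv> \<lambda>\<gamma> s. if \<gamma> \<in> arcs_from E x then k \<gamma> s
      else if inv_arc \<gamma> \<in> arcs_from E x then k (inv_arc \<gamma>) (len \<gamma> - s) else 0"
  obtains g where "continuous_on (network E) g" "\<And>\<gamma> s. \<gamma> \<in> E \<Longrightarrow> s \<in> {0..len \<gamma>} \<Longrightarrow> g (crv \<gamma> s) = G \<gamma> s"
proof -
  define T where "T \<gamma> y = (if y \<in> crv \<gamma> ` {0..len \<gamma>} then k \<gamma> (inv_into {0..len \<gamma>} (crv \<gamma>) y) else 0)" for \<gamma> y
  define g where "g y = (\<Sum>\<gamma>\<in>arcs_from E x. T \<gamma> y)" for y
  have T_on: "T \<gamma> (crv \<gamma> s) = k \<gamma> s" if "\<gamma> \<in> E" "s \<in> {0..len \<gamma>}" for \<gamma> s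
    using that inj_crv[OF that(1)] by (simp add: T_def inv_into_f_f)
  have T_off: "T \<gamma>' (crv \<gamma> s) = 0"
    if a: "\<gamma>' \<in> arcs_from E x" "\<gamma> \<in> E" "s \<in> {0..len \<gamma>}" "\<gamma> \<noteq> \<gamma>'" "\<gamma> \<noteq> inv_arc \<gamma>'" for \<gamma> \<gamma>' s
  proof (cases "crv \<gamma> s \<in> crv \<gamma>' ` {0..len \<gamma>'}")
    case True
    have \<gamma>': "\<gamma>' \<in> E" using a(1) by (rule arcs_from_D)
    obtain s' where s': "s' \<in> {0..len \<gamma>'}" "crv \<gamma> s = crv \<gamma>' s'" using True by blast
    have "s' = 0 \<or> s' = len \<gamma>'"
    proof (rule ccontr)
      assume n: "\<not> ?thesis"
      then have i': "crv \<gamma>' s' \<in> arc_interior \<gamma>'" using s'(1) by (auto simp: arc_interior_def)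
      have "s \<noteq> 0" "s \<noteq> len \<gamma>"
        using interior_not_vertex[OF \<gamma>' s'(1)] n s'(2) endpoint_vertex[OF a(2)] by metis+
      then have "crv \<gamma> s \<in> arc_interior \<gamma>" using a(3) by (auto simp: arc_interior_def)
      then show False using interior_disjoint[OF \<gamma>' a(2,4,5)] i' s'(2) by auto
    qed
    then show ?thesis using T_on[OF \<gamma>' s'(1)] k0[OF a(1)] s'(2) by auto
  qed (simp add: T_def)
  have g1: "g (crv \<gamma> s) = k \<gamma> s" if a: "\<gamma> \<in> arcs_from E x" "s \<in> {0..len \<gamma>}" for \<gamma> s
  proof -
    have "(\<Sum>\<gamma>'\<in>arcs_from E x - {\<gamma>}. T \<gamma>' (crv \<gamma> s)) = 0"
    proof (rule sum.neutral, rule ballI)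
      fix \<gamma>' assume b: "\<gamma>' \<in> arcs_from E x - {\<gamma>}"
      then have "\<gamma> \<noteq> inv_arc \<gamma>'" using inv_arc_not_from[of \<gamma>' x] a by auto
      then show "T \<gamma>' (crv \<gamma> s) = 0" using T_off[of \<gamma>' \<gamma> s] a b arcs_from_D(1)[OF a(1)] by auto
    qed
    then show ?thesis unfolding g_def
      using sum.remove[OF finite_arcs_from a(1), of "\<lambda>\<gamma>'. T \<gamma>' (crv \<gamma> s)"] T_on[OF arcs_from_D(1)[OF a(1)] a(2)] by simp
  qed
  have gG: "g (crv \<gamma> s) = G \<gamma> s" if a: "\<gamma> \<in> E" "s \<in> {0..len \<gamma>}" for \<gamma> s
  proof -
    consider "\<gamma> \<in> arcs_from E x" | "\<gamma> \<notin> arcs_from E x" "inv_arc \<gamma> \<in> arcs_from E x"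
      | "\<gamma> \<notin> arcs_from E x" "inv_arc \<gamma> \<notin> arcs_from E x" by blast
    then show ?thesis
    proof cases
      case 1
      then show ?thesis using g1[OF 1 a(2)] by (simp add: G_def)
    next
      case 2
      have "crv \<gamma> s = crv (inv_arc \<gamma>) (len \<gamma> - s)" using a(2) by (simp add: crv_inv_arc)
      then show ?thesis using g1[OF 2(2), of "len \<gamma> - s"] a(2) 2 by (simp add: G_def)
    next
      case 3
      have "T \<gamma>' (crv \<gamma> s) = 0" if b: "\<gamma>' \<in> arcs_from E x" for \<gamma>'
      proof (rule T_off[OF b a])
        show "\<gamma> \<noteq> \<gamma>'" using 3 b by blast
        show "\<gamma> \<noteq> inv_arc \<gamma>'" using 3(2) b inv_inv_arc_in[OF arcs_from_D(1)[OF b]] by metis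
      qed
      then show ?thesis using 3 by (simp add: g_def G_def)
    qed
  qed
  have Gc: "continuous_on UNIV (G \<gamma>)" for \<gamma>
  proof -
    have "continuous_on UNIV (\<lambda>s. k (inv_arc \<gamma>) (len \<gamma> - s))" if "inv_arc \<gamma> \<in> arcs_from E x"
      by (intro continuous_on_compose2[OF kc[OF that]] continuous_intros) auto
    then show ?thesis using kc[of \<gamma>] unfolding G_def
      by (cases "\<gamma> \<in> arcs_from E x"; cases "inv_arc \<gamma> \<in> arcs_from E x") simp_all
  qed
  have "continuous_on (network E) g"
    unfolding network_def
  proof (rule continuous_on_closed_Union[OF finite_arcs])
    fix \<gamma> assume \<gamma>: "\<gamma> \<in> E"
    let ?K = "crv \<gamma> ` {0..len \<gamma>}"
    show "closed ?K" by (intro compact_imp_closed compact_continuous_image continuous_crv[OF \<gamma>]) simp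
    let ?inv = "inv_into {0..len \<gamma>} (crv \<gamma>)"
    have "continuous_on ?K ?inv"
      by (rule continuous_on_inv[OF continuous_crv[OF \<gamma>]]) (use inj_crv[OF \<gamma>] in \<open>auto simp: inv_into_f_f\<close>)
    then have "continuous_on ?K (\<lambda>y. G \<gamma> (?inv y))"
      by (rule continuous_on_compose2[OF Gc]) simp
    moreover have "g y = G \<gamma> (?inv y)" if "y \<in> ?K" for y
      using gG[OF \<gamma> inv_into_into[OF that]] f_inv_into_f[OF that] by simp
    ultimately show "continuous_on ?K g" by (simp cong: continuous_on_cong)
  qed
  then show ?thesis using gG that by blast
qed

lemma network_test_function:
  assumes x: "x \<in> vertices E" and t0: "0 < t0"
    and jets: "\<And>\<gamma>. \<gamma> \<in> arcs_from E x \<Longrightarrow> lower_jet (strip (len \<gamma>)) (along \<gamma> v) 0 t0 (p \<gamma>) a"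
  obtains \<Phi> where "C1_network E \<Phi>" "subtangent (network E \<times> {0..}) v \<Phi> (x, t0)"
    "((\<lambda>r. \<Phi> (x, r)) has_real_derivative a) (at t0)"
    "\<And>\<gamma>. \<gamma> \<in> arcs_from E x \<Longrightarrow> ((\<lambda>s. along \<gamma> \<Phi> (s, t0)) has_real_derivative p \<gamma>) (at 0 within {0..len \<gamma>})"
proof -
  define B where "B \<gamma> h k \<longleftrightarrow> \<gamma> \<in> arcs_from E x \<and> (h, t0 + k) \<in> strip (len \<gamma>)" for \<gamma> h k
  define er where "er \<gamma> h k = v (x, t0) + p \<gamma> * h + a * k - along \<gamma> v (h, t0 + k)" for \<gamma> h k
  have along0: "along \<gamma> v (0, t) = v (x, t)" if "\<gamma> \<in> arcs_from E x" for \<gamma> v t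
    using arcs_from_D(2)[OF that] by (simp add: along_def)
  have err: "\<exists>d>0. \<forall>\<gamma> h k. B \<gamma> h k \<longrightarrow> \<bar>h\<bar> < d \<longrightarrow> \<bar>k\<bar> < d \<longrightarrow> er \<gamma> h k \<le> \<epsilon> * (\<bar>h\<bar> + \<bar>k\<bar>)" if \<epsilon>: "\<epsilon> > 0" for \<epsilon>
  proof -
    have "\<exists>d>0. \<forall>\<gamma>\<in>arcs_from E x. \<forall>h k. B \<gamma> h k \<longrightarrow> \<bar>h\<bar> < d \<longrightarrow> \<bar>k\<bar> < d \<longrightarrow> er \<gamma> h k \<le> \<epsilon> * (\<bar>h\<bar> + \<bar>k\<bar>)"
    proof (rule finite_common_radius[OF finite_arcs_from])
      fix \<gamma> assume \<gamma>: "\<gamma> \<in> arcs_from E x"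
      obtain d where d: "d > 0" "\<And>h k. \<bar>h\<bar> < d \<Longrightarrow> \<bar>k\<bar> < d \<Longrightarrow> (0 + h, t0 + k) \<in> strip (len \<gamma>) \<Longrightarrow>
        along \<gamma> v (0, t0) + p \<gamma> * h + a * k - \<epsilon> * (\<bar>h\<bar> + \<bar>k\<bar>) \<le> along \<gamma> v (0 + h, t0 + k)"
        by (rule lower_jetD[OF jets[OF \<gamma>] \<epsilon>]) (rule that)
      have "er \<gamma> h k \<le> \<epsilon> * (\<bar>h\<bar> + \<bar>k\<bar>)" if "B \<gamma> h k" "\<bar>h\<bar> < d" "\<bar>k\<bar> < d" for h k
      proof -
        have "(0 + h, t0 + k) \<in> strip (len \<gamma>)" using that(1) by (simp add: B_def)
        from d(2)[OF that(2,3) this] show ?thesis unfolding along0[OF \<gamma>] er_def add_0 by linarith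
      qed
      then show "\<exists>d>0. \<forall>d'. 0 < d' \<longrightarrow> d' \<le> d \<longrightarrow> (\<forall>h k. B \<gamma> h k \<longrightarrow> \<bar>h\<bar> < d' \<longrightarrow> \<bar>k\<bar> < d' \<longrightarrow> er \<gamma> h k \<le> \<epsilon> * (\<bar>h\<bar> + \<bar>k\<bar>))"
        using d(1) by (intro exI[of _ d]) auto
    qed
    then obtain d where "d > 0" "\<And>\<gamma> h k. \<gamma> \<in> arcs_from E x \<Longrightarrow> B \<gamma> h k \<Longrightarrow> \<bar>h\<bar> < d \<Longrightarrow> \<bar>k\<bar> < d \<Longrightarrow> er \<gamma> h k \<le> \<epsilon> * (\<bar>h\<bar> + \<bar>k\<bar>)"
      by blast
    then show ?thesis by (intro exI[of _ d]) (auto simp: B_def)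
  qed
  obtain \<sigma> \<sigma>' d where \<sigma>: "continuous_on UNIV \<sigma>'" "\<And>r. (\<sigma> has_real_derivative \<sigma>' r) (at r)"
      "\<sigma> 0 = 0" "\<sigma>' 0 = 0" "\<And>r. 0 \<le> \<sigma> r" "d > 0"
    and bd: "\<And>\<gamma> h k. B \<gamma> h k \<Longrightarrow> \<bar>h\<bar> < d \<Longrightarrow> \<bar>k\<bar> < d \<Longrightarrow> er \<gamma> h k \<le> \<sigma> h + \<sigma> k"
    by (rule C1_modulus[where B = B and e = er, OF err]) (assumption, rule that)
  have \<sigma>c: "continuous_on UNIV \<sigma>" using \<sigma>(2) by (intro DERIV_continuous_on) (auto intro: DERIV_subset)
  \<comment> \<open>The factor 1 - s / len \<gamma> in k makes it vanish at the far end, as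
    \<open>glue_at_vertex\<close> requires, and keeps p \<gamma> as derivative at 0. On the first
    half of the arc at least half of each correction survives: 2 \<sigma> leaves \<sigma>, and M
    compensates the change in the linear term that the cutoff causes for negative p
    \<gamma>.\<close>
  define M where "M \<gamma> = 2 * \<bar>p \<gamma>\<bar> / len \<gamma>" for \<gamma>
  define k where "k \<gamma> s = (p \<gamma> * s - 2 * \<sigma> s - M \<gamma> * s\<^sup>2) * (1 - s / len \<gamma>)" for \<gamma> s
  define k' where "k' \<gamma> s = (p \<gamma> - 2 * \<sigma>' s - 2 * M \<gamma> * s) * (1 - s / len \<gamma>)
      - (p \<gamma> * s - 2 * \<sigma> s - M \<gamma> * s\<^sup>2) / len \<gamma>" for \<gamma> s
  have Dk: "(k \<gamma> has_real_derivative k' \<gamma> s) (at s)" for \<gamma> s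
    unfolding k_def[abs_def] k'_def divide_inverse
    by (auto intro!: derivative_eq_intros \<sigma>(2) simp: algebra_simps)
  have ck': "continuous_on UNIV (k' \<gamma>)" for \<gamma>
    unfolding k'_def[abs_def] divide_inverse by (intro continuous_intros \<sigma>(1) \<sigma>c)
  have k0: "k \<gamma> 0 = 0" for \<gamma> using \<sigma>(3) by (simp add: k_def)
  have kL: "k \<gamma> (len \<gamma>) = 0" if "\<gamma> \<in> arcs_from E x" for \<gamma>
    using len_pos[OF arcs_from_D(1)[OF that]] by (simp add: k_def)
  have ck: "continuous_on UNIV (k \<gamma>)" for \<gamma> using Dk by (intro DERIV_continuous_on) (auto intro: DERIV_subset)
  obtain g where g: "continuous_on (network E) g" "\<And>\<gamma> s. \<gamma> \<in> E \<Longrightarrow> s \<in> {0..len \<gamma>} \<Longrightarrow>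
      g (crv \<gamma> s) = (if \<gamma> \<in> arcs_from E x then k \<gamma> s
      else if inv_arc \<gamma> \<in> arcs_from E x then k (inv_arc \<gamma>) (len \<gamma> - s) else 0)"
    by (rule glue_at_vertex[where k = k, OF x k0 kL ck]) (assumption, rule that)
  have g_from: "g (crv \<gamma> s) = k \<gamma> s" if "\<gamma> \<in> arcs_from E x" "s \<in> {0..len \<gamma>}" for \<gamma> s
    using g(2)[OF arcs_from_D(1)[OF that(1)] that(2)] that(1) by simp
  define A where "A t = a * (t - t0) - \<sigma> (t - t0)" for t
  define \<Phi> where "\<Phi> = (\<lambda>(y, t). g y + A t)"
  have DA: "(A has_real_derivative a - \<sigma>' (t - t0)) (at t)" for t
    unfolding A_def[abs_def] by (auto intro!: derivative_eq_intros DERIV_chain2[OF \<sigma>(2)])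
  have cA': "continuous_on UNIV (\<lambda>t. a - \<sigma>' (t - t0))"
    by (intro continuous_intros continuous_on_compose2[OF \<sigma>(1)]) auto
  have cA: "continuous_on UNIV A" using DA by (intro DERIV_continuous_on) (auto intro: DERIV_subset)
  obtain \<gamma>0 where \<gamma>0: "\<gamma>0 \<in> arcs_from E x" using arcs_from_nonempty[OF x] by blast
  have gx: "g x = 0"
    using g_from[OF \<gamma>0, of 0] arcs_from_D[OF \<gamma>0] len_pos[of \<gamma>0] k0 by simp
  show ?thesis
  proof (rule that[of \<Phi>])
    show "((\<lambda>r. \<Phi> (x, r)) has_real_derivative a) (at t0)"
      using DA[of t0] \<sigma>(4) unfolding \<Phi>_def by (auto intro!: derivative_eq_intros)
    show "((\<lambda>s. along \<gamma> \<Phi> (s, t0)) has_real_derivative p \<gamma>) (at 0 within {0..len \<gamma>})"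
      if \<gamma>: "\<gamma> \<in> arcs_from E x" for \<gamma>
    proof -
      have "(k \<gamma> has_real_derivative p \<gamma>) (at 0 within {0..len \<gamma>})"
        using Dk[of \<gamma> 0] \<sigma>(3,4) by (auto simp: k'_def intro: DERIV_subset)
      moreover have "A t0 = 0" using \<sigma>(3) by (simp add: A_def)
      ultimately show ?thesis
        using len_pos[OF arcs_from_D(1)[OF \<gamma>]] g_from[OF \<gamma>]
        by (elim DERIV_cong_ev[THEN iffD1, rotated -1] has_field_derivative_transform_within[where d = 1])
          (auto simp: along_def \<Phi>_def)
    qed
    show "C1_network E \<Phi>" unfolding C1_network_def
    proof (intro conjI ballI)
      show "continuous_on (network E \<times> {0..}) \<Phi>" unfolding \<Phi>_def case_prod_unfold
        by (intro continuous_intros continuous_on_compose2[OF g(1)] continuous_on_compose2[OF cA]) auto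
      fix \<gamma> assume \<gamma>: "\<gamma> \<in> E"
      define G where "G s = (if \<gamma> \<in> arcs_from E x then k \<gamma> s
        else if inv_arc \<gamma> \<in> arcs_from E x then k (inv_arc \<gamma>) (len \<gamma> - s) else 0)" for s
      define G' where "G' s = (if \<gamma> \<in> arcs_from E x then k' \<gamma> s
        else if inv_arc \<gamma> \<in> arcs_from E x then - k' (inv_arc \<gamma>) (len \<gamma> - s) else 0)" for s
      have "((\<lambda>s. k (inv_arc \<gamma>) (len \<gamma> - s)) has_real_derivative - k' (inv_arc \<gamma>) (len \<gamma> - s)) (at s)" for s
      proof -
        have "((\<lambda>s. len \<gamma> - s) has_real_derivative - 1) (at s)" by (auto intro!: derivative_eq_intros)
        from DERIV_chain2[OF Dk this] show ?thesis by simp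
      qed
      then have DG: "(G has_real_derivative G' s) (at s)" for s
        unfolding G_def[abs_def] G'_def using Dk by auto
      have "continuous_on UNIV (\<lambda>s. - k' (inv_arc \<gamma>) (len \<gamma> - s))"
        by (intro continuous_intros continuous_on_compose2[OF ck']) auto
      then have cG': "continuous_on UNIV G'"
        unfolding G'_def[abs_def] using ck'[of \<gamma>]
        by (cases "\<gamma> \<in> arcs_from E x"; cases "inv_arc \<gamma> \<in> arcs_from E x") simp_all
      show "C1_on ({0..len \<gamma>} \<times> {0..}) (along \<gamma> \<Phi>)"
        by (rule C1_on_separated[OF cG' cA' DG DA])
          (use g(2)[OF \<gamma>] in \<open>auto simp: along_def \<Phi>_def G_def\<close>)
    qed
    show "subtangent (network E \<times> {0..}) v \<Phi> (x, t0)"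
    proof -
      have "\<exists>\<delta>>0. \<forall>\<gamma>\<in>arcs_from E x. \<delta> \<le> len \<gamma> / 2"
        by (rule finite_common_radius[OF finite_arcs_from])
          (metis arcs_from_D(1) half_gt_zero len_pos)
      then obtain \<delta>0 where \<delta>0: "\<delta>0 > 0" "\<And>\<gamma>. \<gamma> \<in> arcs_from E x \<Longrightarrow> \<delta>0 \<le> len \<gamma> / 2" by blast
      have "min \<delta>0 d > 0" using \<delta>0 \<sigma>(6) by simp
      then obtain e where e: "e > 0" "\<And>y. y \<in> network E \<Longrightarrow> dist y x < e \<Longrightarrow>
        \<exists>\<gamma>\<in>arcs_from E x. \<exists>s. 0 \<le> s \<and> s < min \<delta>0 d \<and> s \<le> len \<gamma> \<and> y = crv \<gamma> s"
        by (rule near_vertex[OF x]) (rule that)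
      have "v (x, t0) - \<Phi> (x, t0) \<le> v (y, t) - \<Phi> (y, t)"
        if a: "y \<in> network E" "0 \<le> t" "dist (y, t) (x, t0) < min e d" for y t
      proof -
        have d1: "dist y x < e" "\<bar>t - t0\<bar> < d"
          using a(3) dist_fst_le[of "(y, t)" "(x, t0)"] dist_snd_le[of "(y, t)" "(x, t0)"]
          by (auto simp: dist_real_def)
        obtain \<gamma> s where \<gamma>: "\<gamma> \<in> arcs_from E x" and s: "0 \<le> s" "s < \<delta>0" "s < d" "s \<le> len \<gamma>" "y = crv \<gamma> s"
          using e(2)[OF a(1) d1(1)] by auto
        have L: "0 < len \<gamma>" using len_pos[OF arcs_from_D(1)[OF \<gamma>]] .
        have "er \<gamma> s (t - t0) \<le> \<sigma> s + \<sigma> (t - t0)"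
          using bd[of \<gamma> s "t - t0"] \<gamma> s a(2) d1 by (auto simp: B_def)
        then have v: "v (x, t0) + p \<gamma> * s + a * (t - t0) - \<sigma> s - \<sigma> (t - t0) \<le> v (y, t)"
          by (simp add: er_def along_def s(5))
        have "k \<gamma> s \<le> p \<gamma> * s - \<sigma> s"
        proof -
          define w where "w = s / len \<gamma>"
          have w: "0 \<le> w" "w \<le> 1/2" "M \<gamma> * s = 2 * \<bar>p \<gamma>\<bar> * w"
            using s(1,2) \<delta>0(2)[OF \<gamma>] L by (auto simp: w_def M_def field_simps)
          have eq: "p \<gamma> * s - \<sigma> s - k \<gamma> s = \<sigma> s * (1 - 2 * w) + s * (M \<gamma> * s) * (1 - w) + s * (p \<gamma> * w)"
            unfolding k_def w_def[symmetric] by (simp add: power2_eq_square algebra_simps)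
          have "\<bar>p \<gamma>\<bar> * w * 1 \<le> \<bar>p \<gamma>\<bar> * w * (2 * (1 - w))" using w by (intro mult_left_mono) auto
          moreover have "- (\<bar>p \<gamma>\<bar> * w) \<le> p \<gamma> * w"
            using mult_right_mono[of "- \<bar>p \<gamma>\<bar>" "p \<gamma>" w] w by simp
          ultimately have "0 \<le> (M \<gamma> * s) * (1 - w) + p \<gamma> * w" unfolding w(3) by (simp add: algebra_simps)
          then have "0 \<le> s * ((M \<gamma> * s) * (1 - w) + p \<gamma> * w)" using s(1) by simp
          moreover have "0 \<le> \<sigma> s * (1 - 2 * w)" using \<sigma>(5)[of s] w by simp
          ultimately show ?thesis using eq by (simp add: algebra_simps)
        qed
        then show ?thesis using v g_from[OF \<gamma>, of s] s gx \<sigma>(3) by (simp add: \<Phi>_def A_def)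
      qed
      then show ?thesis unfolding subtangent_def eventually_at
        using e(1) \<sigma>(6) by (intro exI[of _ "min e d"]) auto
    qed
  qed
qed

end

section \<open>Consequences of transport on a strip\<close>

definition upper_slope :: "(real \<Rightarrow> real) \<Rightarrow> real \<Rightarrow> real \<Rightarrow> bool" where
  "upper_slope f t b \<longleftrightarrow> (\<forall>\<epsilon>>0. \<exists>d>0. \<forall>k. \<bar>k\<bar> < d \<longrightarrow> f (t + k) \<le> f t + b * k + \<epsilon> * \<bar>k\<bar>)"

lemma upper_slopeD:
  assumes "upper_slope f t b" "\<epsilon> > 0"
  obtains d where "d > 0" "\<And>k. \<bar>k\<bar> < d \<Longrightarrow> f (t + k) \<le> f t + b * k + \<epsilon> * \<bar>k\<bar>"
  using assms unfolding upper_slope_def by blast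

lemma upper_slope_of_supertangent:
  assumes "supertangent {0<..} f \<psi> t" "(\<psi> has_real_derivative b) (at t)" "0 < t"
  shows "upper_slope f t b"
  unfolding upper_slope_def
proof (intro allI impI)
  fix \<epsilon> :: real assume \<epsilon>: "\<epsilon> > 0"
  obtain d1 where d1: "d1 > 0" "\<And>y. y \<in> {0<..} \<Longrightarrow> y \<noteq> t \<Longrightarrow> dist y t < d1 \<Longrightarrow> f y - \<psi> y \<le> f t - \<psi> t"
    using assms(1) unfolding supertangent_def eventually_at by blast
  have "(\<psi> has_derivative (\<lambda>k. b * k)) (at t)"
    using assms(2) by (simp add: has_field_derivative_def)
  then obtain d2 where d2: "d2 > 0" "\<And>y. norm (y - t) < d2 \<Longrightarrow> norm (\<psi> y - \<psi> t - b * (y - t)) \<le> \<epsilon> * norm (y - t)"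
    using \<epsilon> unfolding has_derivative_at_alt by blast
  show "\<exists>d>0. \<forall>k. \<bar>k\<bar> < d \<longrightarrow> f (t + k) \<le> f t + b * k + \<epsilon> * \<bar>k\<bar>"
  proof (intro exI[of _ "Min {d1, d2, t}"] conjI allI impI)
    fix k assume k: "\<bar>k\<bar> < Min {d1, d2, t}"
    have "f (t + k) - \<psi> (t + k) \<le> f t - \<psi> t"
      using d1(2)[of "t + k"] k by (cases "k = 0") (auto simp: dist_real_def)
    moreover have "\<bar>\<psi> (t + k) - \<psi> t - b * k\<bar> \<le> \<epsilon> * \<bar>k\<bar>" using d2(2)[of "t + k"] k by simp
    ultimately show "f (t + k) \<le> f t + b * k + \<epsilon> * \<bar>k\<bar>" unfolding abs_le_iff by linarith
  qed (use d1 d2 assms(3) in auto)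
qed

lemma strip_hamiltonian_min:
  assumes "strip_hamiltonian L h" "s \<in> {0..L}"
  obtains m where "\<And>p. h s m \<le> h s p"
proof -
  have cont: "continuous_on ({0..L} \<times> UNIV) (\<lambda>(s, p). h s p)"
    using assms unfolding strip_hamiltonian_def by auto
  obtain \<delta> C where d: "\<delta> > 0" "\<And>s p. s \<in> {0..L} \<Longrightarrow> \<delta> * \<bar>p\<bar> - C \<le> h s p"
    using assms unfolding strip_hamiltonian_def by blast
  define R where "R = (\<bar>h s 0\<bar> + \<bar>C\<bar>) / \<delta>"
  have R: "0 \<le> R" "\<delta> * R = \<bar>h s 0\<bar> + \<bar>C\<bar>" using d(1) by (auto simp: R_def)
  have "continuous_on {-R..R} (\<lambda>p. (\<lambda>(s, p). h s p) (s, p))"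
    by (rule continuous_on_compose2[OF cont]) (use assms(2) in \<open>auto intro!: continuous_intros\<close>)
  then have "continuous_on {-R..R} (h s)" by simp
  then obtain m where m: "m \<in> {-R..R}" "\<And>p. p \<in> {-R..R} \<Longrightarrow> h s m \<le> h s p"
    using continuous_attains_inf[of "{-R..R}" "h s"] R(1) by auto
  have "h s m \<le> h s p" for p
  proof (cases "\<bar>p\<bar> \<le> R")
    case True
    then show ?thesis using m(2)[of p] by (simp add: abs_le_iff)
  next
    case False
    have "\<delta> * R \<le> \<delta> * \<bar>p\<bar>" using False d(1) by (intro mult_left_mono) auto
    then have "h s 0 \<le> h s p" using d(2)[OF assms(2), of p] R(2) by linarith
    then show ?thesis using m(2)[of 0] R(1) by simp
  qed
  then show ?thesis using that by blast
qed

section \<open>Congruence and affine changes of the space variable\<close>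

lemma lower_jet_cong:
  assumes "(s, t) \<in> S" "\<And>z. z \<in> S \<Longrightarrow> f z = g z"
  shows "lower_jet S f s t p a \<longleftrightarrow> lower_jet S g s t p a"
proof -
  have "lower_jet S g s t p a" if "lower_jet S f s t p a" "\<And>z. z \<in> S \<Longrightarrow> f z = g z" for f g
    by (rule lower_jet_le[OF that(1), of 1]) (use that(2) assms(1) in auto)
  from this[of f g] this[of g f] show ?thesis using assms(2) by auto
qed

lemma strip_sub_cong:
  assumes "\<And>z. z \<in> strip L \<Longrightarrow> f z = g z"
  shows "strip_sub L h f \<longleftrightarrow> strip_sub L h g"
proof -
  have "upper_jet (strip L) f s t p a \<longleftrightarrow> upper_jet (strip L) g s t p a" if "s \<in> {0<..<L}" "0 < t" for s t p a
    by (rule lower_jet_cong) (use that assms in auto)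
  then show ?thesis unfolding strip_sub_def by auto
qed

lemma strip_super_cong:
  assumes "\<And>z. z \<in> strip L \<Longrightarrow> f z = g z"
  shows "strip_super L h f \<longleftrightarrow> strip_super L h g"
proof -
  have "lower_jet (strip L) f s t p a \<longleftrightarrow> lower_jet (strip L) g s t p a" if "s \<in> {0<..<L}" "0 < t" for s t p a
    by (rule lower_jet_cong) (use that assms in auto)
  then show ?thesis unfolding strip_super_def by auto
qed

text \<open>Serves both to split an arc at an interior point into two branches and to reverse an
  arc; \<tau> = -1 flips the sign of the slope.\<close>

lemma lower_jet_affine:
  assumes j: "lower_jet (strip L') (\<lambda>(s, t). V (s0 + \<tau> * s, t)) s t p a"
    and s: "0 < s" "s < L'" and \<tau>: "\<tau> = 1 \<or> \<tau> = -1"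
  shows "lower_jet (strip L) V (s0 + \<tau> * s) t (\<tau> * p) a"
proof (rule lower_jetI)
  fix \<epsilon> :: real assume \<epsilon>: "\<epsilon> > 0"
  obtain d where d: "d > 0" "\<And>h k. \<bar>h\<bar> < d \<Longrightarrow> \<bar>k\<bar> < d \<Longrightarrow> (s + h, t + k) \<in> strip L' \<Longrightarrow>
      (\<lambda>(s, t). V (s0 + \<tau> * s, t)) (s, t) + p * h + a * k - \<epsilon> * (\<bar>h\<bar> + \<bar>k\<bar>) \<le> (\<lambda>(s, t). V (s0 + \<tau> * s, t)) (s + h, t + k)"
    by (rule lower_jetD[OF j \<epsilon>]) (rule that)
  show "\<exists>d>0. \<forall>h k. \<bar>h\<bar> < d \<longrightarrow> \<bar>k\<bar> < d \<longrightarrow> (s0 + \<tau> * s + h, t + k) \<in> strip L \<longrightarrow>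
      V (s0 + \<tau> * s, t) + \<tau> * p * h + a * k - \<epsilon> * (\<bar>h\<bar> + \<bar>k\<bar>) \<le> V (s0 + \<tau> * s + h, t + k)"
  proof (intro exI[of _ "Min {d, s, L' - s}"] conjI allI impI)
    fix h k assume a: "\<bar>h\<bar> < Min {d, s, L' - s}" "\<bar>k\<bar> < Min {d, s, L' - s}" "(s0 + \<tau> * s + h, t + k) \<in> strip L"
    have hs: "0 \<le> s + h" "s + h \<le> L'" "0 \<le> s - h" "s - h \<le> L'" using a(1) by (auto simp: abs_less_iff)
    from \<tau> show "V (s0 + \<tau> * s, t) + \<tau> * p * h + a * k - \<epsilon> * (\<bar>h\<bar> + \<bar>k\<bar>) \<le> V (s0 + \<tau> * s + h, t + k)"
    proof
      assume "\<tau> = 1"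
      then show ?thesis using d(2)[of h k] a hs by (auto simp: add.assoc)
    next
      assume "\<tau> = - 1"
      then show ?thesis using d(2)[of "- h" k] a hs by (auto simp: algebra_simps)
    qed
  qed (use d s in auto)
qed

lemma strip_super_affine:
  assumes V: "strip_super L h V" and \<tau>: "\<tau> = 1 \<or> \<tau> = -1"
    and sub: "\<And>s. s \<in> {0..L'} \<Longrightarrow> s0 + \<tau> * s \<in> {0..L}"
  shows "strip_super L' (\<lambda>s p. h (s0 + \<tau> * s) (\<tau> * p)) (\<lambda>(s, t). V (s0 + \<tau> * s, t))"
  unfolding strip_super_def
proof (intro ballI allI impI)
  fix s t p a assume s: "s \<in> {0<..<L'}" "0 < t"
    and j: "lower_jet (strip L') (\<lambda>(s, t). V (s0 + \<tau> * s, t)) s t p a"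
  have "lower_jet (strip L) V (s0 + \<tau> * s) t (\<tau> * p) a" by (rule lower_jet_affine[OF j]) (use s \<tau> in auto)
  moreover have "0 < s0 + \<tau> * s" "s0 + \<tau> * s < L" using sub[of 0] sub[of L'] s \<tau> by auto
  ultimately show "0 \<le> a + h (s0 + \<tau> * s) (\<tau> * p)" using strip_superD[OF V] s(2) by blast
qed

lemma strip_hamiltonian_affine:
  assumes h: "strip_hamiltonian L h" and \<tau>: "\<tau> = 1 \<or> \<tau> = -1" and "0 < L'"
    and sub: "\<And>s. s \<in> {0..L'} \<Longrightarrow> s0 + \<tau> * s \<in> {0..L}"
  shows "strip_hamiltonian L' (\<lambda>s p. h (s0 + \<tau> * s) (\<tau> * p))"
proof -
  have cont: "continuous_on ({0..L} \<times> UNIV) (\<lambda>(s, p). h s p)"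
    and conv: "\<And>s. s \<in> {0..L} \<Longrightarrow> convex_on UNIV (h s)"
    using h unfolding strip_hamiltonian_def by auto
  obtain \<delta> C where d: "\<delta> > 0" "\<And>s p. s \<in> {0..L} \<Longrightarrow> \<delta> * \<bar>p\<bar> - C \<le> h s p"
    using h unfolding strip_hamiltonian_def by blast
  have "continuous_on ({0..L'} \<times> UNIV) (\<lambda>z. (\<lambda>(s, p). h s p) (s0 + \<tau> * fst z, \<tau> * snd z))"
    by (rule continuous_on_compose2[OF cont]) (use sub in \<open>auto intro!: continuous_intros\<close>)
  then have 1: "continuous_on ({0..L'} \<times> UNIV) (\<lambda>(s, p). h (s0 + \<tau> * s) (\<tau> * p))"
    by (simp add: case_prod_unfold)
  have 2: "convex_on UNIV (\<lambda>p. h (s0 + \<tau> * s) (\<tau> * p))" if "s \<in> {0..L'}" for s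
  proof (rule convex_onI)
    fix t x y :: real assume "0 < t" "t < 1"
    then show "h (s0 + \<tau> * s) (\<tau> * ((1 - t) *\<^sub>R x + t *\<^sub>R y)) \<le> (1 - t) * h (s0 + \<tau> * s) (\<tau> * x) + t * h (s0 + \<tau> * s) (\<tau> * y)"
      using convex_onD[OF conv[OF sub[OF that]], of t "\<tau> * x" "\<tau> * y"] by (simp add: algebra_simps)
  qed simp
  have 3: "\<delta> * \<bar>p\<bar> - C \<le> h (s0 + \<tau> * s) (\<tau> * p)" if "s \<in> {0..L'}" for s p
    using d(2)[OF sub[OF that], of "\<tau> * p"] \<tau> by auto
  show ?thesis unfolding strip_hamiltonian_def using 1 2 3 d(1) \<open>0 < L'\<close> by blast
qed

section \<open>Lines through interior points and through the base\<close>

lemma interior_line: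
  assumes h: "strip_hamiltonian L h" and U: "usc_on (strip L) U" "strip_sub L h U"
    and s0: "0 < s0" "s0 < L" and t0: "0 < t0" and tilt: "tilt (h s0) (- \<nu>) \<kappa>"
  shows "\<exists>d>0. \<forall>\<sigma>. 0 < \<sigma> \<longrightarrow> \<sigma> < d \<longrightarrow> U (s0, t0) \<le> U (s0 - \<nu> * \<sigma>, t0 - \<sigma>) + \<kappa> * \<sigma>"
proof -
  have "s0 \<in> {0..L}" using s0 by simp
  then obtain r where r: "r > 0" "\<And>s p. s \<in> {0..L} \<Longrightarrow> \<bar>s - s0\<bar> < r \<Longrightarrow> 0 \<le> h s p + - \<nu> * p + \<kappa>"
    by (rule tilt_nearby[OF h _ tilt]) (rule that)
  define \<rho> where "\<rho> = Min {r, s0, L - s0} / 2"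
  have \<rho>: "\<rho> > 0" "\<rho> < r" "\<rho> < s0" "\<rho> < L - s0" using r s0 by (auto simp: \<rho>_def)
  show ?thesis
  proof (intro exI[of _ "min t0 (\<rho> / (\<bar>\<nu>\<bar> + 1))"] conjI allI impI)
    fix \<sigma> assume \<sigma>: "0 < \<sigma>" "\<sigma> < min t0 (\<rho> / (\<bar>\<nu>\<bar> + 1))"
    then have "\<sigma> * (\<bar>\<nu>\<bar> + 1) < \<rho>" by (simp add: less_divide_eq)
    moreover have "\<bar>\<nu> * \<sigma>\<bar> \<le> \<sigma> * (\<bar>\<nu>\<bar> + 1)" using \<sigma> by (simp add: abs_mult algebra_simps)
    ultimately have ns: "\<bar>\<nu> * \<sigma>\<bar> < \<rho>" by linarith
    have "U (s0 - \<nu> * \<sigma> + \<nu> * \<sigma>, (t0 - \<sigma>) + \<sigma>) \<le> U (s0 - \<nu> * \<sigma>, t0 - \<sigma>) + \<kappa> * \<sigma>"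
    proof (rule transport_interior[OF U, of "s0 - \<rho>" "s0 + \<rho>"])
      show "0 \<le> h s p + - \<nu> * p + \<kappa>" if "s \<in> {s0 - \<rho>..s0 + \<rho>}" for s p
        by (rule r(2)) (use that \<rho> in \<open>auto simp: abs_less_iff\<close>)
    qed (use \<rho> ns \<sigma> in \<open>auto simp: abs_less_iff\<close>)
    then show "U (s0, t0) \<le> U (s0 - \<nu> * \<sigma>, t0 - \<sigma>) + \<kappa> * \<sigma>" by simp
  qed (use t0 \<rho> in auto)
qed

text \<open>Outward transport compares U (s, t0 + k) with U (0, t0 + k - s / \<nu>), so a bound in
  time along the base spreads into the strip. This supplies every arc at a vertex with a jet of the
  same time slope; without such jets the junction condition would say nothing.\<close>

lemma upper_jet_base:
  assumes h: "strip_hamiltonian L h" and U: "usc_on (strip L) U" "strip_sub L h U"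
    and t0: "0 < t0" and slope: "upper_slope (\<lambda>t. U (0, t)) t0 b"
  shows "\<exists>p. upper_jet (strip L) U 0 t0 p b"
proof -
  have L: "0 < L" using h by (simp add: strip_hamiltonian_def)
  obtain \<nu> \<kappa> where \<nu>: "\<nu> > 0" "\<And>s p. s \<in> {0..L} \<Longrightarrow> 0 \<le> h s p + - \<nu> * p + \<kappa>"
    by (rule tilt_small_slope[OF h]) (rule that)
  have "upper_jet (strip L) U 0 t0 ((\<kappa> - b) / \<nu>) b"
  proof (rule upper_jetI)
    fix \<epsilon> :: real assume "\<epsilon> > 0"
    define \<epsilon>' where "\<epsilon>' = min \<epsilon> (\<epsilon> * \<nu>)"
    have \<epsilon>': "\<epsilon>' > 0" "\<epsilon>' \<le> \<epsilon>" "\<epsilon>' / \<nu> \<le> \<epsilon>" using \<open>\<epsilon> > 0\<close> \<nu>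
      by (auto simp: \<epsilon>'_def min_less_iff_conj divide_le_eq)
    obtain d where d: "d > 0" "\<And>k. \<bar>k\<bar> < d \<Longrightarrow> U (0, t0 + k) \<le> U (0, t0) + b * k + \<epsilon>' * \<bar>k\<bar>"
      by (rule upper_slopeD[OF slope \<epsilon>'(1)]) (rule that)
    define e where "e = Min {d / 2, t0 / 2, L, d / 2 * \<nu>, t0 / 2 * \<nu>}"
    have e: "e > 0" using d t0 L \<nu> by (simp add: e_def)
    show "\<exists>d>0. \<forall>s k. \<bar>s\<bar> < d \<longrightarrow> \<bar>k\<bar> < d \<longrightarrow> (0 + s, t0 + k) \<in> strip L \<longrightarrow>
        U (0 + s, t0 + k) \<le> U (0, t0) + (\<kappa> - b) / \<nu> * s + b * k + \<epsilon> * (\<bar>s\<bar> + \<bar>k\<bar>)"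
    proof (intro exI[of _ e] conjI allI impI)
      fix s k assume a: "\<bar>s\<bar> < e" "\<bar>k\<bar> < e" "(0 + s, t0 + k) \<in> strip L"
      define \<sigma> where "\<sigma> = s / \<nu>"
      have k: "\<bar>k\<bar> < d / 2" "\<bar>k\<bar> < t0 / 2" and "s < L" using a by (auto simp: e_def)
      have "s < d / 2 * \<nu>" "s < t0 / 2 * \<nu>" "0 \<le> s" using a by (auto simp: e_def)
      then have s: "0 \<le> s" "0 \<le> \<sigma>" "\<sigma> < d / 2" "\<sigma> < t0 / 2" "\<nu> * \<sigma> = s"
        using \<nu>(1) by (auto simp: \<sigma>_def pos_divide_less_eq)
      have "U (s, t0 + k) \<le> U (0, t0 + k - \<sigma>) + \<kappa> * \<sigma>"
      proof (cases "s = 0")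
        case False
        then have "0 < \<sigma>" using s \<nu> by (auto simp: \<sigma>_def)
        then show ?thesis
          using transport_outward[OF U, of \<nu> \<sigma> L \<kappa> "t0 + k - \<sigma>"] \<nu> s \<open>s < L\<close> k by auto
      qed (simp add: \<sigma>_def)
      also have "U (0, t0 + k - \<sigma>) \<le> U (0, t0) + b * (k - \<sigma>) + \<epsilon>' * \<bar>k - \<sigma>\<bar>"
        using d(2)[of "k - \<sigma>"] k s by (simp add: add_diff_eq)
      also have "\<epsilon>' * \<bar>k - \<sigma>\<bar> \<le> \<epsilon>' * \<bar>k\<bar> + \<epsilon>' * \<sigma>"
        unfolding distrib_left[symmetric] using \<epsilon>' s by (intro mult_left_mono) auto
      also have "\<epsilon>' * \<bar>k\<bar> \<le> \<epsilon> * \<bar>k\<bar>" using \<epsilon>' by (intro mult_right_mono) auto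
      also have "\<epsilon>' * \<sigma> \<le> \<epsilon> * \<bar>s\<bar>"
        using mult_right_mono[OF \<epsilon>'(3) s(1)] s(1) by (simp add: \<sigma>_def)
      finally have "U (s, t0 + k) \<le> U (0, t0) + b * (k - \<sigma>) + (\<epsilon> * \<bar>k\<bar> + \<epsilon> * \<bar>s\<bar>) + \<kappa> * \<sigma>" by simp
      moreover have "(\<kappa> - b) / \<nu> * s = \<kappa> * \<sigma> - b * \<sigma>"
        by (simp add: \<sigma>_def diff_divide_distrib left_diff_distrib)
      ultimately show "U (0 + s, t0 + k) \<le> U (0, t0) + (\<kappa> - b) / \<nu> * s + b * k + \<epsilon> * (\<bar>s\<bar> + \<bar>k\<bar>)"
        by (simp add: algebra_simps)
    qed (rule e)
  qed
  then show ?thesis by blast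
qed

text \<open>Meant for viscosity subsolutions, whose vertex condition speaks of time slopes only.
  Lines ending at some x > 0 stay in the open arc, and continuity allows x to tend to 0.\<close>

lemma inward_line_continuous:
  assumes h: "strip_hamiltonian L h" and U: "continuous_on (strip L) U" "strip_sub L h U"
    and \<nu>: "0 < \<nu>" "tilt (h 0) \<nu> \<kappa>"
  shows "\<exists>d>0. \<forall>t\<ge>0. \<forall>\<sigma>. 0 < \<sigma> \<longrightarrow> \<sigma> < d \<longrightarrow> U (0, t + \<sigma>) \<le> U (\<nu> * \<sigma>, t) + \<kappa> * \<sigma>"
proof -
  have L: "0 < L" using h by (simp add: strip_hamiltonian_def)
  then have "0 \<in> {0..L}" by simp
  then obtain r where r: "r > 0" "\<And>s p. s \<in> {0..L} \<Longrightarrow> \<bar>s - 0\<bar> < r \<Longrightarrow> 0 \<le> h s p + \<nu> * p + \<kappa>"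
    by (rule tilt_nearby[OF h _ \<nu>(2)]) (rule that)
  define \<rho> where "\<rho> = min r L / 2"
  have \<rho>: "\<rho> > 0" "\<rho> < r" "\<rho> < L" using r L by (auto simp: \<rho>_def)
  show ?thesis
  proof (intro exI[of _ "\<rho> / \<nu> / 2"] conjI allI impI)
    show "0 < \<rho> / \<nu> / 2" using \<rho> \<nu> by simp
    fix t \<sigma> :: real assume t: "0 \<le> t" and \<sigma>: "0 < \<sigma>" "\<sigma> < \<rho> / \<nu> / 2"
    have ns: "0 < \<nu> * \<sigma>" "\<nu> * \<sigma> < \<rho> / 2"
      using \<sigma> \<nu>(1) by (auto simp: field_simps)
    have shift: "U (x, t + \<sigma>) \<le> U (x + \<nu> * \<sigma>, t) + \<kappa> * \<sigma>" if x: "0 < x" "x < \<rho> / 2" for x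
    proof -
      have "U (x + \<nu> * \<sigma> + - \<nu> * \<sigma>, t + \<sigma>) \<le> U (x + \<nu> * \<sigma>, t) + \<kappa> * \<sigma>"
      proof (rule transport_interior[OF usc_on_continuous[OF U(1)] U(2), of "x / 2" \<rho>])
        show "0 \<le> h s p + - (- \<nu>) * p + \<kappa>" if "s \<in> {x / 2..\<rho>}" for s p
          using r(2)[of s p] that x \<rho> by auto
      qed (use x ns \<rho> t \<sigma> in auto)
      then show ?thesis by simp
    qed
    have "((\<lambda>x. U (x + \<nu> * \<sigma>, t) + \<kappa> * \<sigma> - U (x, t + \<sigma>)) \<longlongrightarrow> U (0 + \<nu> * \<sigma>, t) + \<kappa> * \<sigma> - U (0, t + \<sigma>)) (at 0 within {0..\<rho>/2})"
    proof -
      have "continuous_on {0..\<rho>/2} (\<lambda>x. U (x + \<nu> * \<sigma>, t))" "continuous_on {0..\<rho>/2} (\<lambda>x. U (x, t + \<sigma>))"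
        by (rule continuous_on_compose2[OF U(1)]; use ns \<rho> t \<sigma> in \<open>auto intro!: continuous_intros\<close>)+
      then have "continuous_on {0..\<rho>/2} (\<lambda>x. U (x + \<nu> * \<sigma>, t) + \<kappa> * \<sigma> - U (x, t + \<sigma>))"
        by (intro continuous_intros)
      moreover have "0 \<in> {0..\<rho>/2}" using \<rho> by simp
      ultimately show ?thesis unfolding continuous_on_def by (rule bspec)
    qed
    moreover have "eventually (\<lambda>x. 0 \<le> U (x + \<nu> * \<sigma>, t) + \<kappa> * \<sigma> - U (x, t + \<sigma>)) (at 0 within {0..\<rho>/2})"
      unfolding eventually_at using shift \<rho> by (intro exI[of _ "\<rho>/2"]) (auto simp: dist_real_def)
    moreover have "at 0 within {0..\<rho>/2} \<noteq> bot" using \<rho> by (simp add: trivial_limit_within)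
    ultimately have "0 \<le> U (0 + \<nu> * \<sigma>, t) + \<kappa> * \<sigma> - U (0, t + \<sigma>)"
      by (rule tendsto_lowerbound)
    then show "U (0, t + \<sigma>) \<le> U (\<nu> * \<sigma>, t) + \<kappa> * \<sigma>" by simp
  qed
qed

text \<open>An interior point of an arc is treated as a junction of two branches.\<close>

lemma interior_comparison:
  assumes h: "strip_hamiltonian L h" and s0: "0 < s0" "s0 < L" and t: "0 < t" "0 < t'" and "a < b"
    and W: "usc_on (strip L) W" "strip_sub L h W"
    and V: "usc_on (strip L) (\<lambda>z. - V z)" "strip_super L h V"
    and joint: "\<And>\<epsilon>. \<epsilon> > 0 \<Longrightarrow> \<exists>d>0. \<forall>s k k'. s \<in> {0..L} \<longrightarrow> \<bar>k\<bar> < d \<longrightarrow> \<bar>k'\<bar> < d \<longrightarrow>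
      W (s, t' + k') - V (s, t + k) \<le> W (s0, t') - V (s0, t) + b * k' - a * k + \<epsilon> * (\<bar>k\<bar> + \<bar>k'\<bar>)"
  shows False
proof -
  have s0L: "s0 \<in> {0..L}" using s0 by simp
  obtain m where m: "\<And>p. h s0 m \<le> h s0 p" by (rule strip_hamiltonian_min[OF h s0L]) (rule that)
  \<comment> \<open>With \<nu> = 0, W grows at rate at most b - e just before t', whereas
    \<open>joint\<close> at s = s0 forces a rate of at least b - e / 2.\<close>
  have bm: "b + h s0 m \<le> 0"
  proof (rule ccontr)
    assume "\<not> b + h s0 m \<le> 0"
    define e where "e = (b + h s0 m) / 2"
    have e: "e > 0" "e - h s0 m = b - e" using \<open>\<not> b + h s0 m \<le> 0\<close> by (auto simp: e_def field_simps)
    have "tilt (h s0) (- 0) (b - e)" using tilt_zero[OF h s0L m e(1)] e(2) by simp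
    then obtain d1 where d1: "d1 > 0" "\<And>\<sigma>. 0 < \<sigma> \<Longrightarrow> \<sigma> < d1 \<Longrightarrow> W (s0, t') \<le> W (s0 - 0 * \<sigma>, t' - \<sigma>) + (b - e) * \<sigma>"
      using interior_line[OF h W s0 t(2)] by blast
    have "e / 2 > 0" using e by simp
    from joint[OF this] obtain d2 where d2: "d2 > 0" "\<And>s k k'. s \<in> {0..L} \<Longrightarrow> \<bar>k\<bar> < d2 \<Longrightarrow> \<bar>k'\<bar> < d2 \<Longrightarrow>
      W (s, t' + k') - V (s, t + k) \<le> W (s0, t') - V (s0, t) + b * k' - a * k + e / 2 * (\<bar>k\<bar> + \<bar>k'\<bar>)" by blast
    define \<sigma> where "\<sigma> = min d1 d2 / 2"
    have \<sigma>: "0 < \<sigma>" "\<sigma> < d1" "\<sigma> < d2" using d1 d2 by (auto simp: \<sigma>_def)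
    have "W (s0, t' - \<sigma>) \<le> W (s0, t') - b * \<sigma> + e / 2 * \<sigma>"
      using d2(2)[OF s0L, of 0 "- \<sigma>"] \<sigma> d2(1) by simp
    moreover have "W (s0, t') \<le> W (s0, t' - \<sigma>) + (b - e) * \<sigma>" using d1(2)[of \<sigma>] \<sigma> by simp
    moreover have "(b - e) * \<sigma> = b * \<sigma> - e * \<sigma>" "0 < e * \<sigma>" using e \<sigma> by (simp_all add: algebra_simps)
    ultimately show False by simp
  qed
  \<comment> \<open>s0 becomes the base of the branch running in direction \<tau>; the Hamiltonian
    and its minimizer are reflected with it.\<close>
  have side: "lower_jet (strip L') (\<lambda>(s, t). V (s0 + \<tau> * s, t)) 0 t (\<tau> * m) a"
    if \<tau>: "\<tau> = 1 \<or> \<tau> = -1" and L': "0 < L'" and sub: "\<And>s. s \<in> {0..L'} \<Longrightarrow> s0 + \<tau> * s \<in> {0..L}" for \<tau> L'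
  proof (rule branch_slope[where W = "\<lambda>(s, t). W (s0 + \<tau> * s, t)" and b = b and t' = t',
        OF strip_hamiltonian_affine[OF h \<tau> L' sub] t(1) \<open>a < b\<close> _ _ strip_super_affine[OF V(2) \<tau> sub]])
    have tt: "\<tau> * (\<tau> * x) = x" for x using \<tau> by auto
    show "b + h (s0 + \<tau> * 0) (\<tau> * (\<tau> * m)) \<le> 0" using bm by (simp add: tt)
    have "usc_on (strip L') (\<lambda>z. - V (s0 + \<tau> * fst z, snd z))"
      by (rule usc_on_compose[OF V(1), of "strip L'" "\<lambda>z. (s0 + \<tau> * fst z, snd z)"])
        (use sub in \<open>auto intro!: continuous_intros\<close>)
    then show "usc_on (strip L') (\<lambda>z. - (\<lambda>(s, t). V (s0 + \<tau> * s, t)) z)" by (simp add: case_prod_unfold)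
    fix \<nu> \<kappa> :: real assume \<nu>: "0 < \<nu>" "tilt (\<lambda>p. h (s0 + \<tau> * 0) (\<tau> * p)) \<nu> \<kappa>"
    then obtain \<delta> where \<delta>: "\<delta> > 0" "\<And>p. \<delta> * (1 + \<bar>p\<bar>) \<le> h s0 (\<tau> * p) + \<nu> * p + \<kappa>"
      unfolding tilt_def by auto
    have "tilt (h s0) (- (- \<tau> * \<nu>)) \<kappa>" unfolding tilt_def
    proof (intro exI[of _ \<delta>] conjI allI \<delta>(1))
      fix p
      have "\<bar>\<tau> * p\<bar> = \<bar>p\<bar>" using \<tau> by auto
      then show "\<delta> * (1 + \<bar>p\<bar>) \<le> h s0 p + - (- \<tau> * \<nu>) * p + \<kappa>" using \<delta>(2)[of "\<tau> * p"] by (simp add: tt algebra_simps)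
    qed
    from interior_line[OF h W s0 t(2) this]
    show "\<exists>d>0. \<forall>\<sigma>. 0 < \<sigma> \<longrightarrow> \<sigma> < d \<longrightarrow> (\<lambda>(s, t). W (s0 + \<tau> * s, t)) (0, t') \<le>
        (\<lambda>(s, t). W (s0 + \<tau> * s, t)) (\<nu> * \<sigma>, t' - \<sigma>) + \<kappa> * \<sigma>" by (simp add: mult.assoc)
  next
    fix \<epsilon> :: real assume "\<epsilon> > 0"
    from joint[OF this] obtain d where d: "d > 0" "\<And>s k k'. s \<in> {0..L} \<Longrightarrow> \<bar>k\<bar> < d \<Longrightarrow> \<bar>k'\<bar> < d \<Longrightarrow>
      W (s, t' + k') - V (s, t + k) \<le> W (s0, t') - V (s0, t) + b * k' - a * k + \<epsilon> * (\<bar>k\<bar> + \<bar>k'\<bar>)" by blast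
    show "\<exists>d>0. \<forall>s k k'. 0 \<le> s \<longrightarrow> s < d \<longrightarrow> \<bar>k\<bar> < d \<longrightarrow> \<bar>k'\<bar> < d \<longrightarrow>
        (\<lambda>(s, t). W (s0 + \<tau> * s, t)) (s, t' + k') - (\<lambda>(s, t). V (s0 + \<tau> * s, t)) (s, t + k)
        \<le> (\<lambda>(s, t). W (s0 + \<tau> * s, t)) (0, t') - (\<lambda>(s, t). V (s0 + \<tau> * s, t)) (0, t) + b * k' - a * k + \<epsilon> * (\<bar>k\<bar> + \<bar>k'\<bar>)"
    proof (intro exI[of _ "min d L'"] conjI allI impI)
      fix s k k' assume "0 \<le> s" "s < min d L'" "\<bar>k\<bar> < min d L'" "\<bar>k'\<bar> < min d L'"
      then show "(\<lambda>(s, t). W (s0 + \<tau> * s, t)) (s, t' + k') - (\<lambda>(s, t). V (s0 + \<tau> * s, t)) (s, t + k)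
        \<le> (\<lambda>(s, t). W (s0 + \<tau> * s, t)) (0, t') - (\<lambda>(s, t). V (s0 + \<tau> * s, t)) (0, t) + b * k' - a * k + \<epsilon> * (\<bar>k\<bar> + \<bar>k'\<bar>)"
        using d(2)[OF sub[of s], of k k'] by simp
    qed (use d L' in auto)
  qed
  have R: "lower_jet (strip (L - s0)) (\<lambda>(s, t). V (s0 + 1 * s, t)) 0 t (1 * m) a"
    by (rule side) (use s0 in auto)
  have Lf: "lower_jet (strip s0) (\<lambda>(s, t). V (s0 + - 1 * s, t)) 0 t (- 1 * m) a"
    by (rule side) (use s0 in auto)
  \<comment> \<open>The slopes m and -m on branches of opposite direction are the same slope m on
    the arc, so the two one-sided jets glue together.\<close>
  have "lower_jet (strip L) V s0 t m a"
  proof (rule lower_jetI)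
    fix \<epsilon> :: real assume \<epsilon>: "\<epsilon> > 0"
    obtain d1 where d1: "d1 > 0" "\<And>h k. \<bar>h\<bar> < d1 \<Longrightarrow> \<bar>k\<bar> < d1 \<Longrightarrow> (0 + h, t + k) \<in> strip (L - s0) \<Longrightarrow>
      (\<lambda>(s, t). V (s0 + 1 * s, t)) (0, t) + 1 * m * h + a * k - \<epsilon> * (\<bar>h\<bar> + \<bar>k\<bar>) \<le> (\<lambda>(s, t). V (s0 + 1 * s, t)) (0 + h, t + k)"
      by (rule lower_jetD[OF R \<epsilon>]) (rule that)
    obtain d2 where d2: "d2 > 0" "\<And>h k. \<bar>h\<bar> < d2 \<Longrightarrow> \<bar>k\<bar> < d2 \<Longrightarrow> (0 + h, t + k) \<in> strip s0 \<Longrightarrow>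
      (\<lambda>(s, t). V (s0 + - 1 * s, t)) (0, t) + - 1 * m * h + a * k - \<epsilon> * (\<bar>h\<bar> + \<bar>k\<bar>) \<le> (\<lambda>(s, t). V (s0 + - 1 * s, t)) (0 + h, t + k)"
      by (rule lower_jetD[OF Lf \<epsilon>]) (rule that)
    show "\<exists>d>0. \<forall>h k. \<bar>h\<bar> < d \<longrightarrow> \<bar>k\<bar> < d \<longrightarrow> (s0 + h, t + k) \<in> strip L \<longrightarrow>
        V (s0, t) + m * h + a * k - \<epsilon> * (\<bar>h\<bar> + \<bar>k\<bar>) \<le> V (s0 + h, t + k)"
    proof (intro exI[of _ "min d1 d2"] conjI allI impI)
      fix h k assume "\<bar>h\<bar> < min d1 d2" "\<bar>k\<bar> < min d1 d2" "(s0 + h, t + k) \<in> strip L"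
      then show "V (s0, t) + m * h + a * k - \<epsilon> * (\<bar>h\<bar> + \<bar>k\<bar>) \<le> V (s0 + h, t + k)"
        using d1(2)[of h k] d2(2)[of "- h" k] by (cases "0 \<le> h") auto
    qed (use d1 d2 in auto)
  qed
  then have "0 \<le> a + h s0 m" using strip_superD[OF V(2) s0 t(1)] by blast
  then show False using bm \<open>a < b\<close> by linarith
qed

section \<open>Comparison on the network\<close>

locale hj_network =
  fixes E Ep :: "'a::euclidean_space net_arc set"
    and H :: "'a hamilt" and c :: "'a \<Rightarrow> real" and m :: "'a net_arc \<Rightarrow> real"
  assumes emb: "embedded_network E"
    and orient: "orientation_of E Ep"
    and ham: "hamiltonian E H"
    and H_cont: "\<And>\<gamma>. \<gamma> \<in> E \<Longrightarrow> continuous_on ({0..len \<gamma>} \<times> UNIV) (\<lambda>(s, \<mu>). H \<gamma> s \<mu>)"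
    and H_conv: "\<And>\<gamma> s. \<gamma> \<in> E \<Longrightarrow> s \<in> {0..len \<gamma>} \<Longrightarrow> convex_on UNIV (H \<gamma> s)"
    and H_coer: "\<And>\<gamma>. \<gamma> \<in> E \<Longrightarrow> coercive_uniformly {0..len \<gamma>} (H \<gamma>)"
    and flux: "flux_limiter E Ep H c"
    and argmin: "\<And>\<gamma>. \<gamma> \<in> E \<Longrightarrow> is_arg_min (H \<gamma> 0) (\<lambda>_. True) (m \<gamma>)"
begin

abbreviation Q :: "('a \<times> real) set" where "Q \<equiv> network E \<times> {0..}"

lemma H_strip: "\<gamma> \<in> E \<Longrightarrow> strip_hamiltonian (len \<gamma>) (H \<gamma>)"
  by (intro strip_hamiltonianI H_cont H_conv H_coer len_pos[OF emb])

lemma m_min: "\<gamma> \<in> E \<Longrightarrow> H \<gamma> 0 (m \<gamma>) \<le> H \<gamma> 0 p"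
  using argmin[of \<gamma>] by (simp add: is_arg_min_linorder)

text \<open>The flux limiter is formulated over the oriented arcs through x. An arc issuing from x
  may enter only as its reversal, at parameter len \<gamma>, with the same minimum. SUP and INF are
  taken in the reals, so boundedness has to be established first.\<close>

lemma c_le:
  assumes x: "x \<in> vertices E" and \<gamma>: "\<gamma> \<in> arcs_from E x"
  shows "H \<gamma> 0 (m \<gamma>) \<le> - c x"
proof -
  let ?S = "SIGMA \<gamma>:arcs_through Ep x. {0..len \<gamma>}"
  let ?f = "\<lambda>(\<gamma>, s). INF \<mu>. H \<gamma> s \<mu>"
  have EpE: "Ep \<subseteq> E" using orient by (simp add: orientation_of_def)
  have bdd_b: "bdd_below (range (H \<gamma> s))" if a: "\<gamma> \<in> E" "s \<in> {0..len \<gamma>}" for \<gamma> s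
  proof -
    obtain \<mu> where "\<And>p. H \<gamma> s \<mu> \<le> H \<gamma> s p"
      by (rule strip_hamiltonian_min[OF H_strip[OF a(1)] a(2)]) (rule that)
    then show ?thesis by (intro bdd_belowI[of _ "H \<gamma> s \<mu>"]) auto
  qed
  have "bdd_above (\<Union>\<gamma>\<in>arcs_through Ep x. (\<lambda>s. INF \<mu>. H \<gamma> s \<mu>) ` {0..len \<gamma>})"
  proof (rule bdd_above_UN[THEN iffD2])
    show "finite (arcs_through Ep x)"
      using finite_subset[OF EpE finite_arcs[OF emb]] by (simp add: arcs_through_def)
    show "\<forall>\<gamma>\<in>arcs_through Ep x. bdd_above ((\<lambda>s. INF \<mu>. H \<gamma> s \<mu>) ` {0..len \<gamma>})"
    proof
      fix \<gamma> assume "\<gamma> \<in> arcs_through Ep x"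
      then have \<gamma>: "\<gamma> \<in> E" using EpE by (auto simp: arcs_through_def)
      have "continuous_on {0..len \<gamma>} (\<lambda>s. (\<lambda>(s, \<mu>). H \<gamma> s \<mu>) (s, 0))"
        by (rule continuous_on_compose2[OF H_cont[OF \<gamma>]]) (auto intro!: continuous_intros)
      then have "compact ((\<lambda>s. H \<gamma> s 0) ` {0..len \<gamma>})" by (intro compact_continuous_image) auto
      then have "bdd_above ((\<lambda>s. H \<gamma> s 0) ` {0..len \<gamma>})"
        by (intro bounded_imp_bdd_above compact_imp_bounded)
      then obtain M where M: "\<And>s. s \<in> {0..len \<gamma>} \<Longrightarrow> H \<gamma> s 0 \<le> M" unfolding bdd_above_def by blast
      have "(INF \<mu>. H \<gamma> s \<mu>) \<le> M" if "s \<in> {0..len \<gamma>}" for s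
        using cINF_lower[OF bdd_b[OF \<gamma> that], of 0] M[OF that] by simp
      then show "bdd_above ((\<lambda>s. INF \<mu>. H \<gamma> s \<mu>) ` {0..len \<gamma>})" by (intro bdd_aboveI[of _ M]) auto
    qed
  qed
  then have bdd: "bdd_above (?f ` ?S)" by (rule bdd_above_mono) auto
  have le: "(INF \<mu>. H \<gamma>' s \<mu>) \<le> - c x" if "\<gamma>' \<in> arcs_through Ep x" "s \<in> {0..len \<gamma>'}" for \<gamma>' s
  proof -
    have "?f (\<gamma>', s) \<le> (SUP z\<in>?S. ?f z)" by (rule cSUP_upper[OF _ bdd]) (use that in auto)
    moreover have "c x \<le> - (SUP z\<in>?S. ?f z)" using flux x unfolding flux_limiter_def by blast
    ultimately show ?thesis by simp
  qed
  have \<gamma>E: "\<gamma> \<in> E" "crv \<gamma> 0 = x" using arcs_from_D[OF emb \<gamma>] by auto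
  have L: "0 < len \<gamma>" using len_pos[OF emb \<gamma>E(1)] .
  have "(\<gamma> \<in> Ep) \<noteq> (inv_arc \<gamma> \<in> Ep)" using orient \<gamma>E(1) by (auto simp: orientation_of_def)
  then consider "\<gamma> \<in> Ep" | "inv_arc \<gamma> \<in> Ep" by blast
  then show ?thesis
  proof cases
    case 1
    have "H \<gamma> 0 (m \<gamma>) \<le> (INF \<mu>. H \<gamma> 0 \<mu>)" by (rule cINF_greatest) (auto intro: m_min \<gamma>E)
    also have "\<dots> \<le> - c x" by (rule le) (use 1 \<gamma>E L in \<open>auto simp: arcs_through_def intro!: bexI[of _ 0]\<close>)
    finally show ?thesis .
  next
    case 2
    have "H \<gamma> 0 (m \<gamma>) \<le> (INF \<mu>. H (inv_arc \<gamma>) (len \<gamma>) \<mu>)"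
    proof (rule cINF_greatest)
      fix \<mu>
      have "H (inv_arc \<gamma>) (len \<gamma>) \<mu> = H \<gamma> 0 (- \<mu>)" using ham \<gamma>E(1) L by (auto simp: hamiltonian_def)
      then show "H \<gamma> 0 (m \<gamma>) \<le> H (inv_arc \<gamma>) (len \<gamma>) \<mu>" using m_min[OF \<gamma>E(1)] by simp
    qed simp
    also have "\<dots> \<le> - c x"
    proof (rule le)
      show "inv_arc \<gamma> \<in> arcs_through Ep x" unfolding arcs_through_def
        using 2 L \<gamma>E by (auto intro!: bexI[of _ "len \<gamma>"] simp: crv_inv_arc)
    qed (use L in simp)
    finally show ?thesis .
  qed
qed

lemma flux_F_le:
  assumes "x \<in> vertices E"
  shows "flux_F E H m c x p \<le> r \<longleftrightarrow> - c x \<le> r \<and> (\<forall>\<gamma>\<in>arcs_from E x. H_minus H m \<gamma> 0 (p \<gamma>) \<le> r)"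
  unfolding flux_F_def
  using arcs_from_nonempty[OF emb assms] finite_arcs_from[OF emb] by simp

lemma flux_F_m:
  assumes "x \<in> vertices E" shows "flux_F E H m c x m \<le> - c x"
  unfolding flux_F_le[OF assms] using c_le[OF assms] by (simp add: H_minus_def)

text \<open>All arcs at a vertex share the time slope b, because a test function on the network has
  a single time derivative there, while its arc derivatives are independent.\<close>

definition net_sub :: "('a \<times> real \<Rightarrow> real) \<Rightarrow> bool" where
  "net_sub w \<longleftrightarrow> usc_on Q w \<and> (\<forall>\<gamma>\<in>E. strip_sub (len \<gamma>) (H \<gamma>) (along \<gamma> w)) \<and>
    (\<forall>x\<in>vertices E. \<forall>t>0. \<forall>p b. (\<forall>\<gamma>\<in>arcs_from E x. upper_jet (strip (len \<gamma>)) (along \<gamma> w) 0 t (p \<gamma>) b) \<longrightarrow>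
       b + flux_F E H m c x p \<le> 0)"

definition net_super :: "('a \<times> real \<Rightarrow> real) \<Rightarrow> bool" where
  "net_super v \<longleftrightarrow> usc_on Q (\<lambda>z. - v z) \<and> (\<forall>\<gamma>\<in>E. strip_super (len \<gamma>) (H \<gamma>) (along \<gamma> v)) \<and>
    (\<forall>x\<in>vertices E. \<forall>t>0. \<forall>p a. (\<forall>\<gamma>\<in>arcs_from E x. lower_jet (strip (len \<gamma>)) (along \<gamma> v) 0 t (p \<gamma>) a) \<longrightarrow>
       0 \<le> a + flux_F E H m c x p)"

lemma usc_on_along:
  assumes "usc_on Q w" "\<gamma> \<in> E"
  shows "usc_on (strip (len \<gamma>)) (along \<gamma> w)"
proof -
  have "continuous_on (strip (len \<gamma>)) (\<lambda>z. (crv \<gamma> (fst z), snd z))"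
    by (intro continuous_intros continuous_on_compose2[OF continuous_crv[OF emb assms(2)]]) auto
  moreover have "(\<lambda>z. (crv \<gamma> (fst z), snd z)) ` strip (len \<gamma>) \<subseteq> Q"
    using crv_in_network[OF emb assms(2)] by auto
  ultimately show ?thesis using usc_on_compose[OF assms(1)] by (simp add: along_def case_prod_unfold)
qed

lemma along_base: "\<gamma> \<in> arcs_from E x \<Longrightarrow> along \<gamma> w (0, t) = w (x, t)"
  using arcs_from_D(2)[OF emb] by (simp add: along_def)

context
  fixes w assumes w: "net_sub w"
begin

lemma w_usc: "usc_on Q w" and w_along: "\<gamma> \<in> E \<Longrightarrow> usc_on (strip (len \<gamma>)) (along \<gamma> w)"
  and w_sub: "\<gamma> \<in> E \<Longrightarrow> strip_sub (len \<gamma>) (H \<gamma>) (along \<gamma> w)"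
  using w usc_on_along unfolding net_sub_def by auto

lemma upper_jet_from:
  assumes "\<gamma> \<in> arcs_from E x" "0 < t" "upper_slope (\<lambda>t. w (x, t)) t b"
  shows "\<exists>p. upper_jet (strip (len \<gamma>)) (along \<gamma> w) 0 t p b"
proof -
  note \<gamma> = arcs_from_D(1)[OF emb assms(1)]
  show ?thesis
    by (rule upper_jet_base[OF H_strip[OF \<gamma>] w_along[OF \<gamma>] w_sub[OF \<gamma>] assms(2)])
      (use assms in \<open>simp add: along_base\<close>)
qed

lemma vertex_slope_le:
  assumes x: "x \<in> vertices E" and "0 < t" "upper_slope (\<lambda>t. w (x, t)) t b"
  shows "b \<le> c x"
proof -
  have "\<forall>\<gamma>\<in>arcs_from E x. \<exists>p. upper_jet (strip (len \<gamma>)) (along \<gamma> w) 0 t p b"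
    using upper_jet_from[OF _ assms(2,3)] by blast
  from bchoice[OF this] obtain p where "\<forall>\<gamma>\<in>arcs_from E x. upper_jet (strip (len \<gamma>)) (along \<gamma> w) 0 t (p \<gamma>) b"
    by blast
  then have "b + flux_F E H m c x p \<le> 0" using w x assms(2) unfolding net_sub_def by blast
  then show ?thesis using flux_F_le[OF x, of p "- b"] by simp
qed

lemma upper_slope_of_upper_jet:
  assumes \<gamma>: "\<gamma> \<in> arcs_from E x" and t: "0 < t" and j: "upper_jet (strip (len \<gamma>)) (along \<gamma> w) 0 t p b"
  shows "upper_slope (\<lambda>t. w (x, t)) t b"
  unfolding upper_slope_def
proof (intro allI impI)
  fix \<epsilon> :: real assume \<epsilon>: "\<epsilon> > 0"
  have L: "0 < len \<gamma>" using len_pos[OF emb arcs_from_D(1)[OF emb \<gamma>]] .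
  obtain d where d: "d > 0" "\<And>h k. \<bar>h\<bar> < d \<Longrightarrow> \<bar>k\<bar> < d \<Longrightarrow> (0 + h, t + k) \<in> strip (len \<gamma>) \<Longrightarrow>
      along \<gamma> w (0 + h, t + k) \<le> along \<gamma> w (0, t) + p * h + b * k + \<epsilon> * (\<bar>h\<bar> + \<bar>k\<bar>)"
    by (rule upper_jetD[OF j \<epsilon>]) (rule that)
  show "\<exists>d>0. \<forall>k. \<bar>k\<bar> < d \<longrightarrow> w (x, t + k) \<le> w (x, t) + b * k + \<epsilon> * \<bar>k\<bar>"
  proof (intro exI[of _ "min d t"] conjI allI impI)
    fix k assume k: "\<bar>k\<bar> < min d t"
    then have "0 \<le> t + k" by (simp add: abs_less_iff)
    then show "w (x, t + k) \<le> w (x, t) + b * k + \<epsilon> * \<bar>k\<bar>"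
      using d(2)[of 0 k] d(1) L \<gamma> k by (simp add: along_base)
  qed (use d t in simp)
qed

text \<open>An upper jet on one arc gives an upper time slope at the vertex, which in turn gives
  jets with the same b on all arcs. Replacing the one on \<gamma> by the given jet decouples the
  junction condition.\<close>

lemma vertex_jet_le:
  assumes x: "x \<in> vertices E" and \<gamma>: "\<gamma> \<in> arcs_from E x" and t: "0 < t"
    and j: "upper_jet (strip (len \<gamma>)) (along \<gamma> w) 0 t p b"
  shows "b + H_minus H m \<gamma> 0 p \<le> 0"
proof -
  have "upper_slope (\<lambda>t. w (x, t)) t b" by (rule upper_slope_of_upper_jet[OF \<gamma> t j])
  then have "\<forall>\<gamma>\<in>arcs_from E x. \<exists>p. upper_jet (strip (len \<gamma>)) (along \<gamma> w) 0 t p b"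
    using upper_jet_from[OF _ t] by blast
  from bchoice[OF this] obtain p' where p': "\<forall>\<gamma>\<in>arcs_from E x. upper_jet (strip (len \<gamma>)) (along \<gamma> w) 0 t (p' \<gamma>) b"
    by blast
  have "\<forall>\<gamma>'\<in>arcs_from E x. upper_jet (strip (len \<gamma>')) (along \<gamma>' w) 0 t ((p'(\<gamma> := p)) \<gamma>') b"
    using p' j by simp
  then have "b + flux_F E H m c x (p'(\<gamma> := p)) \<le> 0" using w x t unfolding net_sub_def by blast
  then have "flux_F E H m c x (p'(\<gamma> := p)) \<le> - b" by simp
  then have "H_minus H m \<gamma> 0 ((p'(\<gamma> := p)) \<gamma>) \<le> - b" using \<gamma> unfolding flux_F_le[OF x] by blast
  then show ?thesis by simp
qed

text \<open>For p \<le> m \<gamma> the junction condition is the full inequality b + H \<gamma> 0 p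
  \<le> 0. For larger p its value at m \<gamma> suffices, since \<nu> > 0 makes -\<nu> p smaller.
  Both cases give the vertex hypothesis of \<open>transport_inward\<close>.\<close>

lemma inward_line:
  assumes x: "x \<in> vertices E" and \<gamma>: "\<gamma> \<in> arcs_from E x" and \<nu>: "0 < \<nu>" "tilt (H \<gamma> 0) \<nu> \<kappa>"
  shows "\<exists>d>0. \<forall>t\<ge>0. \<forall>\<sigma>. 0 < \<sigma> \<longrightarrow> \<sigma> < d \<longrightarrow>
    along \<gamma> w (0, t + \<sigma>) \<le> along \<gamma> w (\<nu> * \<sigma>, t) + \<kappa> * \<sigma>"
proof -
  note \<gamma>E = arcs_from_D(1)[OF emb \<gamma>]
  have L: "0 < len \<gamma>" using len_pos[OF emb \<gamma>E] .
  then have "0 \<in> {0..len \<gamma>}" by simp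
  then obtain d where d: "d > 0" "\<And>s p. s \<in> {0..len \<gamma>} \<Longrightarrow> \<bar>s - 0\<bar> < d \<Longrightarrow> 0 \<le> H \<gamma> s p + \<nu> * p + \<kappa>"
    by (rule tilt_nearby[OF H_strip[OF \<gamma>E] _ \<nu>(2)]) (rule that)
  define r where "r = min d (len \<gamma>) / 2"
  have r: "0 < r" "r < d" "r \<le> len \<gamma>" using d L by (auto simp: r_def)
  have Hr: "0 \<le> H \<gamma> s p + \<nu> * p + \<kappa>" if "s \<in> {0..r}" for s p
    by (rule d(2)) (use that r in auto)
  have base: "b + - \<nu> * p \<le> \<kappa>" if y: "0 < y" "upper_jet (strip (len \<gamma>)) (along \<gamma> w) 0 y p b" for y p b
  proof (cases "p \<le> m \<gamma>")
    case True
    then have "b + H \<gamma> 0 p \<le> 0" using vertex_jet_le[OF x \<gamma> y] by (simp add: H_minus_def)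
    then show ?thesis using Hr[of 0 p] r by simp
  next
    case False
    then have "b + H \<gamma> 0 (m \<gamma>) \<le> 0" using vertex_jet_le[OF x \<gamma> y] by (simp add: H_minus_def)
    moreover have "\<nu> * m \<gamma> \<le> \<nu> * p" using False \<nu> by simp
    ultimately show ?thesis using Hr[of 0 "m \<gamma>"] r by simp
  qed
  show ?thesis
  proof (intro exI[of _ "r / \<nu>"] conjI allI impI)
    fix t \<sigma> :: real assume t: "0 \<le> t" "0 < \<sigma>" "\<sigma> < r / \<nu>"
    show "along \<gamma> w (0, t + \<sigma>) \<le> along \<gamma> w (\<nu> * \<sigma>, t) + \<kappa> * \<sigma>"
    proof (rule transport_inward[OF w_along[OF \<gamma>E] w_sub[OF \<gamma>E] \<nu>(1) _ r(3) Hr t(1,2)])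
      show "\<nu> * \<sigma> < r" using t(3) \<nu>(1) by (simp add: less_divide_eq mult.commute)
      show "b + - \<nu> * p \<le> \<kappa>" if "t < y" "upper_jet (strip (len \<gamma>)) (along \<gamma> w) 0 y p b" for y p b
        by (rule base[OF _ that(2)]) (use that(1) t(1) in linarith)
    qed
  qed (use r \<nu> in simp)
qed

end

lemma vertex_comparison:
  assumes w: "net_sub w" and v: "net_super v" and x: "x \<in> vertices E" and t: "0 < t" "0 < t'" and "a < b"
    and joint: "\<And>\<epsilon>. \<epsilon> > 0 \<Longrightarrow> \<exists>d>0. \<forall>y k k'. y \<in> network E \<longrightarrow> \<bar>k\<bar> < d \<longrightarrow> \<bar>k'\<bar> < d \<longrightarrow>
      w (y, t' + k') - v (y, t + k) \<le> w (x, t') - v (x, t) + b * k' - a * k + \<epsilon> * (\<bar>k\<bar> + \<bar>k'\<bar>)"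
  shows False
proof -
  have xN: "x \<in> network E" using x vertices_subset[OF emb] by blast
  have "upper_slope (\<lambda>t. w (x, t)) t' b" unfolding upper_slope_def
  proof (intro allI impI)
    fix \<epsilon> :: real assume "\<epsilon> > 0"
    from joint[OF this] obtain d where d: "d > 0" "\<And>y k k'. y \<in> network E \<Longrightarrow> \<bar>k\<bar> < d \<Longrightarrow> \<bar>k'\<bar> < d \<Longrightarrow>
      w (y, t' + k') - v (y, t + k) \<le> w (x, t') - v (x, t) + b * k' - a * k + \<epsilon> * (\<bar>k\<bar> + \<bar>k'\<bar>)" by blast
    show "\<exists>d>0. \<forall>k. \<bar>k\<bar> < d \<longrightarrow> w (x, t' + k) \<le> w (x, t') + b * k + \<epsilon> * \<bar>k\<bar>"
    proof (intro exI[of _ d] conjI allI impI d(1))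
      fix k assume "\<bar>k\<bar> < d"
      then show "w (x, t' + k) \<le> w (x, t') + b * k + \<epsilon> * \<bar>k\<bar>" using d(2)[OF xN, of 0 k] d(1) by simp
    qed
  qed
  then have bc: "b \<le> c x" by (rule vertex_slope_le[OF w x t(2)])
  have "lower_jet (strip (len \<gamma>)) (along \<gamma> v) 0 t (m \<gamma>) a" if \<gamma>: "\<gamma> \<in> arcs_from E x" for \<gamma>
  proof -
    note \<gamma>E = arcs_from_D(1)[OF emb \<gamma>]
    show ?thesis
    proof (rule branch_slope[where W = "along \<gamma> w" and b = b and t' = t', OF H_strip[OF \<gamma>E] t(1) \<open>a < b\<close>])
      show "b + H \<gamma> 0 (m \<gamma>) \<le> 0" using c_le[OF x \<gamma>] bc by simp
      have "usc_on (strip (len \<gamma>)) (along \<gamma> (\<lambda>z. - v z))"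
        using v \<gamma>E by (intro usc_on_along) (simp_all add: net_super_def)
      then show "usc_on (strip (len \<gamma>)) (\<lambda>z. - along \<gamma> v z)" by (simp add: along_def case_prod_unfold)
      show "strip_super (len \<gamma>) (H \<gamma>) (along \<gamma> v)" using v \<gamma>E by (simp add: net_super_def)
      fix \<nu> \<kappa> :: real assume "0 < \<nu>" "tilt (H \<gamma> 0) \<nu> \<kappa>"
      from inward_line[OF w x \<gamma> this] obtain d where d: "d > 0" "\<And>t \<sigma>. 0 \<le> t \<Longrightarrow> 0 < \<sigma> \<Longrightarrow> \<sigma> < d \<Longrightarrow>
        along \<gamma> w (0, t + \<sigma>) \<le> along \<gamma> w (\<nu> * \<sigma>, t) + \<kappa> * \<sigma>" by blast
      show "\<exists>d>0. \<forall>\<sigma>. 0 < \<sigma> \<longrightarrow> \<sigma> < d \<longrightarrow> along \<gamma> w (0, t') \<le> along \<gamma> w (\<nu> * \<sigma>, t' - \<sigma>) + \<kappa> * \<sigma>"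
      proof (intro exI[of _ "min d t'"] conjI allI impI)
        fix \<sigma> assume "0 < \<sigma>" "\<sigma> < min d t'"
        then show "along \<gamma> w (0, t') \<le> along \<gamma> w (\<nu> * \<sigma>, t' - \<sigma>) + \<kappa> * \<sigma>" using d(2)[of "t' - \<sigma>" \<sigma>] by simp
      qed (use d t in simp)
    next
      fix \<epsilon> :: real assume "\<epsilon> > 0"
      from joint[OF this] obtain d where d: "d > 0" "\<And>y k k'. y \<in> network E \<Longrightarrow> \<bar>k\<bar> < d \<Longrightarrow> \<bar>k'\<bar> < d \<Longrightarrow>
        w (y, t' + k') - v (y, t + k) \<le> w (x, t') - v (x, t) + b * k' - a * k + \<epsilon> * (\<bar>k\<bar> + \<bar>k'\<bar>)" by blast
      show "\<exists>d>0. \<forall>s k k'. 0 \<le> s \<longrightarrow> s < d \<longrightarrow> \<bar>k\<bar> < d \<longrightarrow> \<bar>k'\<bar> < d \<longrightarrow>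
        along \<gamma> w (s, t' + k') - along \<gamma> v (s, t + k) \<le> along \<gamma> w (0, t') - along \<gamma> v (0, t) + b * k' - a * k + \<epsilon> * (\<bar>k\<bar> + \<bar>k'\<bar>)"
      proof (intro exI[of _ "min d (len \<gamma>)"] conjI allI impI)
        fix s k k' assume *: "0 \<le> s" "s < min d (len \<gamma>)" "\<bar>k\<bar> < min d (len \<gamma>)" "\<bar>k'\<bar> < min d (len \<gamma>)"
        have "crv \<gamma> s \<in> network E" by (rule crv_in_network[OF emb \<gamma>E]) (use * in auto)
        then show "along \<gamma> w (s, t' + k') - along \<gamma> v (s, t + k) \<le> along \<gamma> w (0, t') - along \<gamma> v (0, t) + b * k' - a * k + \<epsilon> * (\<bar>k\<bar> + \<bar>k'\<bar>)"
          using d(2)[of "crv \<gamma> s" k k'] * \<gamma> unfolding along_base[OF \<gamma>] by (simp add: along_def)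
      qed (use d len_pos[OF emb \<gamma>E] in simp)
    qed
  qed
  then have "0 \<le> a + flux_F E H m c x m" using v x t(1) unfolding net_super_def by blast
  then show False using flux_F_m[OF x] bc \<open>a < b\<close> by linarith
qed

lemma joint_contradiction:
  assumes w: "net_sub w" and v: "net_super v" and x: "x \<in> network E" and t: "0 < t" "0 < t'" and "a < b"
    and joint: "\<And>\<epsilon>. \<epsilon> > 0 \<Longrightarrow> \<exists>d>0. \<forall>y k k'. y \<in> network E \<longrightarrow> \<bar>k\<bar> < d \<longrightarrow> \<bar>k'\<bar> < d \<longrightarrow>
      w (y, t' + k') - v (y, t + k) \<le> w (x, t') - v (x, t) + b * k' - a * k + \<epsilon> * (\<bar>k\<bar> + \<bar>k'\<bar>)"
  shows False
proof -
  obtain \<gamma> s where \<gamma>: "\<gamma> \<in> E" "s \<in> {0..len \<gamma>}" "x = crv \<gamma> s" using x unfolding network_def by blast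
  show False
  proof (cases "s = 0 \<or> s = len \<gamma>")
    case True
    then have "x \<in> vertices E" using endpoint_vertex[OF emb \<gamma>(1)] \<gamma>(3) by auto
    then show False using vertex_comparison[OF w v _ t \<open>a < b\<close> joint] by blast
  next
    case False
    show False
    proof (rule interior_comparison[OF H_strip[OF \<gamma>(1)], of s t t' a b "along \<gamma> w" "along \<gamma> v"])
      have "usc_on (strip (len \<gamma>)) (along \<gamma> (\<lambda>z. - v z))"
        using v \<gamma>(1) by (intro usc_on_along) (simp_all add: net_super_def)
      then show "usc_on (strip (len \<gamma>)) (\<lambda>z. - along \<gamma> v z)" by (simp add: along_def case_prod_unfold)
      show "strip_super (len \<gamma>) (H \<gamma>) (along \<gamma> v)" using v \<gamma> by (simp add: net_super_def)
      show "usc_on (strip (len \<gamma>)) (along \<gamma> w)" by (rule w_along[OF w \<gamma>(1)])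
      show "strip_sub (len \<gamma>) (H \<gamma>) (along \<gamma> w)" by (rule w_sub[OF w \<gamma>(1)])
      fix \<epsilon> :: real assume "\<epsilon> > 0"
      from joint[OF this] obtain d where d: "d > 0" "\<And>y k k'. y \<in> network E \<Longrightarrow> \<bar>k\<bar> < d \<Longrightarrow> \<bar>k'\<bar> < d \<Longrightarrow>
        w (y, t' + k') - v (y, t + k) \<le> w (x, t') - v (x, t) + b * k' - a * k + \<epsilon> * (\<bar>k\<bar> + \<bar>k'\<bar>)" by blast
      show "\<exists>d>0. \<forall>y k k'. y \<in> {0..len \<gamma>} \<longrightarrow> \<bar>k\<bar> < d \<longrightarrow> \<bar>k'\<bar> < d \<longrightarrow>
        along \<gamma> w (y, t' + k') - along \<gamma> v (y, t + k) \<le> along \<gamma> w (s, t') - along \<gamma> v (s, t) + b * k' - a * k + \<epsilon> * (\<bar>k\<bar> + \<bar>k'\<bar>)"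
      proof (intro exI[of _ d] conjI allI impI d(1))
        fix y k k' assume *: "y \<in> {0..len \<gamma>}" "\<bar>k\<bar> < d" "\<bar>k'\<bar> < d"
        show "along \<gamma> w (y, t' + k') - along \<gamma> v (y, t + k) \<le> along \<gamma> w (s, t') - along \<gamma> v (s, t) + b * k' - a * k + \<epsilon> * (\<bar>k\<bar> + \<bar>k'\<bar>)"
          using d(2)[OF crv_in_network[OF emb \<gamma>(1) *(1)] *(2,3)] by (simp add: along_def \<gamma>(3))
      qed
    qed (use False \<gamma> t \<open>a < b\<close> in auto)
  qed
qed

lemma comparison:
  assumes w: "net_sub w" and v: "net_super v" and init: "\<And>x. x \<in> network E \<Longrightarrow> w (x, 0) \<le> v (x, 0)"
    and z: "z \<in> Q"
  shows "w z \<le> v z"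
proof (rule ccontr)
  assume "\<not> w z \<le> v z"
  obtain x1 t1 where z1: "z = (x1, t1)" by (cases z)
  have x1: "x1 \<in> network E" "0 \<le> t1" using z z1 by auto
  define \<mu> where "\<mu> = w (x1, t1) - v (x1, t1)"
  have \<mu>: "\<mu> > 0" using \<open>\<not> w z \<le> v z\<close> z1 by (simp add: \<mu>_def)
  have t1: "0 < t1" using init[OF x1(1)] \<mu> x1(2) unfolding \<mu>_def by (cases "t1 = 0") auto
  \<comment> \<open>The penalty will keep r below t1 + 1, and |r - t| < 1 then keeps t below
    T.\<close>
  define T where "T = t1 + 2"
  define K where "K = network E \<times> {0..T} \<times> {0..T}"
  have cK: "compact K" unfolding K_def by (intro compact_Times compact_network[OF emb]) auto
  have p1: "(x1, t1, t1) \<in> K" using x1 by (simp add: K_def T_def)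
  define G where "G = (\<lambda>(x, r, t). w (x, r) - v (x, t))"
  have uG: "usc_on K G"
  proof -
    have uv: "usc_on Q (\<lambda>z. - v z)" using v by (simp add: net_super_def)
    have "usc_on K (\<lambda>z. w (fst z, fst (snd z)))"
      by (rule usc_on_compose[OF w_usc[OF w]]) (auto simp: K_def intro!: continuous_intros)
    moreover have "usc_on K (\<lambda>z. - v (fst z, snd (snd z)))"
      by (rule usc_on_compose[OF uv]) (auto simp: K_def intro!: continuous_intros)
    ultimately have "usc_on K (\<lambda>z. w (fst z, fst (snd z)) + - v (fst z, snd (snd z)))" by (rule usc_on_add)
    then show ?thesis by (simp add: G_def case_prod_unfold)
  qed
  have Kne: "K \<noteq> {}" using p1 by blast
  obtain zB where zB: "zB \<in> K" "\<And>z. z \<in> K \<Longrightarrow> G z \<le> G zB"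
    by (rule usc_on_attains_max[OF cK Kne uG]) (rule that)
  define B where "B = G zB"
  have GB: "G z \<le> B" if "z \<in> K" for z using zB(2)[OF that] by (simp add: B_def)
  have "G (x1, t1, t1) = \<mu>" by (simp add: G_def \<mu>_def)
  then have B: "\<mu> \<le> B" using GB[OF p1] by simp
  \<comment> \<open>Compactness of the network turns the initial inequality into a uniform layer
    near time 0, in both time variables.\<close>
  have "\<exists>d>0. \<forall>y\<in>network E. \<forall>r t. 0 \<le> r \<longrightarrow> r < d \<longrightarrow> 0 \<le> t \<longrightarrow> t < d \<longrightarrow> G (y, r, t) < \<mu> / 2"
  proof -
    have "\<forall>y\<in>network E. \<exists>d>0. \<forall>z\<in>K. dist z (y, 0, 0) < d \<longrightarrow> G z < \<mu> / 2"
    proof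
      fix y assume y: "y \<in> network E"
      have "(y, 0, 0) \<in> K" using y t1 by (simp add: K_def T_def)
      moreover have "G (y, 0, 0) < \<mu> / 2" using init[OF y] \<mu> by (simp add: G_def)
      ultimately show "\<exists>d>0. \<forall>z\<in>K. dist z (y, 0, 0) < d \<longrightarrow> G z < \<mu> / 2"
        using uG unfolding usc_on_def by blast
    qed
    then obtain D where D: "\<And>y. y \<in> network E \<Longrightarrow> D y > 0"
      "\<And>y z. y \<in> network E \<Longrightarrow> z \<in> K \<Longrightarrow> dist z (y, 0, 0) < D y \<Longrightarrow> G z < \<mu> / 2" by metis
    have "network E \<subseteq> (\<Union>y\<in>network E. ball y (D y / 2))" using D(1) by force
    then obtain C where C: "C \<subseteq> network E" "finite C" "network E \<subseteq> (\<Union>y\<in>C. ball y (D y / 2))"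
      using compactE_image[OF compact_network[OF emb], of "network E" "\<lambda>y. ball y (D y / 2)"] by blast
    have "\<exists>d>0. \<forall>y\<in>C. d \<le> D y / 4"
      by (rule finite_common_radius[OF C(2)]) (use D(1) C(1) in \<open>meson divide_pos_pos subsetD zero_less_numeral\<close>)
    then obtain d where d: "d > 0" "\<And>y. y \<in> C \<Longrightarrow> d \<le> D y / 4" by blast
    show ?thesis
    proof (intro exI[of _ "min d T"] conjI ballI allI impI)
      show "min d T > 0" using d t1 by (simp add: T_def)
      fix y r t assume a: "y \<in> network E" "0 \<le> r" "r < min d T" "0 \<le> t" "t < min d T"
      then obtain y' where y': "y' \<in> C" "dist y' y < D y' / 2" using C(3) by auto
      have "dist (y, r, t) (y', 0, 0) \<le> norm (y - y') + (norm r + norm t)"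
        using norm_Pair_le[of "y - y'" "(r, t)"] norm_Pair_le[of r t] by (simp add: dist_norm)
      also have "\<dots> < D y'" using y'(2) a d(2)[OF y'(1)] by (simp add: dist_norm norm_minus_commute)
      finally show "G (y, r, t) < \<mu> / 2"
        using D(2)[of y' "(y, r, t)"] y'(1) C(1) a by (auto simp: K_def)
    qed
  qed
  then obtain d0 where d0: "d0 > 0" "\<And>y r t. y \<in> network E \<Longrightarrow> 0 \<le> r \<Longrightarrow> r < d0 \<Longrightarrow> 0 \<le> t \<Longrightarrow> t < d0 \<Longrightarrow> G (y, r, t) < \<mu> / 2"
    by blast
  \<comment> \<open>Chosen so that \<theta> t1 = \<mu> / 2: half of the gap survives the penalty at
    (x1, t1, t1).\<close>
  define \<eta> where "\<eta> = \<mu> / (2 * (t1 + 1))"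
  have \<eta>: "\<eta> > 0" "\<eta> * (t1 + 1) = \<mu> / 2" using \<mu> t1 by (auto simp: \<eta>_def field_simps)
  have "1 < (t1 + 1) / t1" using t1 by simp
  then obtain n where n: "B / \<eta> < ((t1 + 1) / t1) ^ n" using real_arch_pow by blast
  then have n': "B < \<eta> * ((t1 + 1) / t1) ^ n" using \<eta> by (simp add: field_simps)
  \<comment> \<open>The linear part makes the derivative at least \<eta>, which separates the time
    slopes a and a + \<theta>' r. The power equals 1 at r = t1 but exceeds B / \<eta> at t1 + 1,
    which keeps the maximum away from the final time.\<close>
  define \<theta> where "\<theta> r = \<eta> * (r + (r / t1) ^ n)" for r
  define \<theta>' where "\<theta>' r = \<eta> * (1 + real n * (r / t1) ^ (n - 1) / t1)" for r
  have D\<theta>: "(\<theta> has_real_derivative \<theta>' r) (at r)" for r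
    unfolding \<theta>_def[abs_def] \<theta>'_def using t1 by (auto intro!: derivative_eq_intros)
  define g where "g = min 1 d0 / 2"
  have g: "g > 0" "g < 1" "g < d0" using d0 by (auto simp: g_def)
  \<comment> \<open>The quadratic term cannot exceed B at the maximum, so this choice forces |r - t|
    < g. Then r = 0 or t = 0 would put both times into the initial layer, where G < \<mu> /
    2.\<close>
  define \<epsilon> where "\<epsilon> = g\<^sup>2 / (2 * (B + 1))"
  have \<epsilon>: "\<epsilon> > 0" "2 * \<epsilon> * B < g\<^sup>2"
  proof -
    show "\<epsilon> > 0" using g B \<mu> by (simp add: \<epsilon>_def)
    have "2 * \<epsilon> * (B + 1) = g\<^sup>2" using B \<mu> by (simp add: \<epsilon>_def field_simps)
    then show "2 * \<epsilon> * B < g\<^sup>2" using \<open>\<epsilon> > 0\<close> by (simp add: algebra_simps)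
  qed
  define F where "F = (\<lambda>(x :: 'a, r, t). (r - t)\<^sup>2 / (2 * \<epsilon>) + \<theta> r)"
  have uF: "usc_on K (\<lambda>z. G z + - F z)"
  proof (rule usc_on_add[OF uG usc_on_continuous])
    show "continuous_on K (\<lambda>z. - F z)" unfolding F_def \<theta>_def case_prod_unfold
      using \<epsilon>(1) t1 by (auto intro!: continuous_intros)
  qed
  obtain zM where zM: "zM \<in> K" "\<And>z. z \<in> K \<Longrightarrow> G z + - F z \<le> G zM + - F zM"
    by (rule usc_on_attains_max[OF cK Kne uF]) (rule that)
  obtain x r t where xrt: "zM = (x, r, t)" by (cases zM) auto
  have x: "x \<in> network E" and rt: "0 \<le> r" "r \<le> T" "0 \<le> t" "t \<le> T" using zM(1) xrt by (auto simp: K_def)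
  have "F (x1, t1, t1) = \<mu> / 2" using t1 \<eta>(2) by (simp add: F_def \<theta>_def)
  then have ge: "\<mu> / 2 \<le> G zM - F zM" using zM(2)[OF p1] \<open>G (x1, t1, t1) = \<mu>\<close> by simp
  have \<theta>nn: "0 \<le> \<theta> r" using \<eta> rt t1 by (simp add: \<theta>_def)
  have sqnn: "0 \<le> (r - t)\<^sup>2 / (2 * \<epsilon>)" using \<epsilon> by simp
  have Gge: "\<mu> / 2 \<le> G (x, r, t)" using ge \<theta>nn sqnn xrt by (simp add: F_def)
  have F_le: "(r - t)\<^sup>2 / (2 * \<epsilon>) \<le> B" "\<theta> r \<le> B"
    using ge \<theta>nn sqnn GB[OF zM(1)] \<mu> xrt by (auto simp: F_def)
  have "(r - t)\<^sup>2 \<le> 2 * \<epsilon> * B" using F_le(1) \<epsilon>(1) by (simp add: field_simps)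
  then have "\<bar>r - t\<bar>\<^sup>2 < g\<^sup>2" using \<epsilon>(2) by simp
  then have near: "\<bar>r - t\<bar> < g" using g(1) by (intro power2_less_imp_less[of "\<bar>r - t\<bar>" g]) auto
  have r_lt: "r < t1 + 1"
  proof (rule ccontr)
    assume "\<not> r < t1 + 1"
    then have "((t1 + 1) / t1) ^ n \<le> (r / t1) ^ n" using t1 by (intro power_mono divide_right_mono) auto
    then have "\<eta> * ((t1 + 1) / t1) ^ n \<le> \<eta> * (r / t1) ^ n" using \<eta> by simp
    moreover have "0 \<le> \<eta> * r" using \<eta> rt by simp
    ultimately have "B < \<theta> r" using n' by (simp add: \<theta>_def algebra_simps)
    then show False using F_le(2) by simp
  qed
  have r0: "0 < r"
  proof (rule ccontr)
    assume "\<not> 0 < r"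
    then show False using d0(2)[OF x, of r t] rt near g d0(1) Gge by auto
  qed
  have t0: "0 < t"
  proof (rule ccontr)
    assume "\<not> 0 < t"
    then show False using d0(2)[OF x, of r t] rt near g d0(1) Gge by auto
  qed
  have t_lt: "t < T" "r < T" using r_lt near g by (auto simp: T_def abs_less_iff)
  define a where "a = (r - t) / \<epsilon>"
  have "0 \<le> \<eta> * (real n * (r / t1) ^ (n - 1) / t1)" using \<eta> rt t1 by simp
  then have "a < a + \<theta>' r" using \<eta>(1) by (simp add: \<theta>'_def algebra_simps)
  show False
  proof (rule joint_contradiction[OF w v x t0 r0 \<open>a < a + \<theta>' r\<close>])
    fix e :: real assume e: "e > 0"
    have "(\<theta> has_derivative (\<lambda>k. \<theta>' r * k)) (at r)"
      using D\<theta>[of r] by (simp add: has_field_derivative_def)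
    then obtain d1 where d1: "d1 > 0" "\<And>y. norm (y - r) < d1 \<Longrightarrow> norm (\<theta> y - \<theta> r - \<theta>' r * (y - r)) \<le> e / 2 * norm (y - r)"
      using e unfolding has_derivative_at_alt by (meson half_gt_zero)
    define S where "S = {d1, \<epsilon> * e / 2, r, t, T - r, T - t}"
    define d where "d = Min S"
    have d_gr: "x < d \<longleftrightarrow> (\<forall>y\<in>S. x < y)" for x
      unfolding d_def by (rule Min_gr_iff) (simp_all add: S_def)
    have "0 < \<epsilon> * e / 2" using \<epsilon>(1) e by simp
    then have d: "d > 0" unfolding d_gr using d1(1) r0 t0 t_lt by (simp add: S_def)
    show "\<exists>d>0. \<forall>y k k'. y \<in> network E \<longrightarrow> \<bar>k\<bar> < d \<longrightarrow> \<bar>k'\<bar> < d \<longrightarrow>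
      w (y, r + k') - v (y, t + k) \<le> w (x, r) - v (x, t) + (a + \<theta>' r) * k' - a * k + e * (\<bar>k\<bar> + \<bar>k'\<bar>)"
    proof (intro exI[of _ d] conjI allI impI d)
      fix y k k' assume y: "y \<in> network E" and k: "\<bar>k\<bar> < d" "\<bar>k'\<bar> < d"
      have kb: "\<bar>k\<bar> < \<epsilon> * e / 2" "\<bar>k'\<bar> < \<epsilon> * e / 2" "\<bar>k'\<bar> < d1" "\<bar>k'\<bar> < r" "\<bar>k\<bar> < t" "\<bar>k'\<bar> < T - r" "\<bar>k\<bar> < T - t"
        using k unfolding d_gr by (simp_all add: S_def)
      have "(y, r + k', t + k) \<in> K" using y kb by (auto simp: K_def abs_less_iff)
      from zM(2)[OF this] have f1: "w (y, r + k') - v (y, t + k) \<le> w (x, r) - v (x, t)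
          + ((r + k' - (t + k))\<^sup>2 / (2 * \<epsilon>) - (r - t)\<^sup>2 / (2 * \<epsilon>)) + (\<theta> (r + k') - \<theta> r)"
        by (simp add: xrt G_def F_def)
      have f2: "(r + k' - (t + k))\<^sup>2 / (2 * \<epsilon>) - (r - t)\<^sup>2 / (2 * \<epsilon>) = a * (k' - k) + (k' - k)\<^sup>2 / (2 * \<epsilon>)"
        using \<epsilon>(1) by (simp add: a_def power2_eq_square field_simps)
      have f3: "(k' - k)\<^sup>2 / (2 * \<epsilon>) \<le> e / 2 * (\<bar>k\<bar> + \<bar>k'\<bar>)"
      proof -
        have tri: "\<bar>k' - k\<bar> \<le> \<bar>k\<bar> + \<bar>k'\<bar>" using abs_triangle_ineq4[of k' k] by linarith
        then have "\<bar>k' - k\<bar> \<le> \<epsilon> * e" using kb(1,2) by linarith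
        have "(k' - k)\<^sup>2 = \<bar>k' - k\<bar> * \<bar>k' - k\<bar>" by (simp add: power2_eq_square)
        also have "\<dots> \<le> (\<epsilon> * e) * (\<bar>k\<bar> + \<bar>k'\<bar>)" 
          by (intro mult_mono tri \<open>\<bar>k' - k\<bar> \<le> \<epsilon> * e\<close>) (use \<epsilon>(1) e in auto)
        finally show ?thesis using \<epsilon>(1) by (simp add: field_simps)
      qed
      have f4: "\<theta> (r + k') - \<theta> r \<le> \<theta>' r * k' + e / 2 * \<bar>k'\<bar>"
      proof -
        have "norm (\<theta> (r + k') - \<theta> r - \<theta>' r * (r + k' - r)) \<le> e / 2 * norm (r + k' - r)"
          by (rule d1(2)) (use kb(3) in simp)
        then have "\<bar>\<theta> (r + k') - \<theta> r - \<theta>' r * k'\<bar> \<le> e / 2 * \<bar>k'\<bar>"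
          unfolding real_norm_def add_diff_cancel_left' .
        then show ?thesis using abs_ge_self[of "\<theta> (r + k') - \<theta> r - \<theta>' r * k'"] by linarith
      qed
      have f5: "e / 2 * \<bar>k'\<bar> \<le> e / 2 * (\<bar>k\<bar> + \<bar>k'\<bar>)" using e by (intro mult_left_mono) auto
      \<comment> \<open>Products and function values are abstracted to variables, so that the final
        estimate is purely linear.\<close>
      have arith: "X \<le> A + S + \<Theta> \<Longrightarrow> S = P + Z \<Longrightarrow> Z \<le> e2 \<Longrightarrow> \<Theta> \<le> q + e3 \<Longrightarrow> e3 \<le> e2 \<Longrightarrow>
          P = u - u' \<Longrightarrow> R = u + q \<Longrightarrow> e1 = e2 + e2 \<Longrightarrow> X \<le> A + R - u' + e1"
        for X A S \<Theta> P Z e2 q e3 u u' R e1 :: real by linarith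
      show "w (y, r + k') - v (y, t + k) \<le> w (x, r) - v (x, t) + (a + \<theta>' r) * k' - a * k + e * (\<bar>k\<bar> + \<bar>k'\<bar>)"
        by (rule arith[OF f1 f2 f3 f4 f5]) (simp_all add: algebra_simps)
    qed
  qed
qed

end

section \<open>Equivalence of the two notions\<close>

text \<open>Negation exchanges the two notions without using convexity, so reversal of arcs has to
  be treated for supersolutions only.\<close>

lemma strip_sub_iff_super: "strip_sub L h U \<longleftrightarrow> strip_super L (\<lambda>s p. - h s (- p)) (\<lambda>z. - U z)"
proof
  assume S: "strip_sub L h U"
  show "strip_super L (\<lambda>s p. - h s (- p)) (\<lambda>z. - U z)" unfolding strip_super_def
  proof (intro ballI allI impI)
    fix s t p a assume "s \<in> {0<..<L}" "0 < t" "lower_jet (strip L) (\<lambda>z. - U z) s t p a"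
    then have "- a + h s (- p) \<le> 0" by (intro strip_subD[OF S]) auto
    then show "0 \<le> a + - h s (- p)" by simp
  qed
next
  assume S: "strip_super L (\<lambda>s p. - h s (- p)) (\<lambda>z. - U z)"
  show "strip_sub L h U" unfolding strip_sub_def
  proof (intro ballI allI impI)
    fix s t p a assume a: "s \<in> {0<..<L}" "0 < t" "upper_jet (strip L) U s t p a"
    have "0 \<le> - a + - h s (- (- p))" by (rule strip_superD[OF S _ _ a(2,3)]) (use a in auto)
    then show "a + h s p \<le> 0" by simp
  qed
qed

lemma C1_network_uminus: "C1_network E \<Phi> \<Longrightarrow> C1_network E (\<lambda>z. - \<Phi> z)"
  unfolding C1_network_def using C1_on_uminus[of _ "along _ \<Phi>"]
  by (auto intro!: continuous_on_minus simp: along_def case_prod_unfold)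

lemma C1_on_strip_base:
  assumes "C1_on (strip L) \<phi>" "0 < L" "0 < t"
  shows "(\<phi> has_derivative (\<lambda>(h, k). partial_s {0..L} \<phi> 0 t * h + partial_t \<phi> 0 t * k)) (at (0, t) within strip L)"
proof (rule C1_on_partials[OF assms(1)])
  show "vector_derivative g (at 0 within {0..L}) = D" if "(g has_vector_derivative D) (at 0 within {0..L})"
    for g :: "real \<Rightarrow> real" and D
    by (rule vector_derivative_within_closed_interval[OF assms(2) _ that]) (use assms(2) in simp)
qed (use assms in \<open>auto simp: interior_real_atLeast\<close>)

context hj_network
begin

lemma along_uminus: "along \<gamma> (\<lambda>z. - f z) = (\<lambda>z. - along \<gamma> f z)"
  by (simp add: along_def case_prod_unfold)

lemma flux_F_cong:
  assumes "\<And>\<gamma>. \<gamma> \<in> arcs_from E x \<Longrightarrow> p \<gamma> = q \<gamma>"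
  shows "flux_F E H m c x p = flux_F E H m c x q"
proof -
  have "(\<lambda>\<gamma>. H_minus H m \<gamma> 0 (p \<gamma>)) ` arcs_from E x = (\<lambda>\<gamma>. H_minus H m \<gamma> 0 (q \<gamma>)) ` arcs_from E x"
    using assms by (auto intro!: image_cong)
  then show ?thesis unfolding flux_F_def by simp
qed

lemma arc_derivs_eq:
  assumes "\<gamma> \<in> E" "((\<lambda>s. along \<gamma> \<Phi> (s, t)) has_real_derivative p) (at 0 within {0..len \<gamma>})"
  shows "arc_derivs \<Phi> t \<gamma> = p"
  unfolding arc_derivs_def partial_s_def
  by (rule vector_derivative_within_closed_interval)
    (use assms len_pos[OF emb assms(1)] in \<open>auto simp: has_real_derivative_iff_has_vector_derivative\<close>)

lemma net_sub_usc_envelope: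
  assumes "flux_limited_subsolution E H m c u"
  shows "net_sub (usc_envelope Q u)"
proof -
  define w where "w = usc_envelope Q u"
  have lb: "locally_bounded Q u" and sub: "\<And>\<gamma>. \<gamma> \<in> E \<Longrightarrow> HJ_subsolution (len \<gamma>) (H \<gamma>) (along \<gamma> w)"
    and vert: "\<And>x t \<Psi>. x \<in> vertices E \<Longrightarrow> 0 < t \<Longrightarrow> C1_network E \<Psi> \<Longrightarrow> supertangent Q w \<Psi> (x, t) \<Longrightarrow>
      partial_t \<Psi> x t + flux_F E H m c x (arc_derivs \<Psi> t) \<le> 0"
    using assms unfolding flux_limited_subsolution_def Let_def w_def by auto
  have "b + flux_F E H m c x p \<le> 0" if x: "x \<in> vertices E" and t: "0 < t"
    and j: "\<forall>\<gamma>\<in>arcs_from E x. upper_jet (strip (len \<gamma>)) (along \<gamma> w) 0 t (p \<gamma>) b" for x t p b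
  proof -
    have j': "lower_jet (strip (len \<gamma>)) (along \<gamma> (\<lambda>z. - w z)) 0 t (- p \<gamma>) (- b)" if "\<gamma> \<in> arcs_from E x" for \<gamma>
      using j that by (simp add: along_def case_prod_unfold)
    obtain \<Phi> where \<Phi>: "C1_network E \<Phi>" "subtangent Q (\<lambda>z. - w z) \<Phi> (x, t)"
      "((\<lambda>r. \<Phi> (x, r)) has_real_derivative - b) (at t)"
      "\<And>\<gamma>. \<gamma> \<in> arcs_from E x \<Longrightarrow> ((\<lambda>s. along \<gamma> \<Phi> (s, t)) has_real_derivative - p \<gamma>) (at 0 within {0..len \<gamma>})"
      by (rule network_test_function[OF emb x t j']) (assumption, rule that)
    define \<Psi> where "\<Psi> z = - \<Phi> z" for z
    have "supertangent Q w \<Psi> (x, t)"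
      unfolding supertangent_uminus \<Psi>_def using \<Phi>(2) by simp
    then have "partial_t \<Psi> x t + flux_F E H m c x (arc_derivs \<Psi> t) \<le> 0"
      by (intro vert[OF x t]) (simp_all add: \<Psi>_def[abs_def] C1_network_uminus[OF \<Phi>(1)])
    moreover have "partial_t \<Psi> x t = b"
      unfolding partial_t_def \<Psi>_def using DERIV_minus[OF \<Phi>(3)]
      by (intro vector_derivative_at) (simp add: has_real_derivative_iff_has_vector_derivative)
    moreover have "flux_F E H m c x (arc_derivs \<Psi> t) = flux_F E H m c x p"
    proof (rule flux_F_cong, rule arc_derivs_eq)
      fix \<gamma> assume \<gamma>: "\<gamma> \<in> arcs_from E x"
      show "\<gamma> \<in> E" by (rule arcs_from_D(1)[OF emb \<gamma>])
      show "((\<lambda>s. along \<gamma> \<Psi> (s, t)) has_real_derivative p \<gamma>) (at 0 within {0..len \<gamma>})"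
        using DERIV_minus[OF \<Phi>(4)[OF \<gamma>]] by (simp add: \<Psi>_def along_def)
    qed
    ultimately show ?thesis by simp
  qed
  then show ?thesis unfolding net_sub_def w_def[symmetric]
    using usc_on_usc_envelope[OF lb] sub by (auto simp: HJ_subsolution_iff w_def)
qed

lemma net_super_lsc_envelope:
  assumes "flux_limited_supersolution E H m c u"
  shows "net_super (lsc_envelope Q u)"
proof -
  define v where "v = lsc_envelope Q u"
  have lb: "locally_bounded Q u" and sup: "\<And>\<gamma>. \<gamma> \<in> E \<Longrightarrow> HJ_supersolution (len \<gamma>) (H \<gamma>) (along \<gamma> v)"
    and vert: "\<And>x t \<Phi>. x \<in> vertices E \<Longrightarrow> 0 < t \<Longrightarrow> C1_network E \<Phi> \<Longrightarrow> subtangent Q v \<Phi> (x, t) \<Longrightarrow>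
      0 \<le> partial_t \<Phi> x t + flux_F E H m c x (arc_derivs \<Phi> t)"
    using assms unfolding flux_limited_supersolution_def Let_def v_def by auto
  have "0 \<le> a + flux_F E H m c x p" if x: "x \<in> vertices E" and t: "0 < t"
    and j: "\<forall>\<gamma>\<in>arcs_from E x. lower_jet (strip (len \<gamma>)) (along \<gamma> v) 0 t (p \<gamma>) a" for x t p a
  proof -
    have j': "lower_jet (strip (len \<gamma>)) (along \<gamma> v) 0 t (p \<gamma>) a" if "\<gamma> \<in> arcs_from E x" for \<gamma>
      using j that by blast
    obtain \<Phi> where \<Phi>: "C1_network E \<Phi>" "subtangent Q v \<Phi> (x, t)"
      "((\<lambda>r. \<Phi> (x, r)) has_real_derivative a) (at t)"
      "\<And>\<gamma>. \<gamma> \<in> arcs_from E x \<Longrightarrow> ((\<lambda>s. along \<gamma> \<Phi> (s, t)) has_real_derivative p \<gamma>) (at 0 within {0..len \<gamma>})"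
      by (rule network_test_function[OF emb x t j']) (assumption, rule that)
    have "0 \<le> partial_t \<Phi> x t + flux_F E H m c x (arc_derivs \<Phi> t)" by (rule vert[OF x t \<Phi>(1,2)])
    moreover have "partial_t \<Phi> x t = a"
      unfolding partial_t_def using \<Phi>(3)
      by (intro vector_derivative_at) (simp add: has_real_derivative_iff_has_vector_derivative)
    moreover have "flux_F E H m c x (arc_derivs \<Phi> t) = flux_F E H m c x p"
      by (rule flux_F_cong, rule arc_derivs_eq[OF _ \<Phi>(4)]) (simp_all add: arcs_from_D(1)[OF emb])
    ultimately show ?thesis by simp
  qed
  then show ?thesis unfolding net_super_def v_def[symmetric]
    using usc_on_lsc_envelope[OF lb] sup by (auto simp: HJ_supersolution_iff v_def)
qed

section \<open>Functions that agree on the network\<close>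

lemma along_eq:
  assumes "\<And>z. z \<in> Q \<Longrightarrow> f z = g z" "\<gamma> \<in> E" "z \<in> strip (len \<gamma>)"
  shows "along \<gamma> f z = along \<gamma> g z"
  using assms crv_in_network[OF emb assms(2)] by (auto simp: along_def)

lemma strip_along_cong:
  assumes "\<And>z. z \<in> Q \<Longrightarrow> f z = g z" "\<gamma> \<in> E"
  shows "strip_sub (len \<gamma>) h (along \<gamma> f) \<longleftrightarrow> strip_sub (len \<gamma>) h (along \<gamma> g)"
    and "strip_super (len \<gamma>) h (along \<gamma> f) \<longleftrightarrow> strip_super (len \<gamma>) h (along \<gamma> g)"
proof -
  have eq: "along \<gamma> f z = along \<gamma> g z" if "z \<in> strip (len \<gamma>)" for z
    by (rule along_eq[OF assms that])
  show "strip_sub (len \<gamma>) h (along \<gamma> f) \<longleftrightarrow> strip_sub (len \<gamma>) h (along \<gamma> g)"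
    by (rule strip_sub_cong) (rule eq)
  show "strip_super (len \<gamma>) h (along \<gamma> f) \<longleftrightarrow> strip_super (len \<gamma>) h (along \<gamma> g)"
    by (rule strip_super_cong) (rule eq)
qed

lemma usc_on_cong: "(\<And>z. z \<in> S \<Longrightarrow> f z = g z) \<Longrightarrow> usc_on S f \<longleftrightarrow> usc_on S g"
  unfolding usc_on_def by auto

lemma jet_base_cong:
  assumes "\<And>z. z \<in> Q \<Longrightarrow> f z = g z" "\<gamma> \<in> arcs_from E x" "0 < t"
  shows "lower_jet (strip (len \<gamma>)) (along \<gamma> f) 0 t p a \<longleftrightarrow> lower_jet (strip (len \<gamma>)) (along \<gamma> g) 0 t p a"
proof (rule lower_jet_cong)
  note \<gamma> = arcs_from_D(1)[OF emb assms(2)]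
  show "(0, t) \<in> strip (len \<gamma>)" using len_pos[OF emb \<gamma>] assms(3) by simp
  show "along \<gamma> f z = along \<gamma> g z" if "z \<in> strip (len \<gamma>)" for z by (rule along_eq[OF assms(1) \<gamma> that])
qed

lemma net_sub_cong:
  assumes eq: "\<And>z. z \<in> Q \<Longrightarrow> f z = g z" and f: "net_sub f"
  shows "net_sub g"
  unfolding net_sub_def
proof (intro conjI ballI allI impI)
  show "usc_on Q g" using w_usc[OF f] usc_on_cong[of Q f g, OF eq] by blast
  show "strip_sub (len \<gamma>) (H \<gamma>) (along \<gamma> g)" if "\<gamma> \<in> E" for \<gamma>
    using w_sub[OF f that] strip_along_cong(1)[of f g, OF eq that] by blast
  fix x t p b assume x: "x \<in> vertices E" and t: "(0::real) < t"
    and j: "\<forall>\<gamma>\<in>arcs_from E x. upper_jet (strip (len \<gamma>)) (along \<gamma> g) 0 t (p \<gamma>) b"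
  have e: "\<And>z. z \<in> Q \<Longrightarrow> - f z = - g z" by (simp add: eq)
  have "upper_jet (strip (len \<gamma>)) (along \<gamma> f) 0 t (p \<gamma>) b" if \<gamma>: "\<gamma> \<in> arcs_from E x" for \<gamma>
  proof -
    have "lower_jet (strip (len \<gamma>)) (along \<gamma> (\<lambda>z. - f z)) 0 t (- p \<gamma>) (- b) \<longleftrightarrow>
        lower_jet (strip (len \<gamma>)) (along \<gamma> (\<lambda>z. - g z)) 0 t (- p \<gamma>) (- b)"
      by (rule jet_base_cong[of "\<lambda>z. - f z" "\<lambda>z. - g z", OF e \<gamma> t])
    then show ?thesis using j \<gamma> unfolding along_uminus by blast
  qed
  then show "b + flux_F E H m c x p \<le> 0" using f x t unfolding net_sub_def by blast
qed

lemma net_super_cong: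
  assumes eq: "\<And>z. z \<in> Q \<Longrightarrow> f z = g z" and f: "net_super f"
  shows "net_super g"
  unfolding net_super_def
proof (intro conjI ballI allI impI)
  have e: "\<And>z. z \<in> Q \<Longrightarrow> - f z = - g z" by (simp add: eq)
  have "usc_on Q (\<lambda>z. - f z)" using f by (simp add: net_super_def)
  then show "usc_on Q (\<lambda>z. - g z)" using usc_on_cong[of Q "\<lambda>z. - f z" "\<lambda>z. - g z", OF e] by blast
  show "strip_super (len \<gamma>) (H \<gamma>) (along \<gamma> g)" if \<gamma>: "\<gamma> \<in> E" for \<gamma>
  proof -
    have "strip_super (len \<gamma>) (H \<gamma>) (along \<gamma> f)" using f \<gamma> by (simp add: net_super_def)
    then show ?thesis using strip_along_cong(2)[of f g, OF eq \<gamma>] by blast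
  qed
  fix x t p a assume x: "x \<in> vertices E" and t: "(0::real) < t"
    and j: "\<forall>\<gamma>\<in>arcs_from E x. lower_jet (strip (len \<gamma>)) (along \<gamma> g) 0 t (p \<gamma>) a"
  have "lower_jet (strip (len \<gamma>)) (along \<gamma> f) 0 t (p \<gamma>) a" if "\<gamma> \<in> arcs_from E x" for \<gamma>
    using jet_base_cong[of f g, OF eq that t] j that by blast
  then show "0 \<le> a + flux_F E H m c x p" using f x t unfolding net_super_def by blast
qed

section \<open>From flux limited to viscosity solutions\<close>

lemma vertex_supersolution_arc:
  assumes u: "net_sub u" "net_super u" and x: "x \<in> vertices E" and t: "0 < t"
    and \<psi>: "subtangent {0<..} (\<lambda>t. u (x, t)) \<psi> t" "(\<psi> has_real_derivative a) (at t)" and a: "a < c x"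
  shows "\<exists>\<gamma>\<in>arcs_from E x. \<forall>p' a'. lower_jet (strip (len \<gamma>)) (along \<gamma> u) 0 t p' a' \<longrightarrow> 0 \<le> a' + H \<gamma> 0 p'"
proof (rule ccontr)
  assume no: "\<not> ?thesis"
  have slope: "upper_slope (\<lambda>t. - u (x, t)) t (- a)"
    by (rule upper_slope_of_supertangent[of _ "\<lambda>t. - \<psi> t"])
      (use \<psi> t DERIV_minus in \<open>auto simp: supertangent_uminus\<close>)
  have "lower_jet (strip (len \<gamma>)) (along \<gamma> u) 0 t (m \<gamma>) a" if \<gamma>: "\<gamma> \<in> arcs_from E x" for \<gamma>
  proof -
    note \<gamma>E = arcs_from_D(1)[OF emb \<gamma>]
    have L: "0 < len \<gamma>" using len_pos[OF emb \<gamma>E] .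
    obtain p' a' where j': "lower_jet (strip (len \<gamma>)) (along \<gamma> u) 0 t p' a'" "a' + H \<gamma> 0 p' < 0"
      using no \<gamma> by (meson not_le)
    obtain \<nu> \<kappa> where \<nu>: "\<nu> > 0" "\<And>s. s \<in> {0..len \<gamma>} \<Longrightarrow> tilt (H \<gamma> s) \<nu> \<kappa>"
      by (rule tilt_small_slope[OF H_strip[OF \<gamma>E]]) (rule that)
    have "tilt (H \<gamma> 0) \<nu> \<kappa>" using \<nu>(2)[of 0] L by simp
    from inward_line[OF u(1) x \<gamma> \<nu>(1) this] obtain d1 where d1: "d1 > 0" "\<And>t \<sigma>. 0 \<le> t \<Longrightarrow> 0 < \<sigma> \<Longrightarrow> \<sigma> < d1 \<Longrightarrow>
      along \<gamma> u (0, t + \<sigma>) \<le> along \<gamma> u (\<nu> * \<sigma>, t) + \<kappa> * \<sigma>" by blast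
    \<comment> \<open>This is the jet with time slope a that \<open>lower_jet_connect\<close> asks
      for: \<psi> bounds u at the vertex from below, and the inward line carries the bound from (x,
      t + k + \<sigma>) to parameter s at time t + k.\<close>
    have "lower_jet (strip (len \<gamma>)) (along \<gamma> u) 0 t ((a - \<kappa>) / \<nu>) a"
    proof (rule lower_jetI)
      fix \<epsilon> :: real assume "\<epsilon> > 0"
      define \<epsilon>' where "\<epsilon>' = min \<epsilon> (\<epsilon> * \<nu>)"
      have \<epsilon>': "\<epsilon>' > 0" "\<epsilon>' \<le> \<epsilon>" "\<epsilon>' / \<nu> \<le> \<epsilon>" using \<open>\<epsilon> > 0\<close> \<nu>(1)
        by (auto simp: \<epsilon>'_def min_less_iff_conj divide_le_eq)
      obtain d2 where d2: "d2 > 0" "\<And>k. \<bar>k\<bar> < d2 \<Longrightarrow> - u (x, t + k) \<le> - u (x, t) + - a * k + \<epsilon>' * \<bar>k\<bar>"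
        by (rule upper_slopeD[OF slope \<epsilon>'(1)]) (rule that)
      define d where "d = min (d2 / 2) (min (d2 / 2 * \<nu>) (d1 * \<nu>))"
      have d: "d > 0" using d1(1) d2(1) \<nu>(1) by (simp add: d_def)
      show "\<exists>d>0. \<forall>s k. \<bar>s\<bar> < d \<longrightarrow> \<bar>k\<bar> < d \<longrightarrow> (0 + s, t + k) \<in> strip (len \<gamma>) \<longrightarrow>
        along \<gamma> u (0, t) + (a - \<kappa>) / \<nu> * s + a * k - \<epsilon> * (\<bar>s\<bar> + \<bar>k\<bar>) \<le> along \<gamma> u (0 + s, t + k)"
      proof (intro exI[of _ d] conjI allI impI d)
        fix s k assume b: "\<bar>s\<bar> < d" "\<bar>k\<bar> < d" "(0 + s, t + k) \<in> strip (len \<gamma>)"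
        define \<sigma> where "\<sigma> = s / \<nu>"
        have "0 \<le> s" "s < d2 / 2 * \<nu>" "s < d1 * \<nu>" "\<bar>k\<bar> < d2 / 2" using b by (auto simp: d_def)
        then have s: "0 \<le> s" "0 \<le> \<sigma>" "\<sigma> < d2 / 2" "\<sigma> < d1" "\<nu> * \<sigma> = s" "\<bar>k\<bar> < d2 / 2"
          using \<nu>(1) by (auto simp: \<sigma>_def pos_divide_less_eq)
        have f1: "u (x, t + (k + \<sigma>)) \<le> along \<gamma> u (s, t + k) + \<kappa> * \<sigma>"
        proof (cases "s = 0")
          case False
          then have "0 < \<sigma>" using s \<nu>(1) by (auto simp: \<sigma>_def)
          then show ?thesis using d1(2)[of "t + k" \<sigma>] s b by (simp add: along_base[OF \<gamma>] add.assoc)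
        qed (simp add: \<sigma>_def along_base[OF \<gamma>])
        have "\<bar>k + \<sigma>\<bar> < d2" using s abs_triangle_ineq[of k \<sigma>] by simp
        from d2(2)[OF this] have f2: "u (x, t) + a * (k + \<sigma>) - \<epsilon>' * \<bar>k + \<sigma>\<bar> \<le> u (x, t + (k + \<sigma>))" by simp
        have "\<epsilon>' * \<bar>k + \<sigma>\<bar> \<le> \<epsilon>' * (\<bar>k\<bar> + \<sigma>)"
          using \<epsilon>'(1) s(2) abs_triangle_ineq[of k \<sigma>] by (intro mult_left_mono) auto
        also have "\<dots> = \<epsilon>' * \<bar>k\<bar> + \<epsilon>' / \<nu> * s" by (simp add: \<sigma>_def algebra_simps)
        also have "\<dots> \<le> \<epsilon> * \<bar>k\<bar> + \<epsilon> * s" using \<epsilon>' s(1) by (intro add_mono mult_right_mono) auto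
        finally have f3: "\<epsilon>' * \<bar>k + \<sigma>\<bar> \<le> \<epsilon> * (\<bar>s\<bar> + \<bar>k\<bar>)" using s(1) by (simp add: algebra_simps)
        have f4: "(a - \<kappa>) / \<nu> * s = a * \<sigma> - \<kappa> * \<sigma>"
          by (simp add: \<sigma>_def diff_divide_distrib left_diff_distrib)
        have f5: "a * (k + \<sigma>) = a * k + a * \<sigma>" by (simp add: algebra_simps)
        show "along \<gamma> u (0, t) + (a - \<kappa>) / \<nu> * s + a * k - \<epsilon> * (\<bar>s\<bar> + \<bar>k\<bar>) \<le> along \<gamma> u (0 + s, t + k)"
          using f1 f2 f3 unfolding f4 f5 along_base[OF \<gamma>] add_0 by linarith
      qed
    qed
    moreover have "usc_on (strip (len \<gamma>)) (\<lambda>z. - along \<gamma> u z)"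
    proof -
      have "usc_on (strip (len \<gamma>)) (along \<gamma> (\<lambda>z. - u z))"
        using u(2) \<gamma>E by (intro usc_on_along) (simp_all add: net_super_def)
      then show ?thesis by (simp add: along_def case_prod_unfold)
    qed
    moreover have "strip_super (len \<gamma>) (H \<gamma>) (along \<gamma> u)" using u(2) \<gamma>E by (simp add: net_super_def)
    moreover have "a + H \<gamma> 0 (m \<gamma>) < 0" using c_le[OF x \<gamma>] a by linarith
    ultimately show ?thesis
      using lower_jet_connect[OF H_strip[OF \<gamma>E] t _ _ j'] by blast
  qed
  then have "0 \<le> a + flux_F E H m c x m" using u(2) x t unfolding net_super_def by blast
  then show False using flux_F_m[OF x] a by linarith
qed

lemma has_derivative_of_C1:
  assumes "\<psi> C1_differentiable_on {0<..}" "0 < (t::real)"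
  shows "(\<psi> has_real_derivative deriv \<psi> t) (at t)"
proof -
  obtain D where "(\<psi> has_vector_derivative D t) (at t)"
    using assms unfolding C1_differentiable_on_def by auto
  then have "(\<psi> has_real_derivative D t) (at t)" by (simp add: has_real_derivative_iff_has_vector_derivative)
  then show ?thesis using DERIV_imp_deriv by metis
qed

lemma flux_limited_imp_viscosity:
  assumes lb: "locally_bounded Q u" and fl: "flux_limited_solution E H m c u0 u"
  shows "viscosity_solution E Ep H c u0 u"
proof -
  define w where "w = usc_envelope Q u"
  define v where "v = lsc_envelope Q u"
  have sub: "net_sub w" and sup: "net_super v"
    and init: "\<And>x. x \<in> network E \<Longrightarrow> w (x, 0) \<le> u0 x \<and> u0 x \<le> v (x, 0)"
    using fl net_sub_usc_envelope net_super_lsc_envelope unfolding flux_limited_solution_def w_def v_def by auto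
  have "w z \<le> v z" if "z \<in> Q" for z
    by (rule comparison[OF sub sup _ that]) (use init in force)
  then have cont: "continuous_on Q u"
    unfolding w_def v_def by (rule continuous_on_envelopes[OF lb])
  have wu: "w z = u z" and vu: "v z = u z" if "z \<in> Q" for z
    using usc_envelope_continuous[OF lb cont that] lsc_envelope_continuous[OF lb cont that] by (auto simp: w_def v_def)
  have u: "net_sub u" "net_super u"
    using net_sub_cong[of w u, OF wu sub] net_super_cong[of v u, OF vu sup] by blast+
  have EpE: "Ep \<subseteq> E" using orient by (simp add: orientation_of_def)
  have "viscosity_subsolution E Ep H c u" unfolding viscosity_subsolution_def
  proof (intro conjI ballI allI impI cont)
    fix \<gamma> assume "\<gamma> \<in> Ep"
    then show "HJ_subsolution (len \<gamma>) (H \<gamma>) (along \<gamma> u)" using w_sub[OF u(1)] EpE by (auto simp: HJ_subsolution_iff)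
  next
    fix x and t :: real and \<psi>
    assume x: "x \<in> vertices E" and t: "0 < t" and \<psi>: "\<psi> C1_differentiable_on {0<..} \<and> supertangent {0<..} (\<lambda>t. u (x, t)) \<psi> t"
    then have "upper_slope (\<lambda>t. u (x, t)) t (deriv \<psi> t)"
      by (intro upper_slope_of_supertangent[of _ \<psi>] has_derivative_of_C1) auto
    then show "deriv \<psi> t \<le> c x" by (rule vertex_slope_le[OF u(1) x t])
  qed
  moreover have "viscosity_supersolution E Ep H c u" unfolding viscosity_supersolution_def
  proof (intro conjI ballI allI impI cont)
    fix \<gamma> assume "\<gamma> \<in> Ep"
    then show "HJ_supersolution (len \<gamma>) (H \<gamma>) (along \<gamma> u)" using u(2) EpE by (auto simp: HJ_supersolution_iff net_super_def)
  next
    fix x and t :: real and \<psi>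
    assume x: "x \<in> vertices E" and t: "0 < t"
      and \<psi>: "\<psi> C1_differentiable_on {0<..} \<and> subtangent {0<..} (\<lambda>t. u (x, t)) \<psi> t \<and> deriv \<psi> t < c x"
    obtain \<gamma> where \<gamma>: "\<gamma> \<in> arcs_from E x"
      "\<And>p a. lower_jet (strip (len \<gamma>)) (along \<gamma> u) 0 t p a \<Longrightarrow> 0 \<le> a + H \<gamma> 0 p"
      using vertex_supersolution_arc[OF u x t, of \<psi> "deriv \<psi> t"] has_derivative_of_C1[of \<psi> t] \<psi> t by blast
    have L: "0 < len \<gamma>" using len_pos[OF emb arcs_from_D(1)[OF emb \<gamma>(1)]] .
    show "\<exists>\<gamma>\<in>arcs_from E x. \<forall>\<phi>. C1_on ({0..len \<gamma>} \<times> {0..}) \<phi> \<and>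
        subtangent ({0..len \<gamma>} \<times> {0..}) (along \<gamma> u) \<phi> (0, t) \<longrightarrow>
        partial_t \<phi> 0 t + H \<gamma> 0 (partial_s {0..len \<gamma>} \<phi> 0 t) \<ge> 0"
    proof (intro bexI[OF _ \<gamma>(1)] allI impI, elim conjE)
      fix \<phi> assume "C1_on (strip (len \<gamma>)) \<phi>" "subtangent (strip (len \<gamma>)) (along \<gamma> u) \<phi> (0, t)"
      from \<gamma>(2)[OF lower_jet_of_subtangent[OF C1_on_strip_base[OF this(1) L t] this(2)]]
      show "partial_t \<phi> 0 t + H \<gamma> 0 (partial_s {0..len \<gamma>} \<phi> 0 t) \<ge> 0" .
    qed
  qed
  moreover have "u (x, 0) = u0 x" if "x \<in> network E" for x
    using init[OF that] wu[of "(x, 0)"] vu[of "(x, 0)"] that by force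
  ultimately show ?thesis unfolding viscosity_solution_def by blast
qed

section \<open>From viscosity to flux limited solutions\<close>

lemma network_test_jet:
  assumes \<gamma>: "\<gamma> \<in> arcs_from E x" and t: "0 < t" and \<Phi>: "C1_network E \<Phi>" "subtangent Q v \<Phi> (x, t)"
  shows "lower_jet (strip (len \<gamma>)) (along \<gamma> v) 0 t (arc_derivs \<Phi> t \<gamma>) (partial_t \<Phi> x t)"
proof -
  note \<gamma>E = arcs_from_D(1)[OF emb \<gamma>]
  have L: "0 < len \<gamma>" using len_pos[OF emb \<gamma>E] .
  have "C1_on (strip (len \<gamma>)) (along \<gamma> \<Phi>)" using \<Phi>(1) \<gamma>E unfolding C1_network_def by blast
  from C1_on_strip_base[OF this L t]
  have D: "(along \<gamma> \<Phi> has_derivative (\<lambda>(h, k). arc_derivs \<Phi> t \<gamma> * h + partial_t \<Phi> x t * k)) (at (0, t) within strip (len \<gamma>))"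
    by (simp add: arc_derivs_def partial_t_def along_base[OF \<gamma>])
  have "subtangent (strip (len \<gamma>)) (along \<gamma> v) (along \<gamma> \<Phi>) (0, t)"
  proof -
    obtain d where d: "d > 0" "\<And>z. z \<in> Q \<Longrightarrow> z \<noteq> (x, t) \<Longrightarrow> dist z (x, t) < d \<Longrightarrow> v (x, t) - \<Phi> (x, t) \<le> v z - \<Phi> z"
      using \<Phi>(2) unfolding subtangent_def eventually_at by blast
    have "0 \<in> {0..len \<gamma>}" "d / 2 > 0" using L d by auto
    then obtain e where e: "e > 0" "\<And>s. s \<in> {0..len \<gamma>} \<Longrightarrow> dist s 0 < e \<Longrightarrow> dist (crv \<gamma> s) (crv \<gamma> 0) < d / 2"
      using continuous_crv[OF emb \<gamma>E] unfolding continuous_on_iff by blast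
    show ?thesis
    proof (rule subtangent_boxI[of "min e (d / 2)"])
      fix h k assume a: "\<bar>h\<bar> < min e (d / 2)" "\<bar>k\<bar> < min e (d / 2)" "(0 + h, t + k) \<in> strip (len \<gamma>)"
      have "dist (crv \<gamma> h) x < d / 2" using e(2)[of h] a arcs_from_D(2)[OF emb \<gamma>] by simp
      moreover have "dist (crv \<gamma> h, t + k) (x, t) \<le> dist (crv \<gamma> h) x + \<bar>k\<bar>"
        using norm_Pair_le[of "crv \<gamma> h - x" k] by (simp add: dist_norm)
      ultimately have "dist (crv \<gamma> h, t + k) (x, t) < d" using a by simp
      moreover have "(crv \<gamma> h, t + k) \<in> Q" using a crv_in_network[OF emb \<gamma>E] by simp
      ultimately have "v (x, t) - \<Phi> (x, t) \<le> v (crv \<gamma> h, t + k) - \<Phi> (crv \<gamma> h, t + k)"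
        using d(2) by (cases "(crv \<gamma> h, t + k) = (x, t)") auto
      then show "along \<gamma> v (0, t) - along \<gamma> \<Phi> (0, t) \<le> along \<gamma> v (0 + h, t + k) - along \<gamma> \<Phi> (0 + h, t + k)"
        unfolding along_base[OF \<gamma>] by (simp add: along_def)
    qed (use e d in simp)
  qed
  then show ?thesis by (rule lower_jet_of_subtangent[OF D])
qed

text \<open>Time regularity at a vertex is read off from any arc issuing from it, since the base s =
  0 of its strip is the vertex at all times.\<close>

lemma vertex_time_derivative:
  assumes x: "x \<in> vertices E" and \<Phi>: "C1_network E \<Phi>"
  shows "(\<lambda>t. \<Phi> (x, t)) C1_differentiable_on {0<..}"
    and "0 < t \<Longrightarrow> ((\<lambda>r. \<Phi> (x, r)) has_real_derivative partial_t \<Phi> x t) (at t)"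
proof -
  obtain \<gamma> where \<gamma>: "\<gamma> \<in> arcs_from E x" using arcs_from_nonempty[OF emb x] by blast
  note \<gamma>E = arcs_from_D(1)[OF emb \<gamma>]
  have L: "0 < len \<gamma>" using len_pos[OF emb \<gamma>E] .
  have "C1_on (strip (len \<gamma>)) (along \<gamma> \<Phi>)" using \<Phi> \<gamma>E unfolding C1_network_def by blast
  then obtain p q where pq: "continuous_on (strip (len \<gamma>)) q"
    "\<And>z. z \<in> strip (len \<gamma>) \<Longrightarrow> (along \<gamma> \<Phi> has_derivative (\<lambda>(h, k). p z * h + q z * k)) (at z within strip (len \<gamma>))"
    unfolding C1_on_def by blast
  have D: "((\<lambda>r. \<Phi> (x, r)) has_real_derivative q (0, t)) (at t)" if t: "0 < t" for t
  proof -
    have "((\<lambda>r. along \<gamma> \<Phi> (0, r)) has_derivative (\<lambda>k. (\<lambda>(h, k). p (0, t) * h + q (0, t) * k) (0, k))) (at t within {0..})"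
      by (rule has_derivative_in_compose2[where t = "strip (len \<gamma>)" and f = "\<lambda>r. (0, r)" and g = "along \<gamma> \<Phi>"
          and g' = "\<lambda>z (h, k). p z * h + q z * k", THEN has_derivative_eq_rhs])
        (use pq L t in \<open>auto intro!: derivative_eq_intros\<close>)
    moreover have "at t within {0..} = at t" by (rule at_within_interior) (use t in \<open>simp add: interior_real_atLeast\<close>)
    ultimately show ?thesis
      by (simp add: along_base[OF \<gamma>] has_field_derivative_def)
  qed
  have "continuous_on {0<..} (\<lambda>t. q (0, t))"
    by (rule continuous_on_compose2[OF pq(1)]) (use L in \<open>auto intro!: continuous_intros\<close>)
  then show "(\<lambda>t. \<Phi> (x, t)) C1_differentiable_on {0<..}"
    unfolding C1_differentiable_on_def using D
    by (intro exI[of _ "\<lambda>t. q (0, t)"]) (auto simp: has_real_derivative_iff_has_vector_derivative)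
  show "((\<lambda>r. \<Phi> (x, r)) has_real_derivative partial_t \<Phi> x t) (at t)" if t: "0 < t"
    using D[OF t] unfolding partial_t_def
    by (metis has_real_derivative_iff_has_vector_derivative vector_derivative_at)
qed

lemma subtangent_vertex_time:
  assumes "subtangent Q v \<Phi> (x, t)" "x \<in> network E"
  shows "subtangent {0<..} (\<lambda>t. v (x, t)) (\<lambda>t. \<Phi> (x, t)) t"
proof -
  obtain d where d: "d > 0" "\<And>z. z \<in> Q \<Longrightarrow> z \<noteq> (x, t) \<Longrightarrow> dist z (x, t) < d \<Longrightarrow> v (x, t) - \<Phi> (x, t) \<le> v z - \<Phi> z"
    using assms(1) unfolding subtangent_def eventually_at by blast
  have "v (x, t) - \<Phi> (x, t) \<le> v (x, r) - \<Phi> (x, r)" if "0 < r" "r \<noteq> t" "dist r t < d" for r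
    by (rule d(2)) (use that assms(2) in \<open>auto simp: dist_Pair_Pair\<close>)
  then show ?thesis unfolding subtangent_def eventually_at using d(1) by (intro exI[of _ d]) auto
qed

text \<open>Viscosity solutions satisfy the equation on oriented arcs, flux limited ones on all
  arcs; reversal bridges the two.\<close>

lemma strip_super_reflect:
  assumes \<gamma>: "\<gamma> \<in> E" and V: "strip_super (len \<gamma>) h (along (inv_arc \<gamma>) v)"
    and h: "\<And>s p. s \<in> {0..len \<gamma>} \<Longrightarrow> h (len \<gamma> - s) (- p) = h' s p"
  shows "strip_super (len \<gamma>) h' (along \<gamma> v)"
proof -
  have "strip_super (len \<gamma>) (\<lambda>s p. h (len \<gamma> + - 1 * s) (- 1 * p)) (\<lambda>(s, t). along (inv_arc \<gamma>) v (len \<gamma> + - 1 * s, t))"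
    by (rule strip_super_affine[OF V]) auto
  then have "strip_super (len \<gamma>) (\<lambda>s p. h (len \<gamma> - s) (- p)) (along \<gamma> v)"
    by (subst strip_super_cong[where g = "\<lambda>(s, t). along (inv_arc \<gamma>) v (len \<gamma> + - 1 * s, t)"])
      (auto simp: along_def crv_inv_arc)
  then show ?thesis using h unfolding strip_super_def by simp
qed

lemma viscosity_imp_flux_limited:
  assumes lb: "locally_bounded Q u" and vs: "viscosity_solution E Ep H c u0 u"
  shows "flux_limited_solution E H m c u0 u"
proof -
  have sub: "viscosity_subsolution E Ep H c u" and sup: "viscosity_supersolution E Ep H c u"
    and init: "\<And>x. x \<in> network E \<Longrightarrow> u (x, 0) = u0 x"
    using vs unfolding viscosity_solution_def by auto
  have cont: "continuous_on Q u" using sub by (simp add: viscosity_subsolution_def)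
  define w where "w = usc_envelope Q u"
  define v where "v = lsc_envelope Q u"
  have wu: "u z = w z" and vu: "u z = v z" if "z \<in> Q" for z
    using usc_envelope_continuous[OF lb cont that] lsc_envelope_continuous[OF lb cont that] by (auto simp: w_def v_def)
  have Hrefl: "H (inv_arc \<gamma>) (len \<gamma> - s) (- p) = H \<gamma> s p" if "\<gamma> \<in> E" "s \<in> {0..len \<gamma>}" for \<gamma> s p
  proof -
    have "len \<gamma> - s \<in> {0..len \<gamma>}" using that by auto
    then have "H (inv_arc \<gamma>) (len \<gamma> - s) (- p) = H \<gamma> (len \<gamma> - (len \<gamma> - s)) (- (- p))"
      using ham that(1) unfolding hamiltonian_def by blast
    then show ?thesis by simp
  qed
  have Ep: "\<gamma> \<in> Ep \<or> inv_arc \<gamma> \<in> Ep" if "\<gamma> \<in> E" for \<gamma> using orient that by (auto simp: orientation_of_def)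
  have Usub: "strip_sub (len \<gamma>) (H \<gamma>) (along \<gamma> u)" if \<gamma>: "\<gamma> \<in> E" for \<gamma>
    using Ep[OF \<gamma>]
  proof
    assume "\<gamma> \<in> Ep"
    then show ?thesis using sub by (simp add: viscosity_subsolution_def HJ_subsolution_iff)
  next
    assume "inv_arc \<gamma> \<in> Ep"
    then have "strip_sub (len (inv_arc \<gamma>)) (H (inv_arc \<gamma>)) (along (inv_arc \<gamma>) u)"
      using sub unfolding viscosity_subsolution_def HJ_subsolution_iff by blast
    then have "strip_super (len \<gamma>) (\<lambda>s p. - H (inv_arc \<gamma>) s (- p)) (along (inv_arc \<gamma>) (\<lambda>z. - u z))"
      unfolding strip_sub_iff_super by (simp add: along_def case_prod_unfold)
    from strip_super_reflect[OF \<gamma> this, of "\<lambda>s p. - H \<gamma> s (- p)"]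
    have "strip_super (len \<gamma>) (\<lambda>s p. - H \<gamma> s (- p)) (along \<gamma> (\<lambda>z. - u z))"
      using Hrefl[OF \<gamma>, of _ "- _"] by simp
    then show ?thesis unfolding strip_sub_iff_super by (simp add: along_def case_prod_unfold)
  qed
  have Usup: "strip_super (len \<gamma>) (H \<gamma>) (along \<gamma> u)" if \<gamma>: "\<gamma> \<in> E" for \<gamma>
    using Ep[OF \<gamma>]
  proof
    assume "\<gamma> \<in> Ep"
    then show ?thesis using sup by (simp add: viscosity_supersolution_def HJ_supersolution_iff)
  next
    assume "inv_arc \<gamma> \<in> Ep"
    then have "strip_super (len (inv_arc \<gamma>)) (H (inv_arc \<gamma>)) (along (inv_arc \<gamma>) u)"
      using sup unfolding viscosity_supersolution_def HJ_supersolution_iff by blast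
    then have "strip_super (len \<gamma>) (H (inv_arc \<gamma>)) (along (inv_arc \<gamma>) u)" by simp
    then show ?thesis by (rule strip_super_reflect[OF \<gamma>]) (rule Hrefl[OF \<gamma>])
  qed
  have "flux_limited_subsolution E H m c u"
    unfolding flux_limited_subsolution_def Let_def w_def[symmetric]
  proof (intro conjI ballI allI impI lb, goal_cases)
    case (1 \<gamma>)
    then show ?case unfolding HJ_subsolution_iff using Usub strip_along_cong(1)[of u w, OF wu 1] by blast
  next
    case (2 x t \<Psi>)
    then have x: "x \<in> vertices E" and t: "0 < t" and \<Psi>: "C1_network E \<Psi>" "supertangent Q w \<Psi> (x, t)" by auto
    have xN: "x \<in> network E" using x vertices_subset[OF emb] by blast
    define b where "b = partial_t \<Psi> x t"
    define p where "p = arc_derivs \<Psi> t"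
    have tu: "supertangent Q u \<Psi> (x, t)"
      using \<Psi>(2) wu xN t unfolding supertangent_def eventually_at by force
    then have st: "subtangent Q (\<lambda>z. - u z) (\<lambda>z. - \<Psi> z) (x, t)" by (simp add: supertangent_uminus)
    have "subtangent {0<..} (\<lambda>t. - u (x, t)) (\<lambda>t. - \<Psi> (x, t)) t" by (rule subtangent_vertex_time[OF st xN])
    then have "supertangent {0<..} (\<lambda>t. u (x, t)) (\<lambda>t. \<Psi> (x, t)) t" by (simp add: supertangent_uminus)
    moreover have "deriv (\<lambda>t. \<Psi> (x, t)) t = b"
      unfolding b_def by (rule DERIV_imp_deriv[OF vertex_time_derivative(2)[OF x \<Psi>(1) t]])
    ultimately have bc: "b \<le> c x"
      using sub x t vertex_time_derivative(1)[OF x \<Psi>(1)] unfolding viscosity_subsolution_def by blast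
    have "H_minus H m \<gamma> 0 (p \<gamma>) \<le> - b" if \<gamma>: "\<gamma> \<in> arcs_from E x" for \<gamma>
    proof (rule ccontr)
      assume no: "\<not> H_minus H m \<gamma> 0 (p \<gamma>) \<le> - b"
      note \<gamma>E = arcs_from_D(1)[OF emb \<gamma>]
      have L: "0 < len \<gamma>" using len_pos[OF emb \<gamma>E] .
      have mc: "H \<gamma> 0 (m \<gamma>) \<le> - b" using c_le[OF x \<gamma>] bc by linarith
      \<comment> \<open>For p \<gamma> \<ge> m \<gamma> the value of \<open>H_minus\<close> is the
        minimum, which is at most -b. So p \<gamma> lies to the left of the minimizer, where a
        tilted supporting line is available; inward transport along it will contradict the upper
        jet.\<close>
      then have "p \<gamma> < m \<gamma>" "- b < H \<gamma> 0 (p \<gamma>)"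
        using no unfolding H_minus_def by (cases "p \<gamma> = m \<gamma>"; auto split: if_splits)+
      moreover obtain \<delta> C where growth: "\<delta> > 0" "\<And>q. \<delta> * \<bar>q\<bar> - C \<le> H \<gamma> 0 q"
        using H_strip[OF \<gamma>E] L unfolding strip_hamiltonian_def by force
      moreover have "convex_on UNIV (H \<gamma> 0)" using H_conv[OF \<gamma>E, of 0] L by simp
      ultimately obtain \<nu> \<kappa> where \<nu>: "\<nu> > 0" "tilt (H \<gamma> 0) \<nu> \<kappa>" "\<kappa> + \<nu> * p \<gamma> < b"
        using tilt_support[of "H \<gamma> 0" \<delta> C "p \<gamma>" "m \<gamma>" b] mc by (metis le_less_trans)
      have "continuous_on (strip (len \<gamma>)) (along \<gamma> u)"
      proof -
        have "continuous_on (strip (len \<gamma>)) (\<lambda>z. u (crv \<gamma> (fst z), snd z))"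
          by (rule continuous_on_compose2[OF cont])
            (auto intro!: continuous_intros continuous_on_compose2[OF continuous_crv[OF emb \<gamma>E]] crv_in_network[OF emb \<gamma>E])
        then show ?thesis by (simp add: along_def case_prod_unfold)
      qed
      from inward_line_continuous[OF H_strip[OF \<gamma>E] this Usub[OF \<gamma>E] \<nu>(1,2)]
      obtain d1 where d1: "d1 > 0" "\<And>t \<sigma>. 0 \<le> t \<Longrightarrow> 0 < \<sigma> \<Longrightarrow> \<sigma> < d1 \<Longrightarrow>
        along \<gamma> u (0, t + \<sigma>) \<le> along \<gamma> u (\<nu> * \<sigma>, t) + \<kappa> * \<sigma>" by blast
      have j: "upper_jet (strip (len \<gamma>)) (along \<gamma> u) 0 t (p \<gamma>) b"
      proof -
        have "lower_jet (strip (len \<gamma>)) (along \<gamma> (\<lambda>z. - u z)) 0 t (arc_derivs (\<lambda>z. - \<Psi> z) t \<gamma>) (partial_t (\<lambda>z. - \<Psi> z) x t)"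
          by (rule network_test_jet[OF \<gamma> t C1_network_uminus[OF \<Psi>(1)] st])
        moreover have "partial_t (\<lambda>z. - \<Psi> z) x t = - b"
          unfolding partial_t_def using DERIV_minus[OF vertex_time_derivative(2)[OF x \<Psi>(1) t]]
          by (intro vector_derivative_at) (simp add: b_def has_real_derivative_iff_has_vector_derivative)
        moreover have "arc_derivs (\<lambda>z. - \<Psi> z) t \<gamma> = - p \<gamma>"
        proof (rule arc_derivs_eq[OF \<gamma>E])
          have "C1_on (strip (len \<gamma>)) (along \<gamma> \<Psi>)" using \<Psi>(1) \<gamma>E unfolding C1_network_def by blast
          from C1_on_strip_base[OF this L t]
          have D: "(along \<gamma> \<Psi> has_derivative (\<lambda>(h, k). p \<gamma> * h + partial_t (along \<gamma> \<Psi>) 0 t * k)) (at (0, t) within strip (len \<gamma>))"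
            by (simp add: p_def arc_derivs_def)
          have "((\<lambda>s. along \<gamma> \<Psi> (s, t)) has_derivative (\<lambda>h. (\<lambda>(h, k). p \<gamma> * h + partial_t (along \<gamma> \<Psi>) 0 t * k) (h, 0))) (at 0 within {0..len \<gamma>})"
            by (rule has_derivative_in_compose[where f = "\<lambda>s. (s, t)" and g = "along \<gamma> \<Psi>", THEN has_derivative_eq_rhs,
                  OF _ has_derivative_subset[OF D]])
              (use t in \<open>auto intro!: derivative_eq_intros\<close>)
          then have "((\<lambda>s. along \<gamma> \<Psi> (s, t)) has_real_derivative p \<gamma>) (at 0 within {0..len \<gamma>})"
            by (simp add: has_field_derivative_def)
          from DERIV_minus[OF this] show "((\<lambda>s. along \<gamma> (\<lambda>z. - \<Psi> z) (s, t)) has_real_derivative - p \<gamma>) (at 0 within {0..len \<gamma>})"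
            by (simp add: along_def)
        qed
        ultimately show ?thesis by (simp add: along_def case_prod_unfold)
      qed
      \<comment> \<open>The jet is evaluated at (\<nu> \<sigma>, t - \<sigma>), with error
        \<epsilon> (1 + \<nu>) \<sigma>; this choice makes it half of the gap left by the
        line.\<close>
      define \<epsilon> where "\<epsilon> = (b - \<kappa> - \<nu> * p \<gamma>) / (2 * (1 + \<nu>))"
      have \<epsilon>: "\<epsilon> > 0" "\<epsilon> * (1 + \<nu>) = (b - \<kappa> - \<nu> * p \<gamma>) / 2" using \<nu> by (auto simp: \<epsilon>_def field_simps)
      obtain d2 where d2: "d2 > 0" "\<And>h k. \<bar>h\<bar> < d2 \<Longrightarrow> \<bar>k\<bar> < d2 \<Longrightarrow> (0 + h, t + k) \<in> strip (len \<gamma>) \<Longrightarrow>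
        along \<gamma> u (0 + h, t + k) \<le> along \<gamma> u (0, t) + p \<gamma> * h + b * k + \<epsilon> * (\<bar>h\<bar> + \<bar>k\<bar>)"
        by (rule upper_jetD[OF j \<epsilon>(1)]) (rule that)
      define S where "S = {d1, d2, d2 / \<nu>, t, len \<gamma> / \<nu>}"
      define \<sigma> where "\<sigma> = Min S / 2"
      have S: "finite S" "S \<noteq> {}" "\<forall>y\<in>S. 0 < y" using d1(1) d2(1) \<nu>(1) t L by (auto simp: S_def)
      then have "0 < Min S" by (subst Min_gr_iff) auto
      then have "0 < \<sigma>" "\<sigma> < Min S" by (auto simp: \<sigma>_def)
      then have \<sigma>: "0 < \<sigma>" "\<sigma> < d1" "\<sigma> < d2" "\<sigma> < d2 / \<nu>" "\<sigma> < t" "\<sigma> < len \<gamma> / \<nu>"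
        using Min_gr_iff[OF S(1,2)] by (auto simp: S_def)
      have ns: "0 < \<nu> * \<sigma>" "\<nu> * \<sigma> < d2" "\<nu> * \<sigma> < len \<gamma>"
        using \<sigma> \<nu>(1) by (auto simp: pos_less_divide_eq mult.commute)
      have "along \<gamma> u (0, t) \<le> along \<gamma> u (\<nu> * \<sigma>, t - \<sigma>) + \<kappa> * \<sigma>" using d1(2)[of "t - \<sigma>" \<sigma>] \<sigma> by simp
      moreover have "along \<gamma> u (\<nu> * \<sigma>, t - \<sigma>) \<le> along \<gamma> u (0, t) + p \<gamma> * (\<nu> * \<sigma>) + b * (- \<sigma>) + \<epsilon> * (\<nu> * \<sigma> + \<sigma>)"
        using d2(2)[of "\<nu> * \<sigma>" "- \<sigma>"] \<sigma> ns by simp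
      ultimately have "0 \<le> (\<kappa> + \<nu> * p \<gamma> - b + \<epsilon> * (1 + \<nu>)) * \<sigma>" by (simp add: algebra_simps)
      then have "0 \<le> \<kappa> + \<nu> * p \<gamma> - b + \<epsilon> * (1 + \<nu>)" using \<sigma>(1) by (simp add: zero_le_mult_iff)
      then show False unfolding \<epsilon>(2) using \<nu>(3) by argo
    qed
    then have "flux_F E H m c x p \<le> - b" unfolding flux_F_le[OF x] using bc by simp
    then show ?case by (simp add: b_def p_def)
  qed
  moreover have "flux_limited_supersolution E H m c u"
    unfolding flux_limited_supersolution_def Let_def v_def[symmetric]
  proof (intro conjI ballI allI impI lb, goal_cases)
    case (1 \<gamma>)
    then show ?case unfolding HJ_supersolution_iff using Usup strip_along_cong(2)[of u v, OF vu 1] by blast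
  next
    case (2 x t \<Phi>)
    then have x: "x \<in> vertices E" and t: "0 < t" and \<Phi>: "C1_network E \<Phi>" "subtangent Q v \<Phi> (x, t)" by auto
    have xN: "x \<in> network E" using x vertices_subset[OF emb] by blast
    define a where "a = partial_t \<Phi> x t"
    define p where "p = arc_derivs \<Phi> t"
    have tu: "subtangent Q u \<Phi> (x, t)"
      using \<Phi>(2) vu xN t unfolding subtangent_def eventually_at by force
    have F: "- c x \<le> flux_F E H m c x p" "\<And>\<gamma>. \<gamma> \<in> arcs_from E x \<Longrightarrow> H_minus H m \<gamma> 0 (p \<gamma>) \<le> flux_F E H m c x p"
      using flux_F_le[OF x, of p "flux_F E H m c x p"] by auto
    have "0 \<le> a + flux_F E H m c x p"
    proof (cases "c x \<le> a")
      case False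
      have "deriv (\<lambda>t. \<Phi> (x, t)) t = a"
        unfolding a_def by (rule DERIV_imp_deriv[OF vertex_time_derivative(2)[OF x \<Phi>(1) t]])
      then have "deriv (\<lambda>t. \<Phi> (x, t)) t < c x" using False by simp
      then obtain \<gamma> where \<gamma>: "\<gamma> \<in> arcs_from E x" "\<And>\<phi>. C1_on ({0..len \<gamma>} \<times> {0..}) \<phi> \<Longrightarrow>
          subtangent ({0..len \<gamma>} \<times> {0..}) (along \<gamma> u) \<phi> (0, t) \<Longrightarrow>
          partial_t \<phi> 0 t + H \<gamma> 0 (partial_s {0..len \<gamma>} \<phi> 0 t) \<ge> 0"
        using sup x t subtangent_vertex_time[OF tu xN] vertex_time_derivative(1)[OF x \<Phi>(1)]
        unfolding viscosity_supersolution_def by blast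
      have L: "0 < len \<gamma>" using len_pos[OF emb arcs_from_D(1)[OF emb \<gamma>(1)]] .
      have "lower_jet (strip (len \<gamma>)) (along \<gamma> u) 0 t (p \<gamma>) a"
        unfolding p_def a_def by (rule network_test_jet[OF \<gamma>(1) t \<Phi>(1) tu])
      \<comment> \<open>\<open>H_minus\<close> at p \<gamma> is H at min (p \<gamma>) (m \<gamma>),
        and lowering the slope of a lower jet at the base is allowed. So the full Hamiltonian in the
        viscosity condition already yields the decreasing part.\<close>
      then have j: "lower_jet (strip (len \<gamma>)) (along \<gamma> u) 0 t (min (p \<gamma>) (m \<gamma>)) a"
        by (rule lower_jet_strip_mono) simp
      obtain \<phi> where \<phi>: "\<And>T. C1_on T \<phi>" "\<And>T. T \<subseteq> strip (len \<gamma>) \<Longrightarrow> subtangent T (along \<gamma> u) \<phi> (0, t)"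
        "((\<lambda>r. \<phi> (r, t)) has_real_derivative min (p \<gamma>) (m \<gamma>)) (at 0)" "((\<lambda>r. \<phi> (0, r)) has_real_derivative a) (at t)"
        by (rule C1_test_function[OF j]) (rule that)
      have "partial_t \<phi> 0 t = a"
        unfolding partial_t_def using \<phi>(4)
        by (intro vector_derivative_at) (simp add: has_real_derivative_iff_has_vector_derivative)
      moreover have "partial_s {0..len \<gamma>} \<phi> 0 t = min (p \<gamma>) (m \<gamma>)"
        unfolding partial_s_def using \<phi>(3) L
        by (intro vector_derivative_within_closed_interval)
          (auto simp: has_real_derivative_iff_has_vector_derivative intro: has_vector_derivative_at_within)
      ultimately have "0 \<le> a + H \<gamma> 0 (min (p \<gamma>) (m \<gamma>))"
        using \<gamma>(2)[OF \<phi>(1) \<phi>(2)[OF subset_refl]] by simp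
      moreover have "H_minus H m \<gamma> 0 (p \<gamma>) = H \<gamma> 0 (min (p \<gamma>) (m \<gamma>))" by (simp add: H_minus_def min_def)
      ultimately show ?thesis using F(2)[OF \<gamma>(1)] by simp
    qed (use F(1) in simp)
    then show ?case by (simp add: a_def p_def)
  qed
  moreover have "usc_envelope Q u (x, 0) \<le> u0 x \<and> u0 x \<le> lsc_envelope Q u (x, 0)" if "x \<in> network E" for x
    using init[OF that] wu[of "(x, 0)"] vu[of "(x, 0)"] that by (simp add: w_def v_def)
  ultimately show ?thesis unfolding flux_limited_solution_def by blast
qed

end

theorem theorem3p4:
  fixes E Ep :: "'a::euclidean_space net_arc set"
    and H :: "'a net_arc \<Rightarrow> real \<Rightarrow> real \<Rightarrow> real"
    and c u0 :: "'a \<Rightarrow> real"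
    and m :: "'a net_arc \<Rightarrow> real"
    and u :: "'a \<times> real \<Rightarrow> real"
  assumes "embedded_network E"
    and "orientation_of E Ep"
    and "hamiltonian E H"
    and "\<forall>\<gamma>\<in>E. continuous_on ({0..len \<gamma>} \<times> UNIV) (\<lambda>(s, \<mu>). H \<gamma> s \<mu>)"
    and "\<forall>\<gamma>\<in>E. \<forall>s\<in>{0..len \<gamma>}. convex_on UNIV (H \<gamma> s)"
    and "\<forall>\<gamma>\<in>E. coercive_uniformly {0..len \<gamma>} (H \<gamma>)"
    and "flux_limiter E Ep H c"
    and "continuous_on (network E) u0"
    and "\<forall>\<gamma>\<in>E. is_arg_min (H \<gamma> 0) (\<lambda>_. True) (m \<gamma>)"
    and "locally_bounded (network E \<times> {0..}) u"
  shows "viscosity_solution E Ep H c u0 u \<longleftrightarrow> flux_limited_solution E H m c u0 u"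
proof -
  interpret hj_network E Ep H c m
    by unfold_locales (use assms in auto)
  show ?thesis
    using viscosity_imp_flux_limited flux_limited_imp_viscosity assms(10) by blast
qed

end
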